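(* Let $\{\zeta_j\}_{j\in\mathbb{Z}}$ be independent standard complex Gaussian random variables. For $n\ge 1$ let $$P_n(x)=\frac{1}{\sqrt{2n+1}}\sum_{j=-n}^{n}\zeta_j e^{ijx},\qquad x\in\mathbb{T}=\mathbb{R}/2\pi\mathbb{Z},$$ and let $m_n=\min_{x\in\mathbb{T}}|P_n(x)|$. Then for all $\tau>0$, $$\lim_{n\to\infty}\mathbb{P}\left(m_n\ge\frac{\tau}{n}\right)=e^{-\lambda\tau},\qquad\text{where }\lambda=2\sqrt{\pi/3}.$$
   Context: A standard complex Gaussian random variable has density $\frac1\pi e^{-|z|^2}$ with respect to Lebesgue measure on $\mathbb{C}$. Here $i=\sqrt{-1}$. *)

theory Defs
  imports "HOL-Probability.Probability"
begin

text \<open>The type \<^typ>\<open>complex\<close> is a Euclidean space with orthonormal basis \<open>1, \<i>\<close>,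
  so \<open>lborel\<close> on it is planar Lebesgue measure.\<close>

definition std_complex_gaussian :: "'a measure \<Rightarrow> ('a \<Rightarrow> complex) \<Rightarrow> bool" where
  "std_complex_gaussian M X \<longleftrightarrow>
     distributed M lborel X (\<lambda>z. ennreal (1 / pi * exp (- (cmod z)\<^sup>2)))"

definition trig_poly :: "(int \<Rightarrow> complex) \<Rightarrow> nat \<Rightarrow> real \<Rightarrow> complex" where
  "trig_poly a n x =
     1 / of_real (sqrt (2 * real n + 1)) *
       (\<Sum>j = - int n..int n. a j * exp (\<i> * of_int j * of_real x))"

text \<open>Functions on the torus are represented as \<open>2\<pi>\<close>-periodic functions on the line.
  The infimum is attained, see \<open>min_modulus_attained\<close>.\<close>

definition min_modulus :: "(int \<Rightarrow> complex) \<Rightarrow> nat \<Rightarrow> real" where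
  "min_modulus a n = (INF x. cmod (trig_poly a n x))"

lemma trig_poly_cis:
  "trig_poly a n x =
     1 / of_real (sqrt (2 * real n + 1)) * (\<Sum>j = - int n..int n. a j * cis (of_int j * x))"
  by (simp add: trig_poly_def cis_conv_exp mult.assoc)

lemma trig_poly_periodic: "trig_poly a n (x + 2 * pi * of_int k) = trig_poly a n x"
proof -
  have "cis (of_int j * (x + 2 * pi * of_int k)) = cis (of_int j * x)" for j :: int
  proof -
    have "cis (2 * pi * of_int (j * k)) = 1"
      by (rule cis_multiple_2pi) simp
    moreover have "of_int j * (x + 2 * pi * of_int k) = of_int j * x + 2 * pi * of_int (j * k)"
      by (simp add: algebra_simps)
    ultimately show ?thesis
      by (simp only: cis_mult [symmetric] mult_1_right)
  qed
  then show ?thesis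
    by (simp add: trig_poly_cis)
qed

lemma min_modulus_attained:
  obtains x where "0 \<le> x" "x \<le> 2 * pi" "min_modulus a n = cmod (trig_poly a n x)"
    "\<And>y. cmod (trig_poly a n x) \<le> cmod (trig_poly a n y)"
proof -
  have "continuous_on {0..2 * pi} (\<lambda>x. cmod (trig_poly a n x))"
    unfolding trig_poly_def by (intro continuous_intros)
  then obtain x where x: "x \<in> {0..2 * pi}"
    and le: "\<And>y. y \<in> {0..2 * pi} \<Longrightarrow> cmod (trig_poly a n x) \<le> cmod (trig_poly a n y)"
    using continuous_attains_inf [of "{0..2 * pi}" "\<lambda>x. cmod (trig_poly a n x)"] by auto
  have min: "cmod (trig_poly a n x) \<le> cmod (trig_poly a n y)" for y
  proof -
    define m where "m = \<lfloor>y / (2 * pi)\<rfloor>"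
    define k where "k = - m"
    have "of_int m \<le> y / (2 * pi)" "y / (2 * pi) \<le> of_int m + 1"
      unfolding m_def by linarith+
    then have "y + 2 * pi * of_int k \<in> {0..2 * pi}"
      by (simp add: k_def field_simps)
    from le [OF this] show ?thesis
      by (simp only: trig_poly_periodic)
  qed
  have "min_modulus a n = cmod (trig_poly a n x)"
    unfolding min_modulus_def by (rule cInf_eq_minimum) (use min in auto)
  with x min show ?thesis
    by (intro that) auto
qed

end

(* Idea: near a small value the polynomial is affine at the scale 1/n^2, so up to negligible errors m_n < \<tau>/n iff
   (n P(x), P'(x)) lies in a fixed set at some point x of a grid of mesh of order 1/n^2. At points that are much
   further apart than 1/n the pairs (P, P') are asymptotically independent Gaussian vectors, because their joint
   characteristic function is the exponential of a quadratic form that is close to the standard one, and Fourier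
   inversion turns this into a bound on densities. Grouping the grid into blocks separated by gaps, the number of
   blocks that are hit has asymptotically Poisson factorial moments: two hits at a distance well below 1/n are excluded
   since Re P would have to turn around in between, and two hits at a larger distance in the same block are
   improbable since the 2x2 covariance matrix has determinant at least of order 1/log^2 n. The Bonferroni
   inequalities then give exp(-\<lambda> \<tau>), with \<lambda> = (4/sqrt 3) E|Z| for a standard complex Gaussian Z. *)

theory Submission
  imports Defs "HOL-Real_Asymp.Real_Asymp"
begin

section \<open>Gaussian measures on Euclidean spaces\<close>

text \<open>The obstacle is the size of the probabilities: j grid points are all hit with
  probability of order n^(-2j), and there are about n^(2j) such tuples, so errors must be small
  relative to n^(-2j) and weak convergence is too coarse. Hence characteristic functions are
  compared up to \<epsilon> times a Gaussian; this costs \<epsilon> times the volume of the target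
  set, which is itself of order n^(-2j). Four parameters are removed after n. A grid cell has length
  \<open>l\<close> in the time of the affine motion; crossing times are trimmed to (1, l - 1), so
  that two cells cannot register the same crossing, and the lost share of order 1 / l vanishes as l
  grows. Slopes w are cut to c < |Re w| and |w| < C, since the crossing of Re = 0 is ill-conditioned
  for small Re w; then c tends to 0 and C to infinity. The level t tends to \<tau>, from below for
  one bound and from above for the other, and absorbs the error of linearisation. The constant:
  there are about 2 pi n^2 / (sqrt 3 l) grid points, each hit with probability about 2 \<tau> l E|Z|
  / (pi n^2), and E|Z| = sqrt pi / 2.\<close>

lemma borel_measurable_cis [measurable]: "cis \<in> borel_measurable borel"
  by (intro borel_measurable_continuous_onI continuous_intros continuous_on_cis)

text \<open>The parameter is the standard deviation of each real coordinate, so a standard complex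
  Gaussian is the case s = 1 / sqrt 2.\<close>

definition gaussian_measure :: "real \<Rightarrow> 'e::euclidean_space measure" where
  "gaussian_measure s = density lborel (\<lambda>x. ennreal (\<Prod>b\<in>Basis. normal_density 0 s (x \<bullet> b)))"

lemma sets_gaussian_measure [measurable_cong, simp]: "sets (gaussian_measure s :: 'e::euclidean_space measure) = sets borel"
  and space_gaussian_measure [simp]: "space (gaussian_measure s :: 'e::euclidean_space measure) = UNIV"
  by (simp_all add: gaussian_measure_def)

text \<open>\<open>lborel\<close> is the image of a product of real Lebesgue measures under the
  coordinate map, so integrals of products of coordinate functions factorise.\<close>

lemma lborel_integral_prod:
  fixes f :: "'e::euclidean_space \<Rightarrow> real \<Rightarrow> 'b::{real_normed_field,banach,second_countable_topology}"
  assumes f: "\<And>b. b \<in> Basis \<Longrightarrow> integrable lborel (f b)"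
  shows "(\<integral>x. (\<Prod>b\<in>Basis. f b (x \<bullet> b)) \<partial>(lborel :: 'e measure)) = (\<Prod>b\<in>Basis. \<integral>t. f b t \<partial>lborel)"
proof -
  interpret product_sigma_finite "\<lambda>_::'e. lborel :: real measure" ..
  have [measurable]: "f b \<in> borel_measurable borel" if "b \<in> Basis" for b
    using borel_measurable_integrable [OF f [OF that]] by simp
  have "(\<integral>x. (\<Prod>b\<in>Basis. f b (x \<bullet> b)) \<partial>(lborel :: 'e measure))
      = (\<integral>g. (\<Prod>b\<in>Basis. f b ((\<Sum>b'\<in>Basis. g b' *\<^sub>R b') \<bullet> b)) \<partial>(\<Pi>\<^sub>M b\<in>Basis. lborel))"
    by (subst lborel_eq, subst integral_distr) simp_all
  also have "\<dots> = (\<integral>g. (\<Prod>b\<in>Basis. f b (g b)) \<partial>(\<Pi>\<^sub>M b\<in>Basis. lborel))"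
    by (intro Bochner_Integration.integral_cong prod.cong) simp_all
  also have "\<dots> = (\<Prod>b\<in>Basis. \<integral>t. f b t \<partial>lborel)"
    by (intro product_integral_prod) (use f in auto)
  finally show ?thesis .
qed

lemma normal_density_prod:
  fixes x :: "'e::euclidean_space"
  assumes "s > 0"
  shows "(\<Prod>b\<in>Basis. normal_density 0 s (x \<bullet> b)) =
    exp (- ((norm x)\<^sup>2 / (2 * s\<^sup>2))) / (sqrt (2 * pi) * s) ^ DIM('e)"
proof -
  have "(norm x)\<^sup>2 = (\<Sum>b\<in>Basis. (x \<bullet> b)\<^sup>2)"
    by (subst power2_norm_eq_inner, subst euclidean_inner) (simp add: power2_eq_square)
  moreover have "sqrt (2 * pi * s\<^sup>2) = sqrt (2 * pi) * s"
    using assms by (simp add: real_sqrt_mult)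
  ultimately show ?thesis
    by (simp add: normal_density_def prod_dividef flip: exp_sum)
       (simp add: sum_divide_distrib sum_negf)
qed

lemma prob_space_gaussian_measure:
  fixes s :: real
  shows "s > 0 \<Longrightarrow> prob_space (gaussian_measure s :: 'e::euclidean_space measure)"
proof (rule prob_spaceI)
  assume s: "s > 0"
  have "(\<integral>\<^sup>+t. ennreal (normal_density 0 s t) \<partial>lborel) = 1"
    using prob_space.emeasure_space_1 [OF prob_space_normal_density [OF s, of 0]]
    by (simp add: emeasure_density)
  then have "(\<integral>\<^sup>+x. (\<Prod>b\<in>Basis. ennreal (normal_density 0 s (x \<bullet> b))) \<partial>(lborel :: 'e measure)) = 1"
    by (subst nn_integral_lborel_prod) simp_all
  then show "emeasure (gaussian_measure s :: 'e measure) (space (gaussian_measure s)) = 1"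
    by (simp add: gaussian_measure_def emeasure_density prod_ennreal)
qed

lemma normal_density_char:
  assumes s: "s > 0"
  shows "(\<integral>t. complex_of_real (normal_density 0 s t) * cis (t * y) \<partial>lborel) = exp (- (s * y)\<^sup>2 / 2)"
proof -
  have "(\<integral>t. complex_of_real (normal_density 0 s t) * cis (t * y) \<partial>lborel) =
    \<bar>s\<bar> *\<^sub>R (\<integral>t. complex_of_real (normal_density 0 s (0 + s * t)) * cis ((0 + s * t) * y) \<partial>lborel)"
    using s by (subst lborel_integral_real_affine [of s _ 0]) auto
  also have "\<dots> = (\<integral>t. s *\<^sub>R (complex_of_real (normal_density 0 s (s * t)) * cis (s * t * y)) \<partial>lborel)"
    using s by simp
  also have "\<dots> = (\<integral>t. std_normal_density t *\<^sub>R cis ((s * y) * t) \<partial>lborel)"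
    using s by (intro Bochner_Integration.integral_cong)
      (auto simp: normal_density_def real_sqrt_mult power_mult_distrib scaleR_conv_of_real mult_ac)
  also have "\<dots> = char std_normal_distribution (s * y)"
    by (simp add: char_def integral_density cis_conv_exp mult_ac)
  also have "\<dots> = exp (- (s * y)\<^sup>2 / 2)"
    by (simp only: char_std_normal_distribution)
  finally show ?thesis .
qed

text \<open>Read from right to left, this writes a Gaussian bump as an average of characters. It is
  the only form of Fourier inversion that the proof uses.\<close>

lemma gaussian_measure_char:
  fixes y :: "'e::euclidean_space"
  assumes s: "s > 0"
  shows "(\<integral>x. cis (x \<bullet> y) \<partial>gaussian_measure s) = exp (- (s * norm y)\<^sup>2 / 2)"
proof -
  have *: "integrable lborel (\<lambda>t. complex_of_real (normal_density 0 s t) * cis (t * (y \<bullet> b)))" for b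
    by (rule Bochner_Integration.integrable_bound [of _ "normal_density 0 s"])
       (use s in \<open>auto simp: norm_mult\<close>)
  have "cis (x \<bullet> y) = (\<Prod>b\<in>Basis. cis ((x \<bullet> b) * (y \<bullet> b)))" for x
    by (subst euclidean_inner) (simp add: cis_conv_exp sum_distrib_left exp_sum)
  then have "(\<integral>x. cis (x \<bullet> y) \<partial>gaussian_measure s) =
      (\<integral>x. (\<Prod>b\<in>Basis. complex_of_real (normal_density 0 s (x \<bullet> b)) * cis ((x \<bullet> b) * (y \<bullet> b))) \<partial>lborel)"
    unfolding gaussian_measure_def by (subst integral_density) (simp_all add: prod_nonneg prod.distrib scaleR_conv_of_real)
  also have "\<dots> = (\<Prod>b\<in>Basis. \<integral>t. complex_of_real (normal_density 0 s t) * cis (t * (y \<bullet> b)) \<partial>lborel)"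
    by (rule lborel_integral_prod) (rule *)
  also have "\<dots> = (\<Prod>b\<in>Basis. of_real (exp (- (s * (y \<bullet> b))\<^sup>2 / 2)))"
    by (subst normal_density_char [OF s]) simp
  also have "\<dots> = of_real (exp (\<Sum>b\<in>Basis. - (s * (y \<bullet> b))\<^sup>2 / 2))"
    by (simp add: exp_sum)
  also have "(\<Sum>b\<in>Basis. - (s * (y \<bullet> b))\<^sup>2 / 2) = - (s * norm y)\<^sup>2 / 2"
    by (simp add: power_mult_distrib sum_negf flip: sum_distrib_left sum_divide_distrib)
       (subst power2_norm_eq_inner, subst euclidean_inner, simp add: power2_eq_square)
  finally show ?thesis .
qed

lemma nn_integral_exp_norm:
  assumes c: "c > 0"
  shows "(\<integral>\<^sup>+x. ennreal (exp (- (c * (norm x)\<^sup>2))) \<partial>(lborel :: 'e::euclidean_space measure))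
    = ennreal (sqrt (pi / c) ^ DIM('e))"
proof -
  \<comment> \<open>The scale at which the Gaussian density is proportional to the
    integrand.\<close>
  define s where "s = 1 / sqrt (2 * c)"
  have s: "s > 0" "s\<^sup>2 = 1 / (2 * c)" using c by (auto simp: s_def power_divide)
  define D where "D = (sqrt (2 * pi) * s) ^ DIM('e)"
  have D: "D > 0" using s by (simp add: D_def)
  have ds: "sqrt (2 * pi) * s = sqrt (pi / c)"
    using c by (simp add: s_def real_sqrt_divide real_sqrt_mult)
  have "ennreal (exp (- (c * (norm x)\<^sup>2))) =
      ennreal D * ennreal (\<Prod>b\<in>Basis. normal_density 0 s (x \<bullet> b))" for x :: 'e
    using D s c by (simp add: normal_density_prod ennreal_mult'[symmetric] D_def)
  then have "(\<integral>\<^sup>+x. ennreal (exp (- (c * (norm x)\<^sup>2))) \<partial>(lborel :: 'e measure)) =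
     ennreal D * emeasure (gaussian_measure s :: 'e measure) (space (gaussian_measure s))"
    by (simp add: gaussian_measure_def emeasure_density nn_integral_cmult)
  also have "\<dots> = ennreal D"
    using prob_space.emeasure_space_1 [OF prob_space_gaussian_measure [OF s(1), where 'e = 'e]] by simp
  finally show ?thesis by (simp add: D_def ds)
qed

text \<open>The density is largest at the origin. This trades the Gaussian weight of the Fourier
  integral for Lebesgue measure.\<close>

lemma nn_integral_gaussian_measure_bound:
  assumes s: "s > 0" and [measurable]: "f \<in> borel_measurable borel"
  shows "(\<integral>\<^sup>+x. f x \<partial>(gaussian_measure s :: 'e::euclidean_space measure)) \<le>
    ennreal (1 / (sqrt (2 * pi) * s) ^ DIM('e)) * (\<integral>\<^sup>+x. f x \<partial>lborel)"
proof -
  have "(\<integral>\<^sup>+x. f x \<partial>(gaussian_measure s :: 'e measure)) =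
     (\<integral>\<^sup>+x. ennreal (\<Prod>b\<in>Basis. normal_density 0 s (x \<bullet> b)) * f x \<partial>(lborel :: 'e measure))"
    by (simp add: gaussian_measure_def nn_integral_density)
  also have "\<dots> \<le> (\<integral>\<^sup>+x. ennreal (1 / (sqrt (2 * pi) * s) ^ DIM('e)) * f x \<partial>lborel)"
    using s by (intro nn_integral_mono mult_right_mono ennreal_leI)
      (auto simp: normal_density_prod field_simps)
  finally show ?thesis by (simp add: nn_integral_cmult)
qed

text \<open>Moves all smoothing scales onto one measure, so that letting s tend to 0 becomes
  dominated convergence under a fixed Gaussian.\<close>

lemma gaussian_measure_scale: "s > 0 \<Longrightarrow> gaussian_measure s = distr (gaussian_measure 1) borel (\<lambda>x :: 'e::euclidean_space. s *\<^sub>R x)"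
proof (rule measure_eqI)
  fix A :: "'e set" assume s: "s > 0" and "A \<in> sets (gaussian_measure s)"
  then have [measurable]: "A \<in> sets borel" by simp
  let ?g = "\<lambda>x :: 'e. ennreal (\<Prod>b\<in>Basis. normal_density 0 s (x \<bullet> b)) * indicator A x"
  have "emeasure (gaussian_measure s) A = (\<integral>\<^sup>+x. ?g x \<partial>lborel)"
    by (simp add: gaussian_measure_def emeasure_density)
  also have "\<dots> = (\<integral>\<^sup>+x. ?g x \<partial>density (distr lborel borel (\<lambda>x. 0 + s *\<^sub>R x)) (\<lambda>_. \<bar>s\<bar> ^ DIM('e)))"
    by (subst lborel_affine [of s 0]) (use s in auto)
  also have "\<dots> = (\<integral>\<^sup>+x. ennreal (s ^ DIM('e)) * ?g (s *\<^sub>R x) \<partial>lborel)"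
    using s by (subst nn_integral_density, simp, simp, subst nn_integral_distr) simp_all
  also have "\<dots> = (\<integral>\<^sup>+x. ennreal (\<Prod>b\<in>Basis. normal_density 0 1 (x \<bullet> b)) * indicator A (s *\<^sub>R x) \<partial>lborel)"
    using s by (intro nn_integral_cong)
      (auto simp: indicator_def normal_density_prod ennreal_mult'[symmetric] power_mult_distrib simp del: inner_scaleR_left)
  also have "\<dots> = emeasure (gaussian_measure 1) ((\<lambda>x. s *\<^sub>R x) -` A)"
    unfolding gaussian_measure_def using measurable_sets_borel [of "\<lambda>x. s *\<^sub>R x" borel A]
    by (subst emeasure_density) (auto simp: indicator_def intro!: nn_integral_cong)
  finally show "emeasure (gaussian_measure s) A = emeasure (distr (gaussian_measure 1) borel (\<lambda>x. s *\<^sub>R x)) A"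
    by (subst emeasure_distr) simp_all
qed simp

text \<open>The density is even, so smoothing f at z means averaging f over a Gaussian displacement
  of z.\<close>

lemma gaussian_measure_convolution:
  assumes s: "s > 0" and [measurable]: "f \<in> borel_measurable borel"
  shows "(\<integral>\<^sup>+a. f a * ennreal (\<Prod>b\<in>Basis. normal_density 0 s ((z - a) \<bullet> b)) \<partial>lborel) =
    (\<integral>\<^sup>+x. f (z + x) \<partial>(gaussian_measure s :: 'e::euclidean_space measure))"
proof -
  let ?g = "\<lambda>a. f a * ennreal (\<Prod>b\<in>Basis. normal_density 0 s ((z - a) \<bullet> b))"
  have "(\<integral>\<^sup>+a. ?g a \<partial>lborel) =
     (\<integral>\<^sup>+a. ?g a \<partial>density (distr lborel borel (\<lambda>x. z + 1 *\<^sub>R x)) (\<lambda>_. ennreal (\<bar>1\<bar> ^ DIM('e))))"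
    by (subst lborel_affine [of 1 z]) auto
  also have "\<dots> = (\<integral>\<^sup>+x. ?g (z + x) \<partial>lborel)"
    by (subst nn_integral_density, simp, simp, subst nn_integral_distr) simp_all
  also have "\<dots> = (\<integral>\<^sup>+x. f (z + x) \<partial>(gaussian_measure s :: 'e measure))"
    using s by (simp add: gaussian_measure_def nn_integral_density normal_density_prod mult.commute del: inner_diff_left inner_minus_left)
  finally show ?thesis .
qed

lemma lborel_complex: "lborel = distr (lborel \<Otimes>\<^sub>M lborel) borel (\<lambda>(a, b). Complex a b)"
proof (rule lborel_eqI)
  have [measurable]: "(\<lambda>(a, b). Complex a b) \<in> borel \<Otimes>\<^sub>M borel \<rightarrow>\<^sub>M borel"
    unfolding Complex_eq by measurable
  fix l u :: complex assume le: "\<And>b. b \<in> Basis \<Longrightarrow> l \<bullet> b \<le> u \<bullet> b"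
  then have le: "Re l \<le> Re u" "Im l \<le> Im u"
    using le [of 1] le [of \<i>] by (auto simp: Basis_complex_def)
  have "(\<lambda>(a, b). Complex a b) -` box l u = {Re l<..<Re u} \<times> {Im l<..<Im u}"
    by (auto simp: box_def Basis_complex_def)
  then show "emeasure (distr (lborel \<Otimes>\<^sub>M lborel) borel (\<lambda>(a, b). Complex a b)) (box l u) =
      ennreal (\<Prod>b\<in>Basis. (u - l) \<bullet> b)"
    using le by (subst emeasure_distr)
      (auto simp: space_pair_measure lborel.emeasure_pair_measure_Times Basis_complex_def ennreal_mult')
qed simp

lemma nn_integral_complex:
  assumes [measurable]: "f \<in> borel_measurable borel"
  shows "(\<integral>\<^sup>+z. f z \<partial>lborel) = (\<integral>\<^sup>+a. \<integral>\<^sup>+b. f (Complex a b) \<partial>lborel \<partial>lborel)"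
proof -
  have [measurable]: "(\<lambda>(a, b). Complex a b) \<in> borel \<Otimes>\<^sub>M borel \<rightarrow>\<^sub>M borel"
    unfolding Complex_eq by measurable
  show ?thesis
    by (subst lborel_complex, subst nn_integral_distr, measurable)
       (simp add: lborel.nn_integral_fst [symmetric] split_beta')
qed

section \<open>Comparison of joint laws through characteristic functions\<close>

text \<open>Each bump is a characteristic function in \<theta>, and Fubini exchanges the two
  expectations. So the mean of a product of bumps depends on the joint law only through its
  characteristic function.\<close>

lemma bump_char:
  fixes Z :: "'i \<Rightarrow> 'a \<Rightarrow> 'e::euclidean_space"
  assumes M: "prob_space M" and I: "finite I" and r: "r > 0"
    and Z [measurable]: "\<And>i. i \<in> I \<Longrightarrow> Z i \<in> borel_measurable M"
  shows "(\<integral>\<omega>. complex_of_real (\<Prod>i\<in>I. exp (- (r * norm (Z i \<omega> - a i))\<^sup>2 / 2)) \<partial>M) =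
    (\<integral>\<theta>. cis (- (\<Sum>i\<in>I. \<theta> i \<bullet> a i)) * (\<integral>\<omega>. cis (\<Sum>i\<in>I. \<theta> i \<bullet> Z i \<omega>) \<partial>M) \<partial>(\<Pi>\<^sub>M i\<in>I. gaussian_measure r))"
proof -
  interpret prob_space M by fact
  interpret G: prob_space "gaussian_measure r :: 'e measure" using r by (rule prob_space_gaussian_measure)
  interpret GP: product_prob_space "\<lambda>_. gaussian_measure r :: 'e measure" I ..
  interpret PS: product_sigma_finite "\<lambda>_. gaussian_measure r :: 'e measure" ..
  interpret P2: pair_prob_space M "\<Pi>\<^sub>M i\<in>I. (gaussian_measure r :: 'e measure)" ..
  let ?F = "\<lambda>\<omega> \<theta>. \<Prod>i\<in>I. cis (\<theta> i \<bullet> (Z i \<omega> - a i))"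
  have F: "?F \<omega> \<theta> = cis (- (\<Sum>i\<in>I. \<theta> i \<bullet> a i)) * cis (\<Sum>i\<in>I. \<theta> i \<bullet> Z i \<omega>)" for \<omega> \<theta>
  proof -
    have "(\<Prod>i\<in>I. cis (f i)) = cis (\<Sum>i\<in>I. f i)" for f :: "'i \<Rightarrow> real"
      using I by (induction I rule: finite_induct) (auto simp: cis_mult)
    then show ?thesis
      by (simp add: cis_mult inner_diff_right sum_subtractf)
  qed
  have "complex_of_real (\<Prod>i\<in>I. exp (- (r * norm (Z i \<omega> - a i))\<^sup>2 / 2)) =
      (\<Prod>i\<in>I. \<integral>x. cis (x \<bullet> (Z i \<omega> - a i)) \<partial>gaussian_measure r)" for \<omega>
    by (simp only: gaussian_measure_char [OF r] of_real_prod)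
  moreover have "\<dots> \<omega> = (\<integral>\<theta>. ?F \<omega> \<theta> \<partial>(\<Pi>\<^sub>M i\<in>I. gaussian_measure r))" for \<omega>
    by (subst PS.product_integral_prod [OF I])
       (auto intro!: G.integrable_const_bound [of _ 1])
  ultimately have "(\<integral>\<omega>. complex_of_real (\<Prod>i\<in>I. exp (- (r * norm (Z i \<omega> - a i))\<^sup>2 / 2)) \<partial>M) =
     (\<integral>\<omega>. (\<integral>\<theta>. ?F \<omega> \<theta> \<partial>(\<Pi>\<^sub>M i\<in>I. gaussian_measure r)) \<partial>M)"
    by simp
  also have "\<dots> = (\<integral>\<theta>. (\<integral>\<omega>. ?F \<omega> \<theta> \<partial>M) \<partial>(\<Pi>\<^sub>M i\<in>I. gaussian_measure r))"
    by (rule P2.Fubini_integral [symmetric])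
       (auto intro!: P2.P.integrable_const_bound [of _ 1] simp: prod_norm [symmetric] case_prod_unfold)
  finally show ?thesis by (simp only: F) simp
qed

text \<open>Each index contributes a factor of order \<open>r ^ (- DIM)\<close>; it is this decay in
  r that later makes the comparison of densities uniform in the smoothing scale.\<close>

lemma nn_integral_PiM_gaussian_measure_exp:
  assumes I: "finite I" and c: "c > 0" and r: "r > 0"
  shows "(\<integral>\<^sup>+\<theta>. ennreal (\<Prod>i\<in>I. exp (- (c * (norm (\<theta> i))\<^sup>2))) \<partial>(\<Pi>\<^sub>M i\<in>I. (gaussian_measure r :: 'e::euclidean_space measure)))
    \<le> ennreal (((sqrt (pi / c) / (sqrt (2 * pi) * r)) ^ DIM('e)) ^ card I)"
proof -
  interpret G: prob_space "gaussian_measure r :: 'e measure" using r by (rule prob_space_gaussian_measure)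
  interpret PS: product_sigma_finite "\<lambda>_. gaussian_measure r :: 'e measure" ..
  have "(\<integral>\<^sup>+\<theta>. ennreal (\<Prod>i\<in>I. exp (- (c * (norm (\<theta> i))\<^sup>2))) \<partial>(\<Pi>\<^sub>M i\<in>I. (gaussian_measure r :: 'e::euclidean_space measure))) =
     (\<Prod>i\<in>I. \<integral>\<^sup>+x. ennreal (exp (- (c * (norm x)\<^sup>2))) \<partial>(gaussian_measure r :: 'e measure))"
    by (subst PS.product_nn_integral_prod [OF I, symmetric]) (auto simp: prod_ennreal)
  also have "\<dots> \<le> (\<Prod>i\<in>I. ennreal (1 / (sqrt (2 * pi) * r) ^ DIM('e)) * ennreal (sqrt (pi / c) ^ DIM('e)))"
    by (intro prod_mono_ennreal order_trans [OF nn_integral_gaussian_measure_bound [OF r]])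
       (auto simp: nn_integral_exp_norm [OF c])
  also have "\<dots> = ennreal (((sqrt (pi / c) / (sqrt (2 * pi) * r)) ^ DIM('e)) ^ card I)"
    using c r by (simp add: ennreal_power power_divide flip: ennreal_mult')
  finally show ?thesis .
qed

text \<open>The centres a enter only through factors of modulus one, so the bound is uniform in
  them.\<close>

lemma bump_diff:
  fixes Z :: "'i \<Rightarrow> 'a \<Rightarrow> 'e::euclidean_space" and Z' :: "'i \<Rightarrow> 'b \<Rightarrow> 'e"
  assumes M: "prob_space M" and M': "prob_space M'" and I: "finite I" and r: "r > 0" and c: "c > 0"
    and e: "\<epsilon> \<ge> 0"
    and Z [measurable]: "\<And>i. i \<in> I \<Longrightarrow> Z i \<in> borel_measurable M"
    and Z' [measurable]: "\<And>i. i \<in> I \<Longrightarrow> Z' i \<in> borel_measurable M'"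
    and le: "\<And>\<theta>. cmod ((\<integral>\<omega>. cis (\<Sum>i\<in>I. \<theta> i \<bullet> Z i \<omega>) \<partial>M) - (\<integral>\<omega>. cis (\<Sum>i\<in>I. \<theta> i \<bullet> Z' i \<omega>) \<partial>M'))
       \<le> \<epsilon> * (\<Prod>i\<in>I. exp (- (c * (norm (\<theta> i))\<^sup>2)))"
  shows "\<bar>(\<integral>\<omega>. (\<Prod>i\<in>I. exp (- (r * norm (Z i \<omega> - a i))\<^sup>2 / 2)) \<partial>M) -
      (\<integral>\<omega>. (\<Prod>i\<in>I. exp (- (r * norm (Z' i \<omega> - a i))\<^sup>2 / 2)) \<partial>M')\<bar>
    \<le> \<epsilon> * ((sqrt (pi / c) / (sqrt (2 * pi) * r)) ^ DIM('e)) ^ card I"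
proof -
  interpret M: prob_space M by fact
  interpret M': prob_space M' by fact
  interpret G: prob_space "gaussian_measure r :: 'e measure" using r by (rule prob_space_gaussian_measure)
  interpret GP: product_prob_space "\<lambda>_. gaussian_measure r :: 'e measure" I ..
  let ?P = "\<Pi>\<^sub>M i\<in>I. (gaussian_measure r :: 'e measure)"
  define F where "F \<theta> = cis (- (\<Sum>i\<in>I. \<theta> i \<bullet> a i)) * (\<integral>\<omega>. cis (\<Sum>i\<in>I. \<theta> i \<bullet> Z i \<omega>) \<partial>M)" for \<theta>
  define F' where "F' \<theta> = cis (- (\<Sum>i\<in>I. \<theta> i \<bullet> a i)) * (\<integral>\<omega>. cis (\<Sum>i\<in>I. \<theta> i \<bullet> Z' i \<omega>) \<partial>M')" for \<theta>
  have norm_cf: "cmod (\<integral>\<omega>. cis (\<Sum>i\<in>I. \<theta> i \<bullet> Z i \<omega>) \<partial>M) \<le> 1"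
      "cmod (\<integral>\<omega>. cis (\<Sum>i\<in>I. \<theta> i \<bullet> Z' i \<omega>) \<partial>M') \<le> 1" for \<theta>
    by (rule order_trans [OF integral_norm_bound], simp add: M.prob_space,
        rule order_trans [OF integral_norm_bound], simp add: M'.prob_space)
  have intF: "integrable ?P F" "integrable ?P F'"
    unfolding F_def F'_def using norm_cf
    by (auto intro!: GP.integrable_const_bound [of _ 1] simp: norm_mult)
  have d: "F \<theta> - F' \<theta> = cis (- (\<Sum>i\<in>I. \<theta> i \<bullet> a i)) *
     ((\<integral>\<omega>. cis (\<Sum>i\<in>I. \<theta> i \<bullet> Z i \<omega>) \<partial>M) - (\<integral>\<omega>. cis (\<Sum>i\<in>I. \<theta> i \<bullet> Z' i \<omega>) \<partial>M'))" for \<theta>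
    by (simp add: F_def F'_def algebra_simps)
  have dle: "cmod (F \<theta> - F' \<theta>) \<le> \<epsilon> * (\<Prod>i\<in>I. exp (- (c * (norm (\<theta> i))\<^sup>2)))" for \<theta>
    using le [of \<theta>] by (simp add: d norm_mult)
  let ?A = "\<integral>\<omega>. (\<Prod>i\<in>I. exp (- (r * norm (Z i \<omega> - a i))\<^sup>2 / 2)) \<partial>M"
  let ?A' = "\<integral>\<omega>. (\<Prod>i\<in>I. exp (- (r * norm (Z' i \<omega> - a i))\<^sup>2 / 2)) \<partial>M'"
  have "complex_of_real ?A = (\<integral>\<theta>. F \<theta> \<partial>?P)" "complex_of_real ?A' = (\<integral>\<theta>. F' \<theta> \<partial>?P)"
    using bump_char [OF M I r Z, where a = a] bump_char [OF M' I r Z', where a = a]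
    by (simp_all only: F_def F'_def integral_complex_of_real)
  then have "complex_of_real (?A - ?A') = (\<integral>\<theta>. F \<theta> - F' \<theta> \<partial>?P)"
    using intF by simp
  then have "ennreal \<bar>?A - ?A'\<bar> = ennreal (cmod (\<integral>\<theta>. F \<theta> - F' \<theta> \<partial>?P))"
    using norm_of_real [where 'a = complex, of "?A - ?A'"] by simp
  also have "\<dots> \<le> (\<integral>\<^sup>+\<theta>. ennreal (cmod (F \<theta> - F' \<theta>)) \<partial>?P)"
    using intF by (intro integral_norm_bound_ennreal) auto
  also have "\<dots> \<le> (\<integral>\<^sup>+\<theta>. ennreal \<epsilon> * ennreal (\<Prod>i\<in>I. exp (- (c * (norm (\<theta> i))\<^sup>2))) \<partial>?P)"
    by (intro nn_integral_mono) (simp only: ennreal_mult' [OF e, symmetric] ennreal_leI [OF dle])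
  also have "\<dots> = ennreal \<epsilon> * (\<integral>\<^sup>+\<theta>. ennreal (\<Prod>i\<in>I. exp (- (c * (norm (\<theta> i))\<^sup>2))) \<partial>?P)"
    by (intro nn_integral_cmult) measurable
  also have "\<dots> \<le> ennreal \<epsilon> * ennreal (((sqrt (pi / c) / (sqrt (2 * pi) * r)) ^ DIM('e)) ^ card I)"
    by (intro mult_left_mono nn_integral_PiM_gaussian_measure_exp I c r) simp
  finally show ?thesis
    using e c r by (subst (asm) ennreal_mult' [symmetric]) (auto simp: ennreal_le_iff)
qed

abbreviation gaussian_density :: "real \<Rightarrow> 'e::euclidean_space \<Rightarrow> real" where
  "gaussian_density s x \<equiv> \<Prod>b\<in>Basis. normal_density 0 s (x \<bullet> b)"

text \<open>Compares the joint densities at a of the two families after adding Gaussian noise of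
  scale s. The error is free of s and of a, so it can be integrated over a and survives as s tends
  to 0.\<close>

lemma smoothed_density_diff:
  fixes Z :: "'i \<Rightarrow> 'a \<Rightarrow> 'e::euclidean_space" and Z' :: "'i \<Rightarrow> 'b \<Rightarrow> 'e"
  assumes M: "prob_space M" and M': "prob_space M'" and I: "finite I" and s: "s > 0" and c: "c > 0"
    and e: "\<epsilon> \<ge> 0"
    and Z [measurable]: "\<And>i. i \<in> I \<Longrightarrow> Z i \<in> borel_measurable M"
    and Z' [measurable]: "\<And>i. i \<in> I \<Longrightarrow> Z' i \<in> borel_measurable M'"
    and le: "\<And>\<theta>. cmod ((\<integral>\<omega>. cis (\<Sum>i\<in>I. \<theta> i \<bullet> Z i \<omega>) \<partial>M) - (\<integral>\<omega>. cis (\<Sum>i\<in>I. \<theta> i \<bullet> Z' i \<omega>) \<partial>M'))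
       \<le> \<epsilon> * (\<Prod>i\<in>I. exp (- (c * (norm (\<theta> i))\<^sup>2)))"
  shows "(\<integral>\<^sup>+\<omega>. ennreal (\<Prod>i\<in>I. gaussian_density s (Z i \<omega> - a i)) \<partial>M) \<le>
      (\<integral>\<^sup>+\<omega>. ennreal (\<Prod>i\<in>I. gaussian_density s (Z' i \<omega> - a i)) \<partial>M') +
      ennreal (\<epsilon> * ((sqrt (pi / c) / (2 * pi)) ^ DIM('e)) ^ card I)"
proof -
  interpret M: prob_space M by fact
  interpret M': prob_space M' by fact
  define D where "D = 1 / ((sqrt (2 * pi) * s) ^ DIM('e)) ^ card I"
  have D: "D > 0" using s by (simp add: D_def)
  let ?b = "\<lambda>x. exp (- (1 / s * norm (x :: 'e))\<^sup>2 / 2)"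
  let ?A = "\<integral>\<omega>. (\<Prod>i\<in>I. ?b (Z i \<omega> - a i)) \<partial>M"
  let ?A' = "\<integral>\<omega>. (\<Prod>i\<in>I. ?b (Z' i \<omega> - a i)) \<partial>M'"
  have "(\<Prod>i\<in>I. gaussian_density s (f i)) = D * (\<Prod>i\<in>I. ?b (f i))" for f :: "'i \<Rightarrow> 'e"
    using s by (simp add: normal_density_prod D_def prod_dividef power_mult_distrib power_divide mult.commute)
  then have *: "ennreal (\<Prod>i\<in>I. gaussian_density s (f i)) = ennreal D * ennreal (\<Prod>i\<in>I. ?b (f i))" for f :: "'i \<Rightarrow> 'e"
    using D by (simp add: ennreal_mult')
  have bnd: "(\<Prod>i\<in>I. ?b (f i)) \<le> 1" for f :: "'i \<Rightarrow> 'e" by (intro prod_le_1) auto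
  have Z1: "(\<integral>\<^sup>+\<omega>. ennreal (\<Prod>i\<in>I. gaussian_density s (Z i \<omega> - a i)) \<partial>M) = ennreal (D * ?A)"
    using D bnd unfolding * by (subst nn_integral_cmult, measurable)
      (subst nn_integral_eq_integral, auto intro!: M.integrable_const_bound [of _ 1]
        simp: ennreal_mult' prod_nonneg abs_prod)
  have Z2: "(\<integral>\<^sup>+\<omega>. ennreal (\<Prod>i\<in>I. gaussian_density s (Z' i \<omega> - a i)) \<partial>M') = ennreal (D * ?A')"
    using D bnd unfolding * by (subst nn_integral_cmult, measurable)
      (subst nn_integral_eq_integral, auto intro!: M'.integrable_const_bound [of _ 1]
        simp: ennreal_mult' prod_nonneg abs_prod)
  have "?A - ?A' \<le> \<epsilon> * ((sqrt (pi / c) / (sqrt (2 * pi) * (1 / s))) ^ DIM('e)) ^ card I"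
    using bump_diff [OF M M' I _ c e Z Z' le, where r = "1 / s" and a = a] s by auto
  then have "D * ?A \<le> D * ?A' + D * (\<epsilon> * ((sqrt (pi / c) / (sqrt (2 * pi) * (1 / s))) ^ DIM('e)) ^ card I)"
    using D by (simp flip: distrib_left)
  \<comment> \<open>With r = 1 / s, the normalisation D of the density cancels the decay in r of the
    Fourier bound.\<close>
  also have "D * (\<epsilon> * ((sqrt (pi / c) / (sqrt (2 * pi) * (1 / s))) ^ DIM('e)) ^ card I) =
      \<epsilon> * (((sqrt (pi / c) / (sqrt (2 * pi) * (1 / s))) / (sqrt (2 * pi) * s)) ^ DIM('e)) ^ card I"
    by (simp only: D_def power_divide) (simp add: divide_divide_eq_left mult_ac)
  also have "(sqrt (pi / c) / (sqrt (2 * pi) * (1 / s))) / (sqrt (2 * pi) * s) = sqrt (pi / c) / (2 * pi)"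
    using s by (simp add: field_simps flip: real_sqrt_mult)
  finally have "ennreal (D * ?A) \<le> ennreal (D * ?A' + \<epsilon> * ((sqrt (pi / c) / (2 * pi)) ^ DIM('e)) ^ card I)"
    by (rule ennreal_leI)
  also have "\<dots> = ennreal (D * ?A') + ennreal (\<epsilon> * ((sqrt (pi / c) / (2 * pi)) ^ DIM('e)) ^ card I)"
    using D e c by (intro ennreal_plus) (auto intro!: mult_nonneg_nonneg Bochner_Integration.integral_nonneg prod_nonneg)
  finally show ?thesis by (simp add: Z1 Z2)
qed

text \<open>Turns smoothed test functions into weights against the smoothed joint density, where a
  pointwise bound on densities can be integrated.\<close>

lemma smoothed_fubini:
  fixes Z :: "'i \<Rightarrow> 'a \<Rightarrow> 'e::euclidean_space"
  assumes M: "prob_space M" and I: "finite I"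
    and Z [measurable]: "\<And>i. i \<in> I \<Longrightarrow> Z i \<in> borel_measurable M"
    and h [measurable]: "\<And>i. i \<in> I \<Longrightarrow> h i \<in> borel_measurable borel"
  shows "(\<integral>\<^sup>+\<omega>. (\<Prod>i\<in>I. \<integral>\<^sup>+a. h i a * ennreal (gaussian_density s (Z i \<omega> - a)) \<partial>lborel) \<partial>M) =
    (\<integral>\<^sup>+a. (\<Prod>i\<in>I. h i (a i)) * (\<integral>\<^sup>+\<omega>. ennreal (\<Prod>i\<in>I. gaussian_density s (Z i \<omega> - a i)) \<partial>M) \<partial>(\<Pi>\<^sub>M i\<in>I. lborel))"
proof -
  interpret M: prob_space M by fact
  interpret PS: product_sigma_finite "\<lambda>_. lborel :: 'e measure" ..
  interpret SF: sigma_finite_measure "\<Pi>\<^sub>M i\<in>I. (lborel :: 'e measure)" by (rule PS.sigma_finite [OF I])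
  interpret P2: pair_sigma_finite M "\<Pi>\<^sub>M i\<in>I. (lborel :: 'e measure)" ..
  have "(\<integral>\<^sup>+\<omega>. (\<Prod>i\<in>I. \<integral>\<^sup>+a. h i a * ennreal (gaussian_density s (Z i \<omega> - a)) \<partial>lborel) \<partial>M) =
     (\<integral>\<^sup>+\<omega>. \<integral>\<^sup>+a. (\<Prod>i\<in>I. h i (a i) * ennreal (gaussian_density s (Z i \<omega> - a i))) \<partial>(\<Pi>\<^sub>M i\<in>I. lborel) \<partial>M)"
    by (subst PS.product_nn_integral_prod [OF I]) auto
  also have "\<dots> = (\<integral>\<^sup>+a. \<integral>\<^sup>+\<omega>. (\<Prod>i\<in>I. h i (a i) * ennreal (gaussian_density s (Z i \<omega> - a i))) \<partial>M \<partial>(\<Pi>\<^sub>M i\<in>I. lborel))"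
    by (rule P2.Fubini' [symmetric]) (simp add: case_prod_unfold)
  also have "\<dots> = (\<integral>\<^sup>+a. (\<Prod>i\<in>I. h i (a i)) * (\<integral>\<^sup>+\<omega>. ennreal (\<Prod>i\<in>I. gaussian_density s (Z i \<omega> - a i)) \<partial>M) \<partial>(\<Pi>\<^sub>M i\<in>I. lborel))"
    by (subst nn_integral_cmult [symmetric]) (auto simp: prod.distrib prod_ennreal prod_nonneg)
  finally show ?thesis .
qed

lemma smoothed_limit:
  fixes Z :: "'i \<Rightarrow> 'a \<Rightarrow> 'e::euclidean_space"
  assumes M: "prob_space M" and I: "finite I"
    and Z [measurable]: "\<And>i. i \<in> I \<Longrightarrow> Z i \<in> borel_measurable M"
    and h: "\<And>i. i \<in> I \<Longrightarrow> continuous_on UNIV (h i)"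
    and h01: "\<And>i x. 0 \<le> h i x" "\<And>i x. h i x \<le> (1::real)"
  shows "(\<lambda>k. \<integral>\<^sup>+\<omega>. (\<Prod>i\<in>I. \<integral>\<^sup>+a. ennreal (h i a) * ennreal (gaussian_density (1 / real (Suc k)) (Z i \<omega> - a)) \<partial>lborel) \<partial>M)
    \<longlonglongrightarrow> (\<integral>\<^sup>+\<omega>. (\<Prod>i\<in>I. ennreal (h i (Z i \<omega>))) \<partial>M)"
proof -
  interpret M: prob_space M by fact
  interpret G: prob_space "gaussian_measure 1 :: 'e measure" by (rule prob_space_gaussian_measure) simp
  have [measurable]: "h i \<in> borel_measurable borel" if "i \<in> I" for i
    using h [OF that] by (rule borel_measurable_continuous_onI)
  define H where "H k i z = (\<integral>x. h i (z + (1 / real (Suc k)) *\<^sub>R x) \<partial>gaussian_measure 1)" for k i z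
  have int: "integrable (gaussian_measure 1) (\<lambda>x. h i (z + (1 / real (Suc k)) *\<^sub>R x))" if "i \<in> I" for i k z
    using that h01 by (intro G.integrable_const_bound [of _ 1]) auto
  have H: "(\<integral>\<^sup>+a. ennreal (h i a) * ennreal (gaussian_density (1 / real (Suc k)) (z - a)) \<partial>lborel) = ennreal (H k i z)"
    if "i \<in> I" for k i z
    using that h01 int [OF that, of z k] unfolding H_def
    by (subst gaussian_measure_convolution, simp, simp, subst gaussian_measure_scale, simp, subst nn_integral_distr, simp, simp)
       (subst nn_integral_eq_integral, auto)
  have [measurable]: "H k i \<in> borel_measurable borel" if "i \<in> I" for k i
    unfolding H_def using that by measurable
  have H01: "0 \<le> H k i z" "H k i z \<le> 1" if "i \<in> I" for k i z
  proof -
    show "0 \<le> H k i z" unfolding H_def by (intro Bochner_Integration.integral_nonneg) (simp add: h01)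
    have "H k i z \<le> (\<integral>x. 1 \<partial>(gaussian_measure 1 :: 'e measure))" unfolding H_def
      by (intro integral_mono int that) (auto simp: h01)
    then show "H k i z \<le> 1" using G.prob_space by simp
  qed
  have Hlim: "(\<lambda>k. H k i z) \<longlonglongrightarrow> h i z" if "i \<in> I" for i z
  proof -
    have "(\<lambda>k. h i (z + (1 / real (Suc k)) *\<^sub>R x)) \<longlonglongrightarrow> h i z" for x
    proof -
      have "(\<lambda>k. z + (1 / real (Suc k)) *\<^sub>R x) \<longlonglongrightarrow> z + 0 *\<^sub>R x"
        by (intro tendsto_intros LIMSEQ_Suc [OF lim_1_over_n])
      then show ?thesis
        using h [OF that] by (intro isCont_tendsto_compose [of z "h i"])
          (auto simp: continuous_on_eq_continuous_at)
    qed
    then have "(\<lambda>k. H k i z) \<longlonglongrightarrow> (\<integral>x. h i z \<partial>(gaussian_measure 1 :: 'e measure))"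
      unfolding H_def using that h01
      by (intro integral_dominated_convergence [where w = "\<lambda>_. 1"]) auto
    then show ?thesis using G.prob_space by simp
  qed
  have "(\<lambda>k. \<integral>\<^sup>+\<omega>. ennreal (\<Prod>i\<in>I. H k i (Z i \<omega>)) \<partial>M) \<longlonglongrightarrow> (\<integral>\<^sup>+\<omega>. ennreal (\<Prod>i\<in>I. h i (Z i \<omega>)) \<partial>M)"
  proof (rule nn_integral_dominated_convergence [where w = "\<lambda>_. 1"])
    show "AE x in M. ennreal (\<Prod>i\<in>I. H k i (Z i x)) \<le> 1" for k
      using H01 by (auto intro!: prod_le_1 simp: ennreal_le_1)
    show "AE x in M. (\<lambda>k. ennreal (\<Prod>i\<in>I. H k i (Z i x))) \<longlonglongrightarrow> ennreal (\<Prod>i\<in>I. h i (Z i x))"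
      using Hlim by (auto intro!: tendsto_intros)
  qed (auto simp: M.emeasure_space_1)
  then show ?thesis
    using h01 H01 by (simp only: H prod_ennreal cong: prod.cong)
qed

text \<open>Integrating the density bound over a produces the product of the integrals of the test
  functions, a volume. The limit s \<rightarrow> 0 then removes the smoothing.\<close>

lemma comparison_continuous:
  fixes Z :: "'i \<Rightarrow> 'a \<Rightarrow> 'e::euclidean_space" and Z' :: "'i \<Rightarrow> 'b \<Rightarrow> 'e"
  assumes M: "prob_space M" and M': "prob_space M'" and I: "finite I" and c: "c > 0"
    and e: "\<epsilon> \<ge> 0"
    and Z [measurable]: "\<And>i. i \<in> I \<Longrightarrow> Z i \<in> borel_measurable M"
    and Z' [measurable]: "\<And>i. i \<in> I \<Longrightarrow> Z' i \<in> borel_measurable M'"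
    and le: "\<And>\<theta>. cmod ((\<integral>\<omega>. cis (\<Sum>i\<in>I. \<theta> i \<bullet> Z i \<omega>) \<partial>M) - (\<integral>\<omega>. cis (\<Sum>i\<in>I. \<theta> i \<bullet> Z' i \<omega>) \<partial>M'))
       \<le> \<epsilon> * (\<Prod>i\<in>I. exp (- (c * (norm (\<theta> i))\<^sup>2)))"
    and h: "\<And>i. i \<in> I \<Longrightarrow> continuous_on UNIV (h i)"
    and h01: "\<And>i x. 0 \<le> h i x" "\<And>i x. h i x \<le> (1::real)"
  shows "(\<integral>\<^sup>+\<omega>. (\<Prod>i\<in>I. ennreal (h i (Z i \<omega>))) \<partial>M) \<le> (\<integral>\<^sup>+\<omega>. (\<Prod>i\<in>I. ennreal (h i (Z' i \<omega>))) \<partial>M') +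
      ennreal (\<epsilon> * ((sqrt (pi / c) / (2 * pi)) ^ DIM('e)) ^ card I) * (\<Prod>i\<in>I. \<integral>\<^sup>+a. ennreal (h i a) \<partial>lborel)"
    (is "_ \<le> ?R + ?E * ?Q")
proof (rule LIMSEQ_le [OF smoothed_limit [OF M I Z h h01]])
  interpret PS: product_sigma_finite "\<lambda>_. lborel :: 'e measure" ..
  have [measurable]: "h i \<in> borel_measurable borel" if "i \<in> I" for i
    using h [OF that] by (rule borel_measurable_continuous_onI)
  show "(\<lambda>k. (\<integral>\<^sup>+\<omega>. (\<Prod>i\<in>I. \<integral>\<^sup>+a. ennreal (h i a) * ennreal (gaussian_density (1 / real (Suc k)) (Z' i \<omega> - a)) \<partial>lborel) \<partial>M') + ?E * ?Q) \<longlonglongrightarrow> ?R + ?E * ?Q"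
    by (intro tendsto_intros smoothed_limit [OF M' I Z' h h01])
  have "(\<integral>\<^sup>+\<omega>. (\<Prod>i\<in>I. \<integral>\<^sup>+a. ennreal (h i a) * ennreal (gaussian_density s (Z i \<omega> - a)) \<partial>lborel) \<partial>M) \<le>
    (\<integral>\<^sup>+\<omega>. (\<Prod>i\<in>I. \<integral>\<^sup>+a. ennreal (h i a) * ennreal (gaussian_density s (Z' i \<omega> - a)) \<partial>lborel) \<partial>M') + ?E * ?Q"
    if s: "s > 0" for s
  proof -
    interpret M': prob_space M' by fact
    have "(\<integral>\<^sup>+\<omega>. (\<Prod>i\<in>I. \<integral>\<^sup>+a. ennreal (h i a) * ennreal (gaussian_density s (Z i \<omega> - a)) \<partial>lborel) \<partial>M) =
     (\<integral>\<^sup>+a. (\<Prod>i\<in>I. ennreal (h i (a i))) * (\<integral>\<^sup>+\<omega>. ennreal (\<Prod>i\<in>I. gaussian_density s (Z i \<omega> - a i)) \<partial>M) \<partial>(\<Pi>\<^sub>M i\<in>I. lborel))"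
      by (rule smoothed_fubini [OF M I Z]) auto
    also have "\<dots> \<le> (\<integral>\<^sup>+a. (\<Prod>i\<in>I. ennreal (h i (a i))) * ((\<integral>\<^sup>+\<omega>. ennreal (\<Prod>i\<in>I. gaussian_density s (Z' i \<omega> - a i)) \<partial>M') + ?E) \<partial>(\<Pi>\<^sub>M i\<in>I. lborel))"
      by (intro nn_integral_mono mult_left_mono smoothed_density_diff [OF M M' I s c e Z Z' le]) simp_all
    also have "\<dots> = (\<integral>\<^sup>+a. (\<Prod>i\<in>I. ennreal (h i (a i))) * (\<integral>\<^sup>+\<omega>. ennreal (\<Prod>i\<in>I. gaussian_density s (Z' i \<omega> - a i)) \<partial>M') \<partial>(\<Pi>\<^sub>M i\<in>I. lborel))
       + (\<integral>\<^sup>+a. (\<Prod>i\<in>I. ennreal (h i (a i))) \<partial>(\<Pi>\<^sub>M i\<in>I. lborel)) * ?E"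
      by (simp add: distrib_left nn_integral_add nn_integral_multc)
    also have "(\<integral>\<^sup>+a. (\<Prod>i\<in>I. ennreal (h i (a i))) * (\<integral>\<^sup>+\<omega>. ennreal (\<Prod>i\<in>I. gaussian_density s (Z' i \<omega> - a i)) \<partial>M') \<partial>(\<Pi>\<^sub>M i\<in>I. lborel)) =
      (\<integral>\<^sup>+\<omega>. (\<Prod>i\<in>I. \<integral>\<^sup>+a. ennreal (h i a) * ennreal (gaussian_density s (Z' i \<omega> - a)) \<partial>lborel) \<partial>M')"
      by (rule smoothed_fubini [OF M' I Z', symmetric]) auto
    also have "(\<integral>\<^sup>+a. (\<Prod>i\<in>I. ennreal (h i (a i))) \<partial>(\<Pi>\<^sub>M i\<in>I. lborel)) = ?Q"
      by (subst PS.product_nn_integral_prod [OF I]) auto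
    finally show ?thesis by (simp add: mult.commute)
  qed
  then show "\<exists>N. \<forall>k\<ge>N. (\<integral>\<^sup>+\<omega>. (\<Prod>i\<in>I. \<integral>\<^sup>+a. ennreal (h i a) * ennreal (gaussian_density (1 / real (Suc k)) (Z i \<omega> - a)) \<partial>lborel) \<partial>M) \<le>
    (\<integral>\<^sup>+\<omega>. (\<Prod>i\<in>I. \<integral>\<^sup>+a. ennreal (h i a) * ennreal (gaussian_density (1 / real (Suc k)) (Z' i \<omega> - a)) \<partial>lborel) \<partial>M') + ?E * ?Q"
    by auto
qed

text \<open>The indicator of a proper open set is the increasing limit of the continuous functions
  \<open>min 1 (m * infdist x (- U))\<close>; \<open>U = UNIV\<close> would give \<open>infdist x {} = 0\<close>.\<close>

theorem comparison_open:
  fixes Z :: "'i \<Rightarrow> 'a \<Rightarrow> 'e::euclidean_space" and Z' :: "'i \<Rightarrow> 'b \<Rightarrow> 'e"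
  assumes M: "prob_space M" and M': "prob_space M'" and I: "finite I" and c: "c > 0"
    and e: "\<epsilon> \<ge> 0"
    and Z [measurable]: "\<And>i. i \<in> I \<Longrightarrow> Z i \<in> borel_measurable M"
    and Z' [measurable]: "\<And>i. i \<in> I \<Longrightarrow> Z' i \<in> borel_measurable M'"
    and le: "\<And>\<theta>. cmod ((\<integral>\<omega>. cis (\<Sum>i\<in>I. \<theta> i \<bullet> Z i \<omega>) \<partial>M) - (\<integral>\<omega>. cis (\<Sum>i\<in>I. \<theta> i \<bullet> Z' i \<omega>) \<partial>M'))
       \<le> \<epsilon> * (\<Prod>i\<in>I. exp (- (c * (norm (\<theta> i))\<^sup>2)))"
    and U: "\<And>i. open (U i)" "\<And>i. bounded (U i)"
  shows "measure M {\<omega> \<in> space M. \<forall>i\<in>I. Z i \<omega> \<in> U i} \<le> measure M' {\<omega> \<in> space M'. \<forall>i\<in>I. Z' i \<omega> \<in> U i} +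
      \<epsilon> * ((sqrt (pi / c) / (2 * pi)) ^ DIM('e)) ^ card I * (\<Prod>i\<in>I. measure lborel (U i))"
proof -
  interpret M: prob_space M by fact
  interpret M': prob_space M' by fact
  define h where "h m i x = min 1 (real m * infdist x (- U i))" for m i x
  define E where "E = \<epsilon> * ((sqrt (pi / c) / (2 * pi)) ^ DIM('e)) ^ card I"
  have E: "E \<ge> 0" using e c by (simp add: E_def)
  have ne: "- U i \<noteq> {}" for i using U(2) [of i] not_bounded_UNIV [where 'a = 'e] by (metis Compl_empty_eq double_complement)
  have h01: "0 \<le> h m i x" "h m i x \<le> 1" for m i x
    by (auto simp: h_def infdist_nonneg)
  have hind: "h m i x \<le> indicator (U i) x" for m i x
    using ne [of i] by (auto simp: h_def indicator_def)
  have cont: "continuous_on UNIV (h m i)" for m i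
    unfolding h_def by (intro continuous_intros)
  have hlim: "(\<lambda>m. h m i x) \<longlonglongrightarrow> indicator (U i) x" for i x
  proof (cases "x \<in> U i")
    case True
    then have p: "infdist x (- U i) > 0"
      using U(1) [of i] ne [of i] in_closed_iff_infdist_zero [of "- U i" x] infdist_nonneg [of x "- U i"]
      by (auto simp: closed_Compl less_le)
    have "eventually (\<lambda>m. h m i x = 1) sequentially"
    proof -
      obtain m0 where "1 / infdist x (- U i) \<le> real m0" using real_arch_simple by blast
      then have "h m i x = 1" if "m \<ge> m0" for m
      proof -
        have "1 / infdist x (- U i) \<le> real m" using \<open>1 / _ \<le> real m0\<close> that by linarith
        then show ?thesis using p by (simp add: h_def field_simps)
      qed
      then show ?thesis by (auto simp: eventually_sequentially)
    qed
    then show ?thesis using True by (simp add: tendsto_eventually)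
  next
    case False
    then have "h m i x = 0" for m by (simp add: h_def)
    then show ?thesis using False by simp
  qed
  have [measurable]: "h m i \<in> borel_measurable borel" for m i
    using cont by (rule borel_measurable_continuous_onI)
  have lim: "(\<lambda>m. \<integral>\<^sup>+\<omega>. (\<Prod>i\<in>I. ennreal (h m i (X i \<omega>))) \<partial>N) \<longlonglongrightarrow> ennreal (measure N {\<omega> \<in> space N. \<forall>i\<in>I. X i \<omega> \<in> U i})"
    if N: "prob_space N" and X [measurable]: "\<And>i. i \<in> I \<Longrightarrow> X i \<in> borel_measurable N" for N :: "'z measure" and X
  proof -
    interpret N: prob_space N by fact
    have [measurable]: "U i \<in> sets borel" for i using U(1) by auto
    have [measurable]: "{\<omega> \<in> space N. \<forall>i\<in>I. X i \<omega> \<in> U i} \<in> sets N"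
      using I by measurable
    have "(\<lambda>m. \<integral>\<^sup>+\<omega>. ennreal (\<Prod>i\<in>I. h m i (X i \<omega>)) \<partial>N) \<longlonglongrightarrow> (\<integral>\<^sup>+\<omega>. ennreal (\<Prod>i\<in>I. indicator (U i) (X i \<omega>)) \<partial>N)"
    proof (rule nn_integral_dominated_convergence [where w = "\<lambda>_. 1"])
      show "AE x in N. ennreal (\<Prod>i\<in>I. h m i (X i x)) \<le> 1" for m
        using h01 by (auto intro!: prod_le_1 simp: ennreal_le_1)
      show "AE x in N. (\<lambda>k. ennreal (\<Prod>i\<in>I. h k i (X i x))) \<longlonglongrightarrow> ennreal (\<Prod>i\<in>I. indicator (U i) (X i x))"
        using hlim by (auto intro!: tendsto_intros)
    qed (auto simp: N.emeasure_space_1)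
    also have "(\<integral>\<^sup>+\<omega>. ennreal (\<Prod>i\<in>I. indicator (U i) (X i \<omega>)) \<partial>N) =
        (\<integral>\<^sup>+\<omega>. indicator {\<omega> \<in> space N. \<forall>i\<in>I. X i \<omega> \<in> U i} \<omega> \<partial>N)"
    proof (intro nn_integral_cong)
      fix \<omega> assume "\<omega> \<in> space N"
      then show "ennreal (\<Prod>i\<in>I. indicator (U i) (X i \<omega>)) = indicator {\<omega> \<in> space N. \<forall>i\<in>I. X i \<omega> \<in> U i} \<omega>"
      proof (cases "\<forall>i\<in>I. X i \<omega> \<in> U i")
        case False
        then have "\<exists>i\<in>I. indicator (U i) (X i \<omega>) = (0 :: real)" by (auto simp: indicator_def)
        then have "(\<Prod>i\<in>I. indicator (U i) (X i \<omega>)) = (0 :: real)" by (rule prod_zero [OF I])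
        then show ?thesis using False by (simp only: indicator_simps mem_Collect_eq) simp
      qed auto
    qed
    finally show ?thesis using h01 by (simp add: prod_ennreal N.emeasure_eq_measure)
  qed
  have vol: "(\<Prod>i\<in>I. \<integral>\<^sup>+a. ennreal (h m i a) \<partial>lborel) \<le> ennreal (\<Prod>i\<in>I. measure lborel (U i))" for m
  proof -
    have "(\<integral>\<^sup>+a. ennreal (h m i a) \<partial>lborel) \<le> ennreal (measure lborel (U i))" for i
    proof -
      have "(\<integral>\<^sup>+a. ennreal (h m i a) \<partial>lborel) \<le> (\<integral>\<^sup>+a. indicator (U i) a \<partial>lborel)"
        using hind [of m i] by (intro nn_integral_mono) (metis ennreal_leI ennreal_indicator)
      also have "\<dots> = ennreal (measure lborel (U i))"
        using U emeasure_bounded_finite [of "U i"]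
        by (simp add: emeasure_eq_ennreal_measure less_top)
      finally show ?thesis .
    qed
    then have "(\<Prod>i\<in>I. \<integral>\<^sup>+a. ennreal (h m i a) \<partial>lborel) \<le> (\<Prod>i\<in>I. ennreal (measure lborel (U i)))"
      by (intro prod_mono_ennreal)
    then show ?thesis by (simp add: prod_ennreal)
  qed
  have "ennreal (measure M {\<omega> \<in> space M. \<forall>i\<in>I. Z i \<omega> \<in> U i}) \<le>
      ennreal (measure M' {\<omega> \<in> space M'. \<forall>i\<in>I. Z' i \<omega> \<in> U i}) + ennreal E * ennreal (\<Prod>i\<in>I. measure lborel (U i))"
  proof (rule LIMSEQ_le [OF lim [OF M Z]])
    show "(\<lambda>m. (\<integral>\<^sup>+\<omega>. (\<Prod>i\<in>I. ennreal (h m i (Z' i \<omega>))) \<partial>M') + ennreal E * ennreal (\<Prod>i\<in>I. measure lborel (U i)))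
      \<longlonglongrightarrow> ennreal (measure M' {\<omega> \<in> space M'. \<forall>i\<in>I. Z' i \<omega> \<in> U i}) + ennreal E * ennreal (\<Prod>i\<in>I. measure lborel (U i))"
      by (intro tendsto_intros lim [OF M' Z'])
    show "\<exists>N. \<forall>m\<ge>N. (\<integral>\<^sup>+\<omega>. (\<Prod>i\<in>I. ennreal (h m i (Z i \<omega>))) \<partial>M) \<le>
       (\<integral>\<^sup>+\<omega>. (\<Prod>i\<in>I. ennreal (h m i (Z' i \<omega>))) \<partial>M') + ennreal E * ennreal (\<Prod>i\<in>I. measure lborel (U i))"
      using comparison_continuous [OF M M' I c e Z Z' le cont h01] vol
      unfolding E_def by (meson add_left_mono mult_left_mono order_trans zero_le)
  qed
  also have "\<dots> = ennreal (measure M' {\<omega> \<in> space M'. \<forall>i\<in>I. Z' i \<omega> \<in> U i} + E * (\<Prod>i\<in>I. measure lborel (U i)))"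
    using E by (simp add: ennreal_mult' prod_nonneg ennreal_plus)
  finally show ?thesis
    using E unfolding E_def [symmetric] by (subst (asm) ennreal_le_iff) (auto intro!: add_nonneg_nonneg mult_nonneg_nonneg prod_nonneg)
qed

section \<open>Linear images of Gaussian families\<close>

lemma std_complex_gaussian_distr:
  assumes "std_complex_gaussian M X"
  shows "distr M borel X = gaussian_measure (1 / sqrt 2)" "X \<in> borel_measurable M"
proof -
  have d: "distributed M lborel X (\<lambda>z. ennreal (1 / pi * exp (- (cmod z)\<^sup>2)))"
    using assms by (simp add: std_complex_gaussian_def)
  then show "X \<in> borel_measurable M"
    by (auto dest: distributed_measurable)
  have "(\<Prod>b\<in>Basis. normal_density 0 (1 / sqrt 2) (z \<bullet> b)) = 1 / pi * exp (- (cmod z)\<^sup>2)" for z :: complex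
    by (subst normal_density_prod) (simp_all add: power_divide power2_eq_square field_simps)
  then have "gaussian_measure (1 / sqrt 2) = density lborel (\<lambda>z :: complex. ennreal (1 / pi * exp (- (cmod z)\<^sup>2)))"
    by (simp add: gaussian_measure_def)
  also have "\<dots> = distr M lborel X"
    using d by (simp add: distributed_distr_eq_density)
  also have "\<dots> = distr M borel X"
    by (rule distr_cong) simp_all
  finally show "distr M borel X = gaussian_measure (1 / sqrt 2)" ..
qed

text \<open>For the real inner product on the plane, the adjoint of multiplication by a is
  multiplication by its conjugate; hence the conjugates in all Gram matrices below.\<close>

lemma inner_mult_right_complex: "\<alpha> \<bullet> (a * z) = (\<alpha> * cnj a) \<bullet> z" for \<alpha> a z :: complex
  by (simp add: inner_complex_def algebra_simps)

locale gaussian_family = prob_space M for M :: "'a measure" +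
  fixes \<zeta> :: "'k \<Rightarrow> 'a \<Rightarrow> complex" and J :: "'k set"
  assumes finite_J: "finite J"
    and indep: "indep_vars (\<lambda>_. borel) \<zeta> J"
    and gauss: "\<And>j. j \<in> J \<Longrightarrow> std_complex_gaussian M (\<zeta> j)"
begin

lemma zeta_measurable [measurable]: "j \<in> J \<Longrightarrow> \<zeta> j \<in> borel_measurable M"
  using std_complex_gaussian_distr(2) [OF gauss] .

text \<open>By independence the factors multiply, and scale 1 / sqrt 2 gives the exponent |c|^2 / 4.
  Thus every linear image has characteristic function exp (- Q / 4) for a Hermitian form Q, and
  comparing laws reduces to comparing forms.\<close>

lemma char_linear:
  "(\<integral>\<omega>. cis (\<Sum>k\<in>J. c k \<bullet> \<zeta> k \<omega>) \<partial>M) = exp (- (\<Sum>k\<in>J. (cmod (c k))\<^sup>2) / 4)"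
proof (cases "J = {}")
  case True then show ?thesis by (simp add: prob_space)
next
  case False
  have prod: "(\<Prod>k\<in>J. cis (f k)) = cis (\<Sum>k\<in>J. f k)" for f :: "'k \<Rightarrow> real"
    using finite_J by (induction J rule: finite_induct) (auto simp: cis_mult)
  have "indep_vars (\<lambda>_. borel) (\<lambda>k. (\<lambda>z. cis (c k \<bullet> z)) \<circ> \<zeta> k) J"
    by (rule indep_vars_compose [OF indep]) measurable
  then have "(\<integral>\<omega>. (\<Prod>k\<in>J. ((\<lambda>z. cis (c k \<bullet> z)) \<circ> \<zeta> k) \<omega>) \<partial>M) = (\<Prod>k\<in>J. \<integral>\<omega>. ((\<lambda>z. cis (c k \<bullet> z)) \<circ> \<zeta> k) \<omega> \<partial>M)"
    by (intro indep_vars_lebesgue_integral finite_J) (auto simp: comp_def intro!: integrable_const_bound [of _ 1])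
  moreover have "(\<integral>\<omega>. cis (c k \<bullet> \<zeta> k \<omega>) \<partial>M) = of_real (exp (- (cmod (c k))\<^sup>2 / 4))" if "k \<in> J" for k
  proof -
    have "(\<integral>\<omega>. cis (c k \<bullet> \<zeta> k \<omega>) \<partial>M) = (\<integral>z. cis (c k \<bullet> z) \<partial>distr M borel (\<zeta> k))"
      using that by (subst integral_distr) simp_all
    also have "\<dots> = (\<integral>z. cis (z \<bullet> c k) \<partial>gaussian_measure (1 / sqrt 2))"
      by (simp add: std_complex_gaussian_distr(1) [OF gauss [OF that]] inner_commute)
    also have "\<dots> = of_real (exp (- (cmod (c k))\<^sup>2 / 4))"
      by (subst gaussian_measure_char) (simp_all add: power_divide)
    finally show ?thesis .
  qed
  ultimately show ?thesis
    by (simp add: prod) (simp add: exp_sum finite_J sum_divide_distrib flip: sum_negf of_real_prod of_real_exp)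
qed

end

text \<open>Expanding the square, the diagonal of the Gram matrix gives \<open>\<Sum>t. |\<alpha> t|\<^sup>2\<close>, while the
  off-diagonal error is at most \<open>\<epsilon> (\<Sum>t. |\<alpha> t|)\<^sup>2\<close>.\<close>

lemma gram_perturbation:
  fixes a :: "'t \<Rightarrow> 'k \<Rightarrow> complex" and \<alpha> :: "'t \<Rightarrow> complex"
  assumes T: "finite T" and J: "finite J"
    and diff: "\<And>t u. t \<in> T \<Longrightarrow> u \<in> T \<Longrightarrow> cmod ((\<Sum>k\<in>J. cnj (a t k) * a u k) - g t u) \<le> \<epsilon>"
  shows "cmod (of_real (\<Sum>k\<in>J. (cmod (\<Sum>t\<in>T. \<alpha> t * cnj (a t k)))\<^sup>2) - (\<Sum>t\<in>T. \<Sum>u\<in>T. \<alpha> t * cnj (\<alpha> u) * g t u))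
    \<le> \<epsilon> * card T * (\<Sum>t\<in>T. (cmod (\<alpha> t))\<^sup>2)"
proof -
  have eps: "T = {} \<or> \<epsilon> \<ge> 0" using diff by (metis all_not_in_conv norm_ge_zero order_trans)
  have "complex_of_real (\<Sum>k\<in>J. (cmod (\<Sum>t\<in>T. \<alpha> t * cnj (a t k)))\<^sup>2) =
      (\<Sum>k\<in>J. (\<Sum>t\<in>T. \<alpha> t * cnj (a t k)) * cnj (\<Sum>u\<in>T. \<alpha> u * cnj (a u k)))"
    by (simp only: of_real_sum complex_norm_square of_real_power [symmetric])
  also have "\<dots> = (\<Sum>k\<in>J. \<Sum>t\<in>T. \<Sum>u\<in>T. \<alpha> t * cnj (\<alpha> u) * (cnj (a t k) * a u k))"
    by (simp add: sum_product algebra_simps)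
  also have "\<dots> = (\<Sum>t\<in>T. \<Sum>u\<in>T. \<alpha> t * cnj (\<alpha> u) * (\<Sum>k\<in>J. cnj (a t k) * a u k))"
    by (subst sum.swap, intro sum.cong refl, subst sum.swap) (simp add: sum_distrib_left)
  finally have "cmod (of_real (\<Sum>k\<in>J. (cmod (\<Sum>t\<in>T. \<alpha> t * cnj (a t k)))\<^sup>2) - (\<Sum>t\<in>T. \<Sum>u\<in>T. \<alpha> t * cnj (\<alpha> u) * g t u)) =
     cmod (\<Sum>t\<in>T. \<Sum>u\<in>T. \<alpha> t * cnj (\<alpha> u) * ((\<Sum>k\<in>J. cnj (a t k) * a u k) - g t u))"
    by (simp add: right_diff_distrib sum_subtractf)
  also have "\<dots> \<le> (\<Sum>t\<in>T. \<Sum>u\<in>T. cmod (\<alpha> t) * cmod (\<alpha> u) * \<epsilon>)"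
    by (intro sum_norm_le) (auto simp: norm_mult intro!: mult_left_mono diff)
  also have "\<dots> \<le> (\<Sum>t\<in>T. \<Sum>u\<in>T. ((cmod (\<alpha> t))\<^sup>2 / 2 + (cmod (\<alpha> u))\<^sup>2 / 2) * \<epsilon>)"
  proof (intro sum_mono mult_right_mono)
    fix t u
    show "cmod (\<alpha> t) * cmod (\<alpha> u) \<le> (cmod (\<alpha> t))\<^sup>2 / 2 + (cmod (\<alpha> u))\<^sup>2 / 2"
      using sum_squares_bound [of "cmod (\<alpha> t)" "cmod (\<alpha> u)"] by simp
  qed (use eps in auto)
  also have "\<dots> = \<epsilon> * card T * (\<Sum>t\<in>T. (cmod (\<alpha> t))\<^sup>2)"
    by (simp add: distrib_right sum.distrib sum_distrib_left [symmetric] sum_distrib_right [symmetric]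
        sum_divide_distrib [symmetric] field_simps)
  finally show ?thesis .
qed

section \<open>Trigonometric polynomials and their Gram matrices\<close>

text \<open>The root mean square of the frequencies - n, ..., n, compare
  \<open>sum_int_square\<close>.\<close>

definition deriv_sd :: "nat \<Rightarrow> real" where
  "deriv_sd n = sqrt (real n * (real n + 1) / 3)"

text \<open>The coefficient vectors of \<open>\<zeta> \<mapsto> P\<^sup>(\<^sup>p\<^sup>)(x) / (deriv_sd n) ^ p\<close>; \<open>deriv_sd n\<close> is the standard deviation
  of the derivative, so that \<open>p = 0, 1\<close> give unit vectors.\<close>

definition trig_coeff :: "nat \<Rightarrow> nat \<Rightarrow> real \<Rightarrow> int \<Rightarrow> complex" where
  "trig_coeff n p x k = of_real (1 / sqrt (2 * real n + 1)) * (\<i> * of_real (of_int k / deriv_sd n)) ^ p * cis (of_int k * x)"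

definition scaled_deriv :: "nat \<Rightarrow> nat \<Rightarrow> (int \<Rightarrow> complex) \<Rightarrow> real \<Rightarrow> complex" where
  "scaled_deriv n p a x = (\<Sum>k = - int n..int n. trig_coeff n p x k * a k)"

text \<open>The correlation between the values of P at two points at distance d, see
  \<open>trig_coeff_gram_dirichlet\<close>.\<close>

definition dirichlet :: "nat \<Rightarrow> real \<Rightarrow> real" where
  "dirichlet n d = (\<Sum>k = - int n..int n. cos (of_int k * d)) / (2 * real n + 1)"

lemma deriv_sd_pos: "n > 0 \<Longrightarrow> deriv_sd n > 0"
  by (simp add: deriv_sd_def)

lemma deriv_sd_square: "(deriv_sd n)\<^sup>2 = real n * (real n + 1) / 3"
  by (simp add: deriv_sd_def)

lemma sum_int_Suc:
  "(\<Sum>k = - int (Suc n)..int (Suc n). f k) = f (- int (Suc n)) + f (int (Suc n)) + (\<Sum>k = - int n..int n. f k)"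
  for f :: "int \<Rightarrow> 'a::comm_monoid_add"
proof -
  have "{- int (Suc n)..int (Suc n)} = insert (- int (Suc n)) (insert (int (Suc n)) {- int n..int n})"
    by auto
  then show ?thesis by (simp add: add.assoc)
qed

lemma sum_int_nat:
  "(\<Sum>k = - int n..int n. f k) = (\<Sum>i\<le>2 * n. f (int i - int n))" for f :: "int \<Rightarrow> 'a::comm_monoid_add"
  by (rule sum.reindex_bij_witness [of _ "\<lambda>i. int i - int n" "\<lambda>k. nat (k + int n)"]) auto

lemma sum_int_odd: "(\<Sum>k = - int n..int n. of_int k) = (0 :: real)"
  by (induction n) (simp_all add: sum_int_Suc del: of_nat_Suc)

lemma sum_int_square: "(\<Sum>k = - int n..int n. (of_int k)\<^sup>2) = real n * (real n + 1) * (2 * real n + 1) / 3"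
proof (induction n)
  case (Suc n)
  show ?case unfolding sum_int_Suc Suc.IH by (simp add: field_simps power2_eq_square)
qed simp

lemma trig_poly_scaled_deriv: "trig_poly a n x = scaled_deriv n 0 a x"
  by (simp add: trig_poly_cis scaled_deriv_def trig_coeff_def sum_distrib_left mult_ac)

lemma trig_coeff_deriv:
  assumes "n > 0"
  shows "((\<lambda>x. trig_coeff n p x k) has_vector_derivative of_real (deriv_sd n) * trig_coeff n (Suc p) x k) (at x)"
proof -
  have "((\<lambda>x. cis (of_int k * x)) has_vector_derivative (of_int k *\<^sub>R (\<i> * cis (of_int k * x)))) (at x)"
  proof -
    have "((\<lambda>x. cis (of_int k * x)) has_derivative (\<lambda>t. (of_int k * t) *\<^sub>R (\<i> * cis (of_int k * x)))) (at x)"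
      by (rule has_derivative_cis) (auto intro!: derivative_eq_intros)
    then show ?thesis unfolding has_vector_derivative_def scaleR_scaleR by (simp only: mult.commute)
  qed
  then have "((\<lambda>x. trig_coeff n p x k) has_vector_derivative
      of_real (1 / sqrt (2 * real n + 1)) * (\<i> * of_real (of_int k / deriv_sd n)) ^ p * (of_int k *\<^sub>R (\<i> * cis (of_int k * x)))) (at x)"
    unfolding trig_coeff_def by (rule has_vector_derivative_mult_right)
  then show ?thesis
    using deriv_sd_pos [OF assms] by (simp add: trig_coeff_def scaleR_conv_of_real field_simps)
qed

lemma scaled_deriv_deriv:
  assumes "n > 0"
  shows "(scaled_deriv n p a has_vector_derivative of_real (deriv_sd n) * scaled_deriv n (Suc p) a x) (at x)"
proof -
  have "(scaled_deriv n p a has_vector_derivative (\<Sum>k = - int n..int n. of_real (deriv_sd n) * trig_coeff n (Suc p) x k * a k)) (at x)"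
    unfolding scaled_deriv_def [abs_def] by (intro has_vector_derivative_sum has_vector_derivative_mult_left trig_coeff_deriv assms)
  then show ?thesis by (simp add: scaled_deriv_def sum_distrib_left mult_ac)
qed

lemma trig_coeff_gram:
  "cnj (trig_coeff n p x k) * trig_coeff n q y k =
     of_real (1 / (2 * real n + 1)) * (cnj \<i> ^ p * \<i> ^ q) * (of_real ((of_int k / deriv_sd n) ^ (p + q)) * cis (of_int k * (y - x)))"
proof -
  have "cnj (trig_coeff n p x k) * trig_coeff n q y k =
     of_real (1 / sqrt (2 * real n + 1) * (1 / sqrt (2 * real n + 1))) * (cnj \<i> ^ p * \<i> ^ q) *
     (of_real ((of_int k / deriv_sd n) ^ (p + q)) * (cis (- (of_int k * x)) * cis (of_int k * y)))"
    unfolding trig_coeff_def by (simp only: complex_cnj_mult complex_cnj_power complex_cnj_complex_of_real power_mult_distrib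
        cis_cnj power_add of_real_mult of_real_power mult_ac)
  then show ?thesis by (simp add: cis_mult algebra_simps)
qed

section \<open>Summation by parts for the off-diagonal Gram entries\<close>

lemma abel_summation:
  fixes z :: complex
  shows "(1 - z) * (\<Sum>i\<le>m. of_real (b i) * z ^ i) =
    of_real (b 0) - of_real (b m) * z ^ Suc m + (\<Sum>i<m. of_real (b (Suc i) - b i) * z ^ Suc i)"
  by (induction m) (simp_all add: algebra_simps)

text \<open>A weighted geometric sum is controlled by the size and the total variation of its
  weights; all cancellation is in 1 / |1 - z|.\<close>

lemma abel_bound:
  assumes z: "cmod z = 1" "z \<noteq> 1" and b: "\<And>i. i \<le> m \<Longrightarrow> \<bar>b i\<bar> \<le> B" and \<Delta>: "\<And>i. i < m \<Longrightarrow> \<bar>b (Suc i) - b i\<bar> \<le> \<Delta>"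
  shows "cmod (\<Sum>i\<le>m. of_real (b i) * z ^ i) \<le> (2 * B + real m * \<Delta>) / cmod (1 - z)"
proof -
  have "cmod ((1 - z) * (\<Sum>i\<le>m. of_real (b i) * z ^ i)) \<le> \<bar>b 0\<bar> + \<bar>b m\<bar> + (\<Sum>i<m. \<bar>b (Suc i) - b i\<bar>)"
    unfolding abel_summation using z
    by (intro norm_triangle_le norm_triangle_le_diff add_mono order_trans [OF norm_sum] sum_mono)
       (simp_all add: norm_mult norm_power flip: of_real_diff)
  also have "\<dots> \<le> B + B + (\<Sum>i<m. \<Delta>)"
    by (intro add_mono sum_mono b \<Delta>) auto
  finally have "cmod (\<Sum>i\<le>m. of_real (b i) * z ^ i) * cmod (1 - z) \<le> 2 * B + real m * \<Delta>"
    by (simp add: norm_mult mult.commute)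
  moreover have "cmod (1 - z) > 0" using z by simp
  ultimately show ?thesis by (simp only: pos_le_divide_eq)
qed

text \<open>The weights (k / \<open>deriv_sd n\<close>)^(p + q) are at most 3 and change by at most
  6 / n per step, so over 2 n steps summation by parts yields 2 * 3 + 2 n * (6 / n) = 18.\<close>

lemma trig_coeff_gram_bound:
  assumes n: "n > 0" and pq: "p \<le> 1" "q \<le> 1" and d: "cis (y - x) \<noteq> 1"
  shows "cmod (\<Sum>k = - int n..int n. cnj (trig_coeff n p x k) * trig_coeff n q y k) \<le> 18 / (real n * cmod (1 - cis (y - x)))"
proof -
  define r where "r = p + q"
  have r: "r = 0 \<or> r = 1 \<or> r = 2" using pq unfolding r_def by linarith
  have s: "deriv_sd n > 0" using n by (rule deriv_sd_pos)
  have s2: "(real n)\<^sup>2 \<le> 3 * (deriv_sd n)\<^sup>2" by (simp add: deriv_sd_square) (simp add: power2_eq_square algebra_simps)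
  have s1: "real n \<le> sqrt 3 * deriv_sd n"
    using s2 s less_imp_le [OF s] by (auto intro: power2_le_imp_le [OF _ mult_nonneg_nonneg] simp: power_mult_distrib)
  define b where "b i = (real_of_int (int i - int n) / deriv_sd n) ^ r" for i
  have ab: "\<bar>real_of_int (int i - int n)\<bar> \<le> real n" if "i \<le> 2 * n" for i using that by auto
  have y3: "\<bar>real_of_int (int i - int n) / deriv_sd n\<bar> \<le> sqrt 3" if "i \<le> 2 * n" for i
    using ab [OF that] s1 s by (simp add: field_simps)
  have sq3: "1 \<le> sqrt 3" "sqrt 3 \<le> 3" "sqrt 3 * sqrt 3 = (3::real)" by (auto intro: real_le_lsqrt)
  have b3: "\<bar>b i\<bar> \<le> 3" if "i \<le> 2 * n" for i
  proof -
    have "\<bar>real_of_int (int i - int n) / deriv_sd n\<bar>\<^sup>2 \<le> (sqrt 3)\<^sup>2" using y3 [OF that] by (intro power_mono) auto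
    then have "\<bar>(real_of_int (int i - int n) / deriv_sd n)\<^sup>2\<bar> \<le> 3" by (simp only: power2_abs abs_power2) simp
    moreover have "\<bar>real_of_int (int i - int n) / deriv_sd n\<bar> \<le> 3" using y3 [OF that] sq3(2) by (rule order_trans)
    moreover have "\<bar>u ^ r\<bar> \<le> 3" if "\<bar>u\<^sup>2\<bar> \<le> 3" "\<bar>u\<bar> \<le> 3" for u :: real
      using r that by auto
    ultimately show ?thesis unfolding b_def by blast
  qed
  have inv: "1 / deriv_sd n \<le> sqrt 3 / real n" using s1 s n by (simp add: field_simps)
  have db: "\<bar>b (Suc i) - b i\<bar> \<le> 6 / real n" if i: "i < 2 * n" for i
  proof -
    define u where "u = real_of_int (int i - int n) / deriv_sd n"
    define v where "v = real_of_int (int (Suc i) - int n) / deriv_sd n"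
    have uv: "\<bar>u\<bar> \<le> sqrt 3" "\<bar>v\<bar> \<le> sqrt 3" unfolding u_def v_def using i by (intro y3; simp)+
    have vu: "v - u = 1 / deriv_sd n" unfolding u_def v_def using s by (simp add: field_simps)
    have "\<bar>v\<^sup>2 - u\<^sup>2\<bar> = \<bar>v + u\<bar> * (1 / deriv_sd n)"
      using s by (simp add: power2_eq_square square_diff_square_factored abs_mult vu)
    also have "\<dots> \<le> (2 * sqrt 3) * (sqrt 3 / real n)"
      using uv s by (intro mult_mono inv) auto
    finally have "\<bar>v\<^sup>2 - u\<^sup>2\<bar> \<le> 6 / real n" by (simp add: mult.assoc)
    moreover have "\<bar>v - u\<bar> \<le> 6 / real n"
      using vu s inv sq3 n by (smt (verit) divide_right_mono of_nat_0_le_iff divide_nonneg_pos)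
    ultimately show ?thesis using r unfolding b_def u_def [symmetric] v_def [symmetric] by auto
  qed
  have cisn: "cis (of_int (int i - int n) * (y - x)) = cis (- (real n * (y - x))) * cis (y - x) ^ i" for i
    unfolding Complex.DeMoivre cis_mult by (rule arg_cong [of _ _ cis]) (simp add: algebra_simps)
  have "(\<Sum>k = - int n..int n. cnj (trig_coeff n p x k) * trig_coeff n q y k) =
    of_real (1 / (2 * real n + 1)) * (cnj \<i> ^ p * \<i> ^ q) * (\<Sum>i\<le>2 * n. of_real (b i) * cis (of_int (int i - int n) * (y - x)))"
    unfolding trig_coeff_gram sum_distrib_left [symmetric] sum_int_nat b_def r_def ..
  also have "(\<Sum>i\<le>2 * n. of_real (b i) * cis (of_int (int i - int n) * (y - x))) =
      cis (- (real n * (y - x))) * (\<Sum>i\<le>2 * n. of_real (b i) * cis (y - x) ^ i)"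
    unfolding cisn sum_distrib_left by (simp add: mult_ac)
  finally have "cmod (\<Sum>k = - int n..int n. cnj (trig_coeff n p x k) * trig_coeff n q y k) =
     1 / (2 * real n + 1) * cmod (\<Sum>i\<le>2 * n. of_real (b i) * cis (y - x) ^ i)"
    by (simp only: norm_mult norm_power norm_of_real norm_cis complex_mod_cnj norm_ii) simp
  also have "\<dots> \<le> 1 / (2 * real n + 1) * ((2 * 3 + real (2 * n) * (6 / real n)) / cmod (1 - cis (y - x)))"
    by (intro mult_left_mono abel_bound b3 db) (use d in auto)
  also have "\<dots> = 18 / ((2 * real n + 1) * cmod (1 - cis (y - x)))" using n by simp
  also have "\<dots> \<le> 18 / (real n * cmod (1 - cis (y - x)))"
    using n d by (intro divide_left_mono mult_right_mono mult_pos_pos) auto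
  finally show ?thesis .
qed

text \<open>The mixed entry vanishes because k is odd on the symmetric range, and the entry p = q =
  1 is 1 by the choice of \<open>deriv_sd\<close>. So value and scaled derivative at one point are
  uncorrelated unit variables.\<close>

lemma trig_coeff_gram_same:
  assumes n: "n > 0" and pq: "p \<le> 1" "q \<le> 1"
  shows "(\<Sum>k = - int n..int n. cnj (trig_coeff n p x k) * trig_coeff n q x k) = (if p = q then 1 else 0)"
proof -
  have s: "deriv_sd n > 0" using n by (rule deriv_sd_pos)
  have N: "2 * real n + 1 > 0" by simp
  have "p = 0 \<or> p = 1" "q = 0 \<or> q = 1" using pq by auto
  moreover have "(\<Sum>k = - int n..int n. (real_of_int k / deriv_sd n)) = 0"
    using sum_int_odd [of n] by (simp flip: sum_divide_distrib)
  moreover have "(\<Sum>k = - int n..int n. (real_of_int k / deriv_sd n)\<^sup>2) = 2 * real n + 1"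
  proof -
    have "(\<Sum>k = - int n..int n. (real_of_int k / deriv_sd n)\<^sup>2) = (\<Sum>k = - int n..int n. (real_of_int k)\<^sup>2) / (deriv_sd n)\<^sup>2"
      by (simp add: power_divide sum_divide_distrib)
    then show ?thesis unfolding sum_int_square deriv_sd_square using n by simp
  qed
  ultimately show ?thesis
    unfolding trig_coeff_gram sum_distrib_left [symmetric] using N
    by (elim disjE) (simp_all add: numeral_2_eq_2 [symmetric] complex_eq_iff flip: of_real_sum of_real_power of_real_divide)
qed

lemma trig_coeff_gram_dirichlet:
  "(\<Sum>k = - int n..int n. cnj (trig_coeff n 0 x k) * trig_coeff n 0 y k) = of_real (dirichlet n (y - x))"
proof -
  have "(\<Sum>k = - int n..int n. cis (of_int k * d)) = of_real (\<Sum>k = - int n..int n. cos (of_int k * d))" for d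
  proof (induction n)
    case (Suc n)
    have e: "of_int (- int (Suc n)) * d = - (of_int (int (Suc n)) * d)" by (simp add: algebra_simps)
    show ?case unfolding sum_int_Suc Suc.IH e by (simp add: complex_eq_iff del: of_nat_Suc)
  qed simp
  then show ?thesis unfolding trig_coeff_gram sum_distrib_left [symmetric] dirichlet_def by simp
qed

section \<open>The Dirichlet kernel near and away from its peak\<close>

lemma jordan_sin:
  assumes "0 \<le> x" "x \<le> pi / 2"
  shows "2 * x / pi \<le> sin x"
proof -
  \<comment> \<open>On this interval sin lies above its chord.\<close>
  have "concave_on {0..pi / 2} sin"
    unfolding concave_on_def
    by (rule f''_ge0_imp_convex [where f' = "\<lambda>x. - cos x" and f'' = sin])
       (auto intro!: derivative_eq_intros sin_ge_zero)
  then have "sin ((1 - 2 * x / pi) *\<^sub>R 0 + (2 * x / pi) *\<^sub>R (pi / 2)) \<ge> (1 - 2 * x / pi) * sin 0 + (2 * x / pi) * sin (pi / 2)"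
    using assms by (intro concave_onD) (auto simp: field_simps)
  then show ?thesis by simp
qed

lemma cmod_one_minus_cis: "cmod (1 - cis d) = 2 * \<bar>sin (d / 2)\<bar>"
proof -
  have "(cmod (1 - cis d))\<^sup>2 = (1 - cos d)\<^sup>2 + (sin d)\<^sup>2" by (simp add: cmod_power2)
  also have "\<dots> = 2 - 2 * cos d" using sin_cos_squared_add [of d] by (simp add: power2_eq_square algebra_simps)
  also have "\<dots> = (2 * \<bar>sin (d / 2)\<bar>)\<^sup>2" using cos_double_sin [of "d / 2"] by (simp add: power_mult_distrib)
  finally show ?thesis by (rule power2_eq_imp_eq) auto
qed

lemma cmod_one_minus_cis_ge:
  assumes "0 \<le> \<delta>" "\<delta> \<le> \<bar>d\<bar>" "\<bar>d\<bar> \<le> 2 * pi - \<delta>"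
  shows "cmod (1 - cis d) \<ge> 2 * \<delta> / pi"
proof -
  define e where "e = \<bar>d\<bar> / 2"
  have e: "\<delta> / 2 \<le> e" "e \<le> pi - \<delta> / 2" using assms by (auto simp: e_def)
  have "sin e \<ge> 2 * (\<delta> / 2) / pi"
  \<comment> \<open>Beyond pi / 2 the symmetry of sin passes to the complementary arc.\<close>
  proof (cases "e \<le> pi / 2")
    case True
    have "2 * (\<delta> / 2) / pi \<le> 2 * e / pi" using e by (intro divide_right_mono) auto
    also have "\<dots> \<le> sin e" using True e assms by (intro jordan_sin) auto
    finally show ?thesis .
  next
    case False
    have "2 * (\<delta> / 2) / pi \<le> 2 * (pi - e) / pi" using e by (intro divide_right_mono) auto
    also have "\<dots> \<le> sin (pi - e)" using False e assms by (intro jordan_sin) auto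
    finally show ?thesis by simp
  qed
  moreover have "\<bar>sin (d / 2)\<bar> = \<bar>sin e\<bar>" by (cases "d \<ge> 0") (auto simp: e_def)
  ultimately show ?thesis unfolding cmod_one_minus_cis by simp
qed

text \<open>The product-to-sum formula turns each new pair of cosines into a difference of sines,
  and the sum telescopes.\<close>

lemma dirichlet_closed: "sin (d / 2) * (\<Sum>k = - int n..int n. cos (of_int k * d)) = sin ((real n + 1 / 2) * d)"
proof (induction n)
  case (Suc n)
  have "2 * sin (d / 2) * cos ((real n + 1) * d) = sin ((real n + 1) * d + d / 2) - sin ((real n + 1) * d - d / 2)"
    by (simp add: sin_add sin_diff)
  moreover have "(real n + 1) * d + d / 2 = (real (Suc n) + 1 / 2) * d" "(real n + 1) * d - d / 2 = (real n + 1 / 2) * d"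
    by (simp_all add: algebra_simps)
  moreover have "cos (- (real n + 1) * d) = cos ((real n + 1) * d)" by (metis cos_minus mult_minus_left)
  ultimately show ?case unfolding sum_int_Suc distrib_left Suc.IH by (simp add: algebra_simps)
qed simp

text \<open>Within the main lobe every k d lies in [- pi, pi], where 1 - cos is bounded below by a
  parabola; outside it the closed form already gives 1 / 2. At distances just below 1 / n this is
  the quantitative lower bound on the determinant of the covariance matrix of two nearby
  values.\<close>

lemma dirichlet_gap:
  assumes n: "n > 0" and d: "0 < d" "d \<le> pi"
  shows "\<bar>dirichlet n d\<bar> \<le> 1 - min (1 / 2) ((real n * d)\<^sup>2 / 24)"
proof -
  define N where "N = 2 * real n + 1"
  have N: "N > 0" by (simp add: N_def)
  define S where "S = (\<Sum>k = - int n..int n. cos (of_int k * d))"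
  have strip: "dirichlet n d = S / N" by (simp add: dirichlet_def N_def S_def)
  have sd: "d / pi \<le> sin (d / 2)" using jordan_sin [of "d / 2"] d by simp
  have sd0: "sin (d / 2) > 0" using sd d by (smt (verit) divide_pos_pos pi_gt_zero)
  have Sc: "sin (d / 2) * S = sin (N * d / 2)"
    unfolding S_def dirichlet_closed N_def by (rule arg_cong [of _ _ sin]) (simp add: algebra_simps)
  show ?thesis
  proof (cases "N * d \<le> 2 * pi")
    case True
    have "S \<ge> 0"
    proof -
      have "sin (N * d / 2) \<ge> 0" using True N d by (intro sin_ge_zero) auto
      then show ?thesis using Sc sd0 by (metis zero_le_mult_iff not_le)
    qed
    then have D0: "dirichlet n d \<ge> 0" using N by (simp add: strip)
    have "1 - cos (of_int k * d) \<ge> 2 * d\<^sup>2 / pi\<^sup>2 * (of_int k)\<^sup>2" if k: "k \<in> {- int n..int n}" for k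
    proof -
      define e where "e = \<bar>of_int k\<bar> * d"
      have "\<bar>real_of_int k\<bar> \<le> real n" using k by auto
      then have "e \<le> real n * d" unfolding e_def using d by (intro mult_right_mono) auto
      also have "\<dots> \<le> pi" using True d unfolding N_def by (simp add: algebra_simps)
      finally have e: "0 \<le> e" "e \<le> pi" using d by (auto simp: e_def)
      then have "e / pi \<le> sin (e / 2)" using jordan_sin [of "e / 2"] by simp
      then have "(e / pi)\<^sup>2 \<le> (sin (e / 2))\<^sup>2" using e by (intro power_mono) auto
      moreover have "cos e = 1 - 2 * (sin (e / 2))\<^sup>2" using cos_double_sin [of "e / 2"] by simp
      moreover have "cos (of_int k * d) = cos e" by (cases "k \<ge> 0") (auto simp: e_def)
      moreover have "(e / pi)\<^sup>2 = d\<^sup>2 / pi\<^sup>2 * (of_int k)\<^sup>2" by (simp add: e_def power_divide power_mult_distrib)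
      ultimately show ?thesis by simp
    qed
    then have "(\<Sum>k = - int n..int n. 2 * d\<^sup>2 / pi\<^sup>2 * (of_int k)\<^sup>2) \<le> (\<Sum>k = - int n..int n. 1 - cos (of_int k * d))"
      by (intro sum_mono)
    then have "2 * d\<^sup>2 / pi\<^sup>2 * (real n * (real n + 1) * N / 3) \<le> N - S"
      unfolding sum_distrib_left [symmetric] sum_int_square sum_subtractf S_def N_def by simp
    then have "2 * d\<^sup>2 / pi\<^sup>2 * (real n * (real n + 1) / 3) \<le> 1 - dirichlet n d"
      using N unfolding strip by (simp add: field_simps)
    \<comment> \<open>The constant is 2 / (3 * 4^2), from pi \<le> 4 and n (n + 1) \<ge>
      n^2.\<close>
    moreover have "(real n * d)\<^sup>2 / 24 \<le> 2 * d\<^sup>2 / pi\<^sup>2 * (real n * (real n + 1) / 3)"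
    proof -
      have "pi\<^sup>2 \<le> 4\<^sup>2" using pi_less_4 by (intro power_mono) auto
      then have "(real n * d)\<^sup>2 * pi\<^sup>2 \<le> (real n * d)\<^sup>2 * 16" by (intro mult_left_mono) auto
      also have "\<dots> \<le> 16 * (d\<^sup>2 * (real n * (real n + 1)))" using d by (simp add: power2_eq_square algebra_simps)
      finally show ?thesis by (simp add: field_simps)
    qed
    moreover have "min (1 / 2) ((real n * d)\<^sup>2 / 24) \<le> (real n * d)\<^sup>2 / 24" by simp
    ultimately show ?thesis using D0 by linarith
  next
    case False
    \<comment> \<open>The numerator of the closed form is at most 1, so |S| \<le> pi / d, and N d >
      2 pi makes this less than N / 2.\<close>
    have "\<bar>sin (d / 2) * S\<bar> \<le> 1" unfolding Sc by (rule abs_sin_le_one)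
    then have "sin (d / 2) * \<bar>S\<bar> \<le> 1" using sd0 by (simp add: abs_mult)
    moreover have "d / pi * \<bar>S\<bar> \<le> sin (d / 2) * \<bar>S\<bar>" using sd by (intro mult_right_mono) auto
    ultimately have "d / pi * \<bar>S\<bar> \<le> 1" by linarith
    then have "d * \<bar>S\<bar> \<le> pi" by (simp add: field_simps)
    then have "2 * (d * \<bar>S\<bar>) \<le> N * d" using False by linarith
    then have "\<bar>S\<bar> \<le> N / 2" using d by (simp add: field_simps)
    then have "\<bar>dirichlet n d\<bar> \<le> 1 / 2" using N by (simp add: strip field_simps)
    then show ?thesis by simp
  qed
qed

section \<open>Values at separated and at close points\<close>

text \<open>Uniqueness of characteristic functions as the case \<epsilon> = 0 of the comparison: the
  laws agree on bounded open sets, which are stable under intersection and generate the Borel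
  sets.\<close>

lemma distr_eqI_char:
  fixes Z :: "'a \<Rightarrow> 'e::euclidean_space" and Z' :: "'b \<Rightarrow> 'e"
  assumes M: "prob_space M" and M': "prob_space M'"
    and Z [measurable]: "Z \<in> borel_measurable M" and Z' [measurable]: "Z' \<in> borel_measurable M'"
    and eq: "\<And>\<theta>. (\<integral>\<omega>. cis (\<theta> \<bullet> Z \<omega>) \<partial>M) = (\<integral>\<omega>. cis (\<theta> \<bullet> Z' \<omega>) \<partial>M')"
  shows "distr M borel Z = distr M' borel Z'"
proof (rule measure_eqI_generator_eq)
  interpret M: prob_space M by fact
  interpret M': prob_space M' by fact
  let ?E = "{U :: 'e set. open U \<and> bounded U}"
  show "Int_stable ?E" by (auto simp: Int_stable_def intro: bounded_Int)
  show "?E \<subseteq> Pow UNIV" by simp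
  have "sets borel = sigma_sets UNIV ?E"
  proof (rule antisym)
    have "A \<in> sigma_sets UNIV ?E" if "open A" for A :: "'e set"
    proof -
      have "(\<Union>n::nat. ball (0 :: 'e) (real n)) = UNIV"
        using reals_Archimedean2 by (auto simp: dist_norm)
      then have "A \<inter> (\<Union>n::nat. ball 0 (real n)) = A" by (simp only: Int_UNIV_right)
      then have eq: "(\<Union>n::nat. A \<inter> ball 0 (real n)) = A" by (simp only: Int_UN_distrib)
      have "A \<inter> ball 0 (real n) \<in> sigma_sets UNIV ?E" for n
        using that by (intro sigma_sets.Basic) (auto intro: bounded_Int)
      then have "(\<Union>n::nat. A \<inter> ball 0 (real n)) \<in> sigma_sets UNIV ?E" by (rule sigma_sets.Union)
      then show ?thesis by (simp only: eq)
    qed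
    then show "sets borel \<subseteq> sigma_sets UNIV ?E"
      unfolding borel_def by (subst sets_measure_of) (auto intro!: sigma_sets_mono)
    show "sigma_sets UNIV ?E \<subseteq> sets borel"
      by (rule sets.sigma_sets_subset [of _ borel, simplified]) auto
  qed
  then show "sets (distr M borel Z) = sigma_sets UNIV ?E" "sets (distr M' borel Z') = sigma_sets UNIV ?E"
    by simp_all
  let ?A = "\<lambda>n::nat. ball (0 :: 'e) (real n)"
  show "range ?A \<subseteq> ?E" by auto
  show "(\<Union>i. ?A i) = UNIV" using reals_Archimedean2 by (auto simp: dist_norm)
  show "emeasure (distr M borel Z) (?A i) \<noteq> \<infinity>" for i
    by (simp add: emeasure_distr)
  have le: "measure N {\<omega> \<in> space N. X \<omega> \<in> U} \<le> measure N' {\<omega> \<in> space N'. X' \<omega> \<in> U}"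
    if "prob_space N" "prob_space N'" "X \<in> borel_measurable N" "X' \<in> borel_measurable N'"
      "\<And>\<theta>. (\<integral>\<omega>. cis (\<theta> \<bullet> X \<omega>) \<partial>N) = (\<integral>\<omega>. cis (\<theta> \<bullet> X' \<omega>) \<partial>N')" "open U" "bounded U"
    for N :: "'x measure" and N' :: "'y measure" and X :: "'x \<Rightarrow> 'e" and X' U
    \<comment> \<open>With a single index and \<epsilon> = 0 the error term vanishes for any decay
      rate c, here 1.\<close>
    using comparison_open [of N N' "{()}" 1 0 "\<lambda>_. X" "\<lambda>_. X'" "\<lambda>_. U"] that by simp
  show "emeasure (distr M borel Z) U = emeasure (distr M' borel Z') U" if "U \<in> ?E" for U
  proof -
    have U: "open U" "bounded U" using that by auto
    have "measure M {\<omega> \<in> space M. Z \<omega> \<in> U} = measure M' {\<omega> \<in> space M'. Z' \<omega> \<in> U}"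
      using le [OF M M' Z Z' eq U] le [OF M' M Z' Z eq [symmetric] U] by simp
    then show ?thesis using U
      by (simp add: emeasure_distr M.emeasure_eq_measure M'.emeasure_eq_measure vimage_def Int_def conj_commute)
  qed
qed

text \<open>The exponent is split in half: one half pays for the tail, the other stays integrable
  and contributes the factor 2.\<close>

lemma gaussian_measure_tail:
  assumes s: "s > 0" and t: "t \<ge> 0"
  shows "measure (gaussian_measure s :: complex measure) {z. cmod z > t} \<le> 2 * exp (- (t\<^sup>2 / (4 * s\<^sup>2)))"
proof -
  interpret G: prob_space "gaussian_measure s :: complex measure" by (rule prob_space_gaussian_measure [OF s])
  have [measurable]: "{z :: complex. cmod z > t} \<in> sets borel" by measurable
  define c where "c = 1 / (4 * s\<^sup>2)"
  have c: "c > 0" using s by (simp add: c_def)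
  have "emeasure (gaussian_measure s :: complex measure) {z. cmod z > t} =
     (\<integral>\<^sup>+z. ennreal (exp (- (2 * c * (cmod z)\<^sup>2)) / (2 * pi * s\<^sup>2)) * indicator {z. cmod z > t} z \<partial>lborel)"
    unfolding gaussian_measure_def using s by (simp add: emeasure_density normal_density_prod power_mult_distrib c_def)
  also have "\<dots> \<le> (\<integral>\<^sup>+z. ennreal (exp (- (c * t\<^sup>2)) / (2 * pi * s\<^sup>2)) * ennreal (exp (- (c * (cmod z)\<^sup>2))) \<partial>lborel)"
  proof (intro nn_integral_mono)
    fix z :: complex
    have "exp (- (2 * c * (cmod z)\<^sup>2)) \<le> exp (- (c * t\<^sup>2)) * exp (- (c * (cmod z)\<^sup>2))" if "cmod z > t"
    proof -
      have "t\<^sup>2 \<le> (cmod z)\<^sup>2" using that t by (intro power_mono) auto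
      then show ?thesis using c by (simp flip: exp_add)
    qed
    then show "ennreal (exp (- (2 * c * (cmod z)\<^sup>2)) / (2 * pi * s\<^sup>2)) * indicator {z. cmod z > t} z \<le>
      ennreal (exp (- (c * t\<^sup>2)) / (2 * pi * s\<^sup>2)) * ennreal (exp (- (c * (cmod z)\<^sup>2)))"
      using s by (auto simp: indicator_def divide_right_mono simp flip: ennreal_mult' intro!: ennreal_leI)
  qed
  also have "\<dots> = ennreal (exp (- (c * t\<^sup>2)) / (2 * pi * s\<^sup>2)) * ennreal (sqrt (pi / c) ^ 2)"
    by (subst nn_integral_cmult, measurable) (simp add: nn_integral_exp_norm [OF c])
  also have "\<dots> = ennreal (2 * exp (- (t\<^sup>2 / (4 * s\<^sup>2))))"
    using s by (simp add: c_def flip: ennreal_mult')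
  finally show ?thesis by (simp add: G.emeasure_eq_measure)
qed

context gaussian_family
begin

text \<open>A linear form in the coefficients is again a complex Gaussian, with variance the sum of
  the |c k|^2. Only an upper bound V on the variance is asked for, which is what is known for
  derivatives.\<close>

lemma linear_tail:
  assumes V: "(\<Sum>k\<in>J. (cmod (c k))\<^sup>2) \<le> V" and V0: "V > 0" and t: "t \<ge> 0"
  shows "prob {\<omega> \<in> space M. cmod (\<Sum>k\<in>J. c k * \<zeta> k \<omega>) > t} \<le> 2 * exp (- (t\<^sup>2 / (2 * V)))"
proof (cases "(\<Sum>k\<in>J. (cmod (c k))\<^sup>2) = 0")
  case True
  \<comment> \<open>Zero variance is treated apart, since the Gaussian measures have positive
    scale.\<close>
  then have "c k = 0" if "k \<in> J" for k
    using that finite_J by (auto simp: sum_nonneg_eq_0_iff)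
  then show ?thesis using t by simp
next
  case False
  define W where "W = (\<Sum>k\<in>J. (cmod (c k))\<^sup>2)"
  have W: "W > 0" using False by (simp add: W_def less_le sum_nonneg)
  define Q where "Q \<omega> = (\<Sum>k\<in>J. c k * \<zeta> k \<omega>)" for \<omega>
  have [measurable]: "Q \<in> borel_measurable M" unfolding Q_def by measurable
  \<comment> \<open>Each of the two real coordinates carries half of the variance W.\<close>
  have "distr M borel Q = distr (gaussian_measure (sqrt (W / 2))) borel (\<lambda>z :: complex. z)"
  proof (rule distr_eqI_char)
    show "prob_space M" by (rule prob_space_axioms)
    show "prob_space (gaussian_measure (sqrt (W / 2)) :: complex measure)" by (rule prob_space_gaussian_measure) (simp add: W)
    fix \<theta> :: complex
    have "(\<integral>\<omega>. cis (\<theta> \<bullet> Q \<omega>) \<partial>M) = (\<integral>\<omega>. cis (\<Sum>k\<in>J. (\<theta> * cnj (c k)) \<bullet> \<zeta> k \<omega>) \<partial>M)"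
      by (simp add: Q_def inner_sum_right inner_mult_right_complex)
    also have "\<dots> = exp (- (cmod \<theta>)\<^sup>2 * W / 4)"
      unfolding char_linear by (simp add: norm_mult power_mult_distrib W_def sum_distrib_left sum_negf)
    also have "\<dots> = (\<integral>z. cis (z \<bullet> \<theta>) \<partial>gaussian_measure (sqrt (W / 2)))"
      by (subst gaussian_measure_char) (use W in \<open>simp_all add: power_mult_distrib mult_ac\<close>)
    finally show "(\<integral>\<omega>. cis (\<theta> \<bullet> Q \<omega>) \<partial>M) = (\<integral>z. cis (\<theta> \<bullet> z) \<partial>gaussian_measure (sqrt (W / 2)))"
      by (simp add: inner_commute)
  qed simp_all
  then have Q: "distr M borel Q = gaussian_measure (sqrt (W / 2))" by (simp add: distr_id2)
  have "prob {\<omega> \<in> space M. cmod (Q \<omega>) > t} = measure (distr M borel Q) {z. cmod z > t}"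
    by (subst measure_distr) (auto simp: vimage_def Int_def conj_commute)
  also have "\<dots> \<le> 2 * exp (- (t\<^sup>2 / (4 * (sqrt (W / 2))\<^sup>2)))"
    unfolding Q by (rule gaussian_measure_tail) (use W t in auto)
  also have "\<dots> \<le> 2 * exp (- (t\<^sup>2 / (2 * V)))"
    using W V t V0 by (simp add: W_def [symmetric] frac_le)
  finally show ?thesis by (simp add: Q_def)
qed

end

text \<open>The factor exp (- m) is kept so that the difference of two Gaussian characteristic
  functions still decays like a Gaussian.\<close>

lemma exp_neg_diff_le:
  fixes a b m :: real
  assumes "m \<le> a" "m \<le> b"
  shows "\<bar>exp (- a) - exp (- b)\<bar> \<le> \<bar>a - b\<bar> * exp (- m)"
proof -
  have *: "exp (- a) - exp (- b) \<le> (b - a) * exp (- m)" if "a \<le> b" "m \<le> a" for a b :: real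
  proof -
    have "1 - (b - a) \<le> exp (- (b - a))" using exp_ge_add_one_self [of "- (b - a)"] by linarith
    then have "exp (- a) * (1 - exp (- (b - a))) \<le> exp (- a) * (b - a)" by (intro mult_left_mono) auto
    also have "\<dots> \<le> exp (- m) * (b - a)" using that by (intro mult_right_mono) auto
    finally show ?thesis by (simp add: algebra_simps flip: exp_add)
  qed
  show ?thesis
    using *[of a b] *[of b a] assms by (cases "a \<le> b") (auto simp: abs_if)
qed

text \<open>The factor per point in \<open>comparison_open\<close> for decay rate 1 / 16 and the
  four real dimensions of a pair (P, P').\<close>

definition tuple_const :: real where "tuple_const = (sqrt (16 * pi) / (2 * pi)) ^ 4"

locale gaussian_trig = gaussian_family M \<zeta> "{- int n..int n}"
  for M :: "'a measure" and \<zeta> :: "int \<Rightarrow> 'a \<Rightarrow> complex" and n :: nat +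
  assumes n: "n > 0"
begin

definition Y :: "nat \<Rightarrow> real \<Rightarrow> 'a \<Rightarrow> complex" where
  "Y p x \<omega> = scaled_deriv n p (\<lambda>k. \<zeta> k \<omega>) x"

lemma Y_measurable [measurable]: "Y p x \<in> borel_measurable M"
  unfolding Y_def scaled_deriv_def by measurable

text \<open>The index (i, p) stands for the p-th derivative at the i-th point, so that values and
  derivatives enter one Hermitian form to which \<open>gram_perturbation\<close> applies.\<close>

lemma pair_char:
  fixes \<theta> :: "'i \<Rightarrow> complex \<times> complex"
  shows "(\<integral>\<omega>. cis (\<Sum>i\<in>I. \<theta> i \<bullet> (Y 0 (x i) \<omega>, Y 1 (x i) \<omega>)) \<partial>M) =
    exp (- (\<Sum>k = - int n..int n. (cmod (\<Sum>(i, p)\<in>I \<times> {0, 1}. (if p = 0 then fst (\<theta> i) else snd (\<theta> i)) * cnj (trig_coeff n p (x i) k)))\<^sup>2) / 4)"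
proof -
  have "(\<Sum>i\<in>I. \<theta> i \<bullet> (Y 0 (x i) \<omega>, Y 1 (x i) \<omega>)) =
     (\<Sum>k = - int n..int n. (\<Sum>(i, p)\<in>I \<times> {0, 1}. (if p = 0 then fst (\<theta> i) else snd (\<theta> i)) * cnj (trig_coeff n p (x i) k)) \<bullet> \<zeta> k \<omega>)" for \<omega>
  proof -
    have "(\<Sum>i\<in>I. \<theta> i \<bullet> (Y 0 (x i) \<omega>, Y 1 (x i) \<omega>)) =
      (\<Sum>i\<in>I. \<Sum>k = - int n..int n. (fst (\<theta> i) * cnj (trig_coeff n 0 (x i) k) + snd (\<theta> i) * cnj (trig_coeff n 1 (x i) k)) \<bullet> \<zeta> k \<omega>)"
      by (simp add: Y_def scaled_deriv_def inner_prod_def inner_sum_right inner_mult_right_complex inner_add_left sum.distrib)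
    also have "\<dots> = (\<Sum>k = - int n..int n. (\<Sum>i\<in>I. fst (\<theta> i) * cnj (trig_coeff n 0 (x i) k) + snd (\<theta> i) * cnj (trig_coeff n 1 (x i) k)) \<bullet> \<zeta> k \<omega>)"
      by (subst sum.swap) (simp add: inner_sum_left)
    finally show ?thesis by (simp flip: sum.cartesian_product)
  qed
  then show ?thesis by (simp only: char_linear)
qed

lemma single_char:
  "(\<integral>\<omega>. cis (\<theta> \<bullet> (Y 0 x \<omega>, Y 1 x \<omega>)) \<partial>M) = exp (- (norm \<theta>)\<^sup>2 / 4)"
proof -
  let ?\<alpha> = "\<lambda>(i, p). if p = (0::nat) then fst \<theta> else snd \<theta>"
  let ?a = "\<lambda>(i, p) k. trig_coeff n p x k"
  \<comment> \<open>With \<epsilon> = 0 the perturbation estimate is an identity, because the Gram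
    matrix at a single point is exactly the identity.\<close>
  have "cmod (of_real (\<Sum>k = - int n..int n. (cmod (\<Sum>t\<in>{()} \<times> {0, 1}. ?\<alpha> t * cnj (?a t k)))\<^sup>2) -
     (\<Sum>t\<in>{()} \<times> {0, 1}. \<Sum>u\<in>{()} \<times> {0, 1}. ?\<alpha> t * cnj (?\<alpha> u) * (if snd t = snd u then 1 else 0)))
    \<le> (0 :: real) * real (card ({()} \<times> {0, 1 :: nat})) * (\<Sum>t\<in>{()} \<times> {0, 1}. (cmod (?\<alpha> t))\<^sup>2)"
    by (rule gram_perturbation) (auto simp: trig_coeff_gram_same [OF n])
  then have "of_real (\<Sum>k = - int n..int n. (cmod (\<Sum>t\<in>{()} \<times> {0, 1}. ?\<alpha> t * cnj (?a t k)))\<^sup>2) =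
     (fst \<theta> * cnj (fst \<theta>) + snd \<theta> * cnj (snd \<theta>))"
    by (simp flip: sum.cartesian_product)
  also have "\<dots> = of_real ((norm \<theta>)\<^sup>2)"
    by (simp add: norm_prod_def complex_norm_square [symmetric])
  finally have "(\<Sum>k = - int n..int n. (cmod (\<Sum>t\<in>{()} \<times> {0, 1}. ?\<alpha> t * cnj (?a t k)))\<^sup>2) = (norm \<theta>)\<^sup>2"
    by (simp only: of_real_eq_iff)
  then show ?thesis
    using pair_char [where I = "{()}" and \<theta> = "\<lambda>_. \<theta>" and x = "\<lambda>_. x"] by (simp add: case_prod_unfold)
qed

lemma single_law:
  "distr M borel (\<lambda>\<omega>. (Y 0 x \<omega>, Y 1 x \<omega>)) = gaussian_measure (1 / sqrt 2)"
proof -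
  have "distr M borel (\<lambda>\<omega>. (Y 0 x \<omega>, Y 1 x \<omega>)) = distr (gaussian_measure (1 / sqrt 2)) borel (\<lambda>z :: complex \<times> complex. z)"
  proof (rule distr_eqI_char)
    show "prob_space M" by (rule prob_space_axioms)
    show "prob_space (gaussian_measure (1 / sqrt 2) :: (complex \<times> complex) measure)" by (rule prob_space_gaussian_measure) simp
    show "(\<integral>\<omega>. cis (\<theta> \<bullet> (Y 0 x \<omega>, Y 1 x \<omega>)) \<partial>M) = (\<integral>z. cis (\<theta> \<bullet> z) \<partial>gaussian_measure (1 / sqrt 2))" for \<theta>
      unfolding single_char unfolding inner_commute [of \<theta>] by (subst gaussian_measure_char) (simp_all add: power_divide)
  qed simp_all
  then show ?thesis by (simp add: distr_id2)
qed

lemma single_prob: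
  assumes [measurable]: "U \<in> sets borel"
  shows "prob {\<omega> \<in> space M. (Y 0 x \<omega>, Y 1 x \<omega>) \<in> U} = measure (gaussian_measure (1 / sqrt 2)) U"
  unfolding single_law [symmetric, of x] by (subst measure_distr) (auto simp: vimage_def Int_def conj_commute)

text \<open>The Gram matrix of the 2 |I| coefficient vectors is the identity up to entries of size
  18 / (n \<kappa>). So the form is S up to \<eta> S, and the characteristic functions differ by at
  most 4 \<eta> exp (- S / 16). The resulting error carries the volume of U to the power |I|, as
  does the main term for small U.\<close>

theorem separated_tuple:
  fixes x :: "'i \<Rightarrow> real"
  assumes I: "finite I" and \<kappa>: "\<kappa> > 0"
    and sep: "\<And>i l. i \<in> I \<Longrightarrow> l \<in> I \<Longrightarrow> i \<noteq> l \<Longrightarrow> cmod (1 - cis (x l - x i)) \<ge> \<kappa>"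
    and \<eta>: "36 * real (card I) / (real n * \<kappa>) \<le> \<eta>" "\<eta> \<le> 1 / 2"
    and U: "open U" "bounded U"
  shows "\<bar>prob {\<omega> \<in> space M. \<forall>i\<in>I. (Y 0 (x i) \<omega>, Y 1 (x i) \<omega>) \<in> U} - measure (gaussian_measure (1 / sqrt 2)) U ^ card I\<bar>
    \<le> 4 * \<eta> * (tuple_const * measure lborel U) ^ card I"
proof -
  interpret G: prob_space "gaussian_measure (1 / sqrt 2) :: (complex \<times> complex) measure" by (rule prob_space_gaussian_measure) simp
  interpret GP: finite_product_prob_space "\<lambda>_. gaussian_measure (1 / sqrt 2) :: (complex \<times> complex) measure" I
    by standard (rule I)
  let ?P = "\<Pi>\<^sub>M i\<in>I. (gaussian_measure (1 / sqrt 2) :: (complex \<times> complex) measure)"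
  let ?Z = "\<lambda>i \<omega>. (Y 0 (x i) \<omega>, Y 1 (x i) \<omega>)"
  have [measurable]: "U \<in> sets borel" using U by auto
  have \<eta>0: "\<eta> \<ge> 0" using \<eta>(1) \<kappa> n by (smt (verit) divide_nonneg_nonneg mult_nonneg_nonneg of_nat_0_le_iff)
  have ref: "(\<integral>g. cis (\<Sum>i\<in>I. \<theta> i \<bullet> g i) \<partial>?P) = of_real (exp (- (\<Sum>i\<in>I. (norm (\<theta> i))\<^sup>2) / 4))" for \<theta>
  proof -
    have prod: "(\<Prod>k\<in>I. cis (f k)) = cis (\<Sum>k\<in>I. f k)" for f :: "'i \<Rightarrow> real"
      using I by (induction I rule: finite_induct) (auto simp: cis_mult)
    have "(\<integral>g. cis (\<Sum>i\<in>I. \<theta> i \<bullet> g i) \<partial>?P) = (\<integral>g. (\<Prod>i\<in>I. cis (g i \<bullet> \<theta> i)) \<partial>?P)"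
      by (simp add: prod inner_commute)
    also have "\<dots> = (\<Prod>i\<in>I. \<integral>z. cis (z \<bullet> \<theta> i) \<partial>gaussian_measure (1 / sqrt 2))"
      by (rule GP.product_integral_prod [OF I]) (auto intro!: G.integrable_const_bound [of _ 1])
    also have "\<dots> = (\<Prod>i\<in>I. of_real (exp (- (norm (\<theta> i))\<^sup>2 / 4)))"
      by (subst gaussian_measure_char) (simp_all add: power_divide)
    finally show ?thesis by (simp add: exp_sum I sum_divide_distrib flip: sum_negf)
  qed
  have diff: "cmod ((\<integral>\<omega>. cis (\<Sum>i\<in>I. \<theta> i \<bullet> ?Z i \<omega>) \<partial>M) - (\<integral>g. cis (\<Sum>i\<in>I. \<theta> i \<bullet> g i) \<partial>?P))
       \<le> 4 * \<eta> * (\<Prod>i\<in>I. exp (- (1 / 16 * (norm (\<theta> i))\<^sup>2)))" for \<theta>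
  proof -
    define S where "S = (\<Sum>i\<in>I. (norm (\<theta> i))\<^sup>2)"
    have S: "S \<ge> 0" by (simp add: S_def sum_nonneg)
    let ?T = "I \<times> {0, 1 :: nat}"
    let ?\<alpha> = "\<lambda>(i, p). if p = (0::nat) then fst (\<theta> i) else snd (\<theta> i)"
    let ?a = "\<lambda>(i, p) k. trig_coeff n p (x i) k"
    define q where "q = (\<Sum>k = - int n..int n. (cmod (\<Sum>t\<in>?T. ?\<alpha> t * cnj (?a t k)))\<^sup>2)"
    have SS: "S = (\<Sum>t\<in>?T. (cmod (?\<alpha> t))\<^sup>2)"
    proof -
      have "(\<Sum>t\<in>?T. (cmod (?\<alpha> t))\<^sup>2) = (\<Sum>i\<in>I. \<Sum>p\<in>{0, 1}. (cmod (?\<alpha> (i, p)))\<^sup>2)"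
        by (subst sum.cartesian_product) (simp only: case_prod_unfold prod.collapse)
      then show ?thesis by (simp add: S_def norm_prod_def)
    qed
    have gr: "cmod ((\<Sum>k = - int n..int n. cnj (?a t k) * ?a u k) - (if t = u then 1 else 0)) \<le> 18 / (real n * \<kappa>)"
      if tu: "t \<in> ?T" "u \<in> ?T" for t u
    proof -
      obtain i p where t: "t = (i, p)" by (cases t)
      obtain l r where u: "u = (l, r)" by (cases u)
      show ?thesis
      proof (cases "i = l")
        case True
        have "(\<Sum>k = - int n..int n. cnj (?a t k) * ?a u k) = (if t = u then 1 else 0)"
          unfolding t u using True tu t u trig_coeff_gram_same [OF n, of p r "x i"] by auto
        then show ?thesis using n \<kappa> by simp
      next
        case False
        have s: "cmod (1 - cis (x l - x i)) \<ge> \<kappa>" using sep [of i l] False tu t u by auto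
        then have "cis (x l - x i) \<noteq> 1" using \<kappa> by auto
        then have "cmod (\<Sum>k = - int n..int n. cnj (trig_coeff n p (x i) k) * trig_coeff n r (x l) k) \<le> 18 / (real n * cmod (1 - cis (x l - x i)))"
          using tu t u by (intro trig_coeff_gram_bound n) auto
        also have "\<dots> \<le> 18 / (real n * \<kappa>)"
          using s n \<kappa> by (intro divide_left_mono mult_left_mono mult_pos_pos) auto
        finally show ?thesis unfolding t u using False by simp
      qed
    qed
    have "cmod (of_real q - (\<Sum>t\<in>?T. \<Sum>u\<in>?T. ?\<alpha> t * cnj (?\<alpha> u) * (if t = u then 1 else 0)))
      \<le> 18 / (real n * \<kappa>) * card ?T * (\<Sum>t\<in>?T. (cmod (?\<alpha> t))\<^sup>2)"
      unfolding q_def by (rule gram_perturbation) (use I gr in auto)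
    also have "(\<Sum>t\<in>?T. \<Sum>u\<in>?T. ?\<alpha> t * cnj (?\<alpha> u) * (if t = u then 1 else 0)) = of_real S"
      unfolding SS using I by (simp add: if_distrib [of "(*) _"] sum.delta complex_norm_square [symmetric] cong: if_cong)
    \<comment> \<open>The index set has 2 |I| elements, whence 36 = 2 * 18 in the condition on
      \<eta>.\<close>
    also have "18 / (real n * \<kappa>) * card ?T * (\<Sum>t\<in>?T. (cmod (?\<alpha> t))\<^sup>2) \<le> \<eta> * S"
      unfolding SS [symmetric] using \<eta>(1) S by (intro mult_right_mono) (auto simp: card_cartesian_product)
    finally have qS: "\<bar>q - S\<bar> \<le> \<eta> * S" by (simp flip: of_real_diff)
    moreover have "\<eta> * S \<le> 1 / 2 * S" using \<eta>(2) S by (rule mult_right_mono)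
    ultimately have qS2: "q \<ge> S / 2" by linarith
    have "cmod ((\<integral>\<omega>. cis (\<Sum>i\<in>I. \<theta> i \<bullet> ?Z i \<omega>) \<partial>M) - (\<integral>g. cis (\<Sum>i\<in>I. \<theta> i \<bullet> g i) \<partial>?P)) =
      \<bar>exp (- (q / 4)) - exp (- (S / 4))\<bar>"
    proof -
      have q: "(\<Sum>k = - int n..int n. (cmod (\<Sum>(i, p)\<in>?T. (if p = 0 then fst (\<theta> i) else snd (\<theta> i)) * cnj (trig_coeff n p (x i) k)))\<^sup>2) = q"
        unfolding q_def by (intro sum.cong refl arg_cong [of _ _ cmod] arg_cong [of _ _ "\<lambda>z. z ^ 2"]) auto
      show ?thesis unfolding pair_char q ref S_def [symmetric] by (simp flip: of_real_diff)
    qed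
    also have "\<dots> \<le> \<bar>q / 4 - S / 4\<bar> * exp (- (S / 8))"
      using qS2 S by (intro exp_neg_diff_le) auto
    also have "\<dots> \<le> (\<eta> * S / 4) * exp (- (S / 8))"
    proof (rule mult_right_mono)
      show "\<bar>q / 4 - S / 4\<bar> \<le> \<eta> * S / 4" using qS by linarith
    qed simp
    \<comment> \<open>Half of the decay exp (- S / 8) absorbs the factor S, as x exp (- x) \<le> 1;
      the other half is the rate 1 / 16.\<close>
    also have "\<dots> = 4 * \<eta> * ((S / 16) * exp (- (S / 16)) * exp (- (S / 16)))"
      by (simp flip: exp_add)
    also have "\<dots> \<le> 4 * \<eta> * (1 * exp (- (S / 16)))"
    proof -
      have "S / 16 \<le> exp (S / 16)" using exp_ge_add_one_self [of "S / 16"] by linarith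
      then have "(S / 16) * exp (- (S / 16)) \<le> 1" by (simp add: exp_minus field_simps)
      then show ?thesis using \<eta>0 by (intro mult_left_mono mult_right_mono) auto
    qed
    also have "exp (- (S / 16)) = (\<Prod>i\<in>I. exp (- (1 / 16 * (norm (\<theta> i))\<^sup>2)))"
      by (simp add: S_def exp_sum I sum_divide_distrib flip: sum_negf)
    finally show ?thesis by simp
  qed
  have "measure ?P {g \<in> space ?P. \<forall>i\<in>I. g i \<in> U} = measure ?P (\<Pi>\<^sub>E i\<in>I. U)"
    by (rule arg_cong [of _ _ "measure ?P"]) (auto simp: space_PiM PiE_def Pi_def)
  also have "\<dots> = measure (gaussian_measure (1 / sqrt 2)) U ^ card I"
    by (subst GP.prob_times) auto
  finally have ref_prob: "measure ?P {g \<in> space ?P. \<forall>i\<in>I. g i \<in> U} = measure (gaussian_measure (1 / sqrt 2)) U ^ card I" .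
  have P: "prob_space ?P" by (rule GP.prob_space_axioms)
  have const: "4 * \<eta> * ((sqrt (pi / (1 / 16)) / (2 * pi)) ^ DIM(complex \<times> complex)) ^ card I * (\<Prod>i\<in>I. measure lborel U)
     = 4 * \<eta> * (tuple_const * measure lborel U) ^ card I"
    by (simp add: tuple_const_def power_mult_distrib mult.commute [of pi])
  have mZ: "?Z i \<in> borel_measurable M" for i by measurable
  have mg: "(\<lambda>g. g i) \<in> borel_measurable ?P" if "i \<in> I" for i using that by measurable
  have diff': "cmod ((\<integral>g. cis (\<Sum>i\<in>I. \<theta> i \<bullet> g i) \<partial>?P) - (\<integral>\<omega>. cis (\<Sum>i\<in>I. \<theta> i \<bullet> ?Z i \<omega>) \<partial>M))
       \<le> 4 * \<eta> * (\<Prod>i\<in>I. exp (- (1 / 16 * (norm (\<theta> i))\<^sup>2)))" for \<theta>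
    using diff [of \<theta>] by (simp add: norm_minus_commute)
  \<comment> \<open>The comparison is one-sided, so it is applied in both directions.\<close>
  show ?thesis
    using comparison_open [OF prob_space_axioms P I _ _ mZ mg diff, of "\<lambda>_. U"]
      comparison_open [OF P prob_space_axioms I _ _ mg mZ diff', of "\<lambda>_. U"] \<eta>0 U
    unfolding ref_prob const by (auto simp: abs_le_iff)
qed

text \<open>Two points may be close here, so only an upper bound of the right order is sought. The
  2x2 block of the close pair has least eigenvalue 1 - |D| \<ge> \<open>lm\<close>, all other
  correlations take away at most half of that, and so the characteristic function decays at rate
  \<open>lm / 8\<close>. This bounds the density near 0.\<close>

theorem close_pair_tuple:
  fixes x :: "'i \<Rightarrow> real"
  assumes I: "finite I" and \<kappa>: "\<kappa> > 0" and p: "p \<in> I" "q \<in> I" "p \<noteq> q"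
    and sep: "\<And>i l. i \<in> I \<Longrightarrow> l \<in> I \<Longrightarrow> i \<noteq> l \<Longrightarrow> {i, l} \<noteq> {p, q} \<Longrightarrow> cmod (1 - cis (x l - x i)) \<ge> \<kappa>"
    and lam: "0 < lm" "\<bar>dirichlet n (x p - x q)\<bar> \<le> 1 - lm" "18 / (real n * \<kappa>) * card I \<le> lm / 2"
    and R: "R > 0"
  shows "prob {\<omega> \<in> space M. \<forall>i\<in>I. cmod (Y 0 (x i) \<omega>) \<le> R / real n} \<le> (exp (1 / 2) * (4 * R\<^sup>2 / (lm * (real n)\<^sup>2))) ^ card I"
proof -
  \<comment> \<open>The bump exp (- (r |z|)^2 / 2) then has width R / n.\<close>
  define r where "r = real n / R"
  have r: "r > 0" using n R by (simp add: r_def)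
  interpret G: prob_space "gaussian_measure r :: complex measure" using r by (rule prob_space_gaussian_measure)
  interpret GP: product_prob_space "\<lambda>_. gaussian_measure r :: complex measure" I ..
  let ?P = "\<Pi>\<^sub>M i\<in>I. (gaussian_measure r :: complex measure)"
  define D where "D = dirichlet n (x p - x q)"
  have Dsym: "dirichlet n (x q - x p) = D"
  proof -
    have "cos (real_of_int k * (x q - x p)) = cos (real_of_int k * (x p - x q))" for k
      by (metis cos_minus minus_diff_eq mult_minus_right)
    then show ?thesis by (simp add: D_def dirichlet_def)
  qed
  define F where "F \<theta> = (\<integral>\<omega>. cis (\<Sum>i\<in>I. \<theta> i \<bullet> Y 0 (x i) \<omega>) \<partial>M)" for \<theta>
  have F: "cmod (F \<theta>) \<le> (\<Prod>i\<in>I. exp (- (lm / 8 * (norm (\<theta> i))\<^sup>2)))" for \<theta>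
  proof -
    define S where "S = (\<Sum>i\<in>I. (norm (\<theta> i))\<^sup>2)"
    define Q where "Q = (\<Sum>k = - int n..int n. (cmod (\<Sum>i\<in>I. \<theta> i * cnj (trig_coeff n 0 (x i) k)))\<^sup>2)"
    have S: "S \<ge> 0" by (simp add: S_def sum_nonneg)
    have "(\<Sum>i\<in>I. \<theta> i \<bullet> Y 0 (x i) \<omega>) = (\<Sum>k = - int n..int n. (\<Sum>i\<in>I. \<theta> i * cnj (trig_coeff n 0 (x i) k)) \<bullet> \<zeta> k \<omega>)" for \<omega>
      unfolding Y_def scaled_deriv_def inner_sum_left inner_sum_right inner_mult_right_complex by (rule sum.swap)
    then have FQ: "F \<theta> = exp (- Q / 4)"
      unfolding F_def by (simp only: char_linear Q_def)
    \<comment> \<open>The unperturbed Gram matrix: the identity except for the correlation D of the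
      close pair.\<close>
    define g where "g i l = (if i = l then 1 else if {i, l} = {p, q} then D else (0::real))" for i l
    have gr: "cmod ((\<Sum>k = - int n..int n. cnj (trig_coeff n 0 (x i) k) * trig_coeff n 0 (x l) k) - of_real (g i l)) \<le> 18 / (real n * \<kappa>)"
      if il: "i \<in> I" "l \<in> I" for i l
    proof (cases "i = l \<or> {i, l} = {p, q}")
      case True
      then have "(\<Sum>k = - int n..int n. cnj (trig_coeff n 0 (x i) k) * trig_coeff n 0 (x l) k) = of_real (g i l)"
        using trig_coeff_gram_same [OF n, of 0 0 "x i"] p(3) Dsym
        by (auto simp: g_def trig_coeff_gram_dirichlet D_def doubleton_eq_iff)
      then show ?thesis using n \<kappa> by simp
    next
      case False
      then have s: "cmod (1 - cis (x l - x i)) \<ge> \<kappa>" using sep [of i l] il by auto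
      then have "cis (x l - x i) \<noteq> 1" using \<kappa> by auto
      then have "cmod (\<Sum>k = - int n..int n. cnj (trig_coeff n 0 (x i) k) * trig_coeff n 0 (x l) k) \<le> 18 / (real n * cmod (1 - cis (x l - x i)))"
        by (intro trig_coeff_gram_bound n) auto
      also have "\<dots> \<le> 18 / (real n * \<kappa>)"
        using s n \<kappa> by (intro divide_left_mono mult_left_mono mult_pos_pos) auto
      finally show ?thesis using False by (simp add: g_def)
    qed
    have "cmod (of_real Q - (\<Sum>i\<in>I. \<Sum>l\<in>I. \<theta> i * cnj (\<theta> l) * of_real (g i l))) \<le> 18 / (real n * \<kappa>) * card I * S"
      unfolding Q_def S_def by (rule gram_perturbation) (use I gr in auto)
    also have "\<dots> \<le> lm / 2 * S" using lam S by (intro mult_right_mono)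
    also have "(\<Sum>i\<in>I. \<Sum>l\<in>I. \<theta> i * cnj (\<theta> l) * of_real (g i l)) =
        of_real S + of_real D * (\<theta> p * cnj (\<theta> q) + \<theta> q * cnj (\<theta> p))"
    proof -
      have "\<theta> i * cnj (\<theta> l) * of_real (g i l) = (if l = i then \<theta> i * cnj (\<theta> i) else 0) +
         ((if l = q then if i = p then \<theta> p * cnj (\<theta> q) * of_real D else 0 else 0) +
          (if l = p then if i = q then \<theta> q * cnj (\<theta> p) * of_real D else 0 else 0))" for i l
        using p(3) by (auto simp: g_def doubleton_eq_iff)
      then show ?thesis
        using I p by (simp add: sum.distrib S_def complex_norm_square [symmetric] algebra_simps)
    qed
    finally have "cmod (of_real (Q - S) - of_real D * (\<theta> p * cnj (\<theta> q) + \<theta> q * cnj (\<theta> p))) \<le> lm / 2 * S"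
      by (simp add: algebra_simps)
    \<comment> \<open>The cross term takes away at most the share |D| \<le> 1 - \<open>lm\<close> of
      S, by the arithmetic-geometric mean inequality.\<close>
    moreover have "cmod (of_real D * (\<theta> p * cnj (\<theta> q) + \<theta> q * cnj (\<theta> p))) \<le> (1 - lm) * S"
    proof -
      have "cmod (\<theta> p * cnj (\<theta> q) + \<theta> q * cnj (\<theta> p)) \<le> 2 * cmod (\<theta> p) * cmod (\<theta> q)"
        by (rule order_trans [OF norm_triangle_ineq]) (simp add: norm_mult)
      also have "\<dots> \<le> (cmod (\<theta> p))\<^sup>2 + (cmod (\<theta> q))\<^sup>2" by (rule sum_squares_bound)
      also have "\<dots> = (\<Sum>i\<in>{p, q}. (norm (\<theta> i))\<^sup>2)" using p by simp
      also have "\<dots> \<le> S" unfolding S_def using p I by (intro sum_mono2) auto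
      finally show ?thesis unfolding norm_mult using lam S by (intro mult_mono) (auto simp: D_def)
    qed
    ultimately have "\<bar>Q - S\<bar> \<le> lm / 2 * S + (1 - lm) * S"
      by (smt (verit) norm_of_real norm_triangle_sub)
    moreover have "lm / 2 * S + (1 - lm) * S = S - lm / 2 * S" by (simp add: algebra_simps)
    ultimately have "Q \<ge> lm / 2 * S" by linarith
    then have "exp (- Q / 4) \<le> exp (- (lm / 8 * S))" by (simp add: mult.commute)
    also have "\<dots> = (\<Prod>i\<in>I. exp (- (lm / 8 * (norm (\<theta> i))\<^sup>2)))"
      by (simp add: S_def exp_sum I sum_distrib_left sum_divide_distrib flip: sum_negf)
    finally show ?thesis by (simp add: FQ)
  qed
  have Fint: "integrable ?P F"
  proof -
    have "cmod (F \<theta>) \<le> 1" for \<theta>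
      by (rule order_trans [OF F]) (use lam in \<open>auto intro!: prod_le_1\<close>)
    then show ?thesis unfolding F_def by (intro GP.integrable_const_bound [of _ 1]) auto
  qed
  define b where "b \<omega> = (\<Prod>i\<in>I. exp (- (r * norm (Y 0 (x i) \<omega> - 0))\<^sup>2 / 2))" for \<omega>
  have "complex_of_real (expectation b) = (\<integral>\<theta>. F \<theta> \<partial>?P)"
    using bump_char [OF prob_space_axioms I r, of "\<lambda>i. Y 0 (x i)" "\<lambda>_. 0"]
    unfolding F_def b_def integral_complex_of_real [symmetric] by simp
  then have "ennreal \<bar>expectation b\<bar> = ennreal (cmod (\<integral>\<theta>. F \<theta> \<partial>?P))"
    using norm_of_real [where 'a = complex, of "expectation b"] by simp
  also have "\<dots> \<le> (\<integral>\<^sup>+\<theta>. ennreal (cmod (F \<theta>)) \<partial>?P)"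
    by (intro integral_norm_bound_ennreal Fint)
  also have "\<dots> \<le> (\<integral>\<^sup>+\<theta>. ennreal (\<Prod>i\<in>I. exp (- (lm / 8 * (norm (\<theta> i))\<^sup>2))) \<partial>?P)"
    by (intro nn_integral_mono ennreal_leI F)
  also have "\<dots> \<le> ennreal (((sqrt (pi / (lm / 8)) / (sqrt (2 * pi) * r)) ^ DIM(complex)) ^ card I)"
    by (rule nn_integral_PiM_gaussian_measure_exp) (use I lam r in auto)
  also have "(sqrt (pi / (lm / 8)) / (sqrt (2 * pi) * r)) ^ DIM(complex) = 4 * R\<^sup>2 / (lm * (real n)\<^sup>2)"
    using lam r R n by (simp add: power_divide power_mult_distrib r_def field_simps)
  finally have b1: "expectation b \<le> (4 * R\<^sup>2 / (lm * (real n)\<^sup>2)) ^ card I"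
    using lam by (subst (asm) ennreal_le_iff) (auto intro!: divide_nonneg_nonneg)
  have bint: "integrable M b"
    unfolding b_def by (intro integrable_const_bound [of _ 1]) (auto intro!: prod_le_1 simp: abs_prod)
  \<comment> \<open>Markov's inequality for b: on the event every bump is at least exp (- 1 /
    2).\<close>
  have "exp (- 1 / 2 :: real) ^ card I * prob {\<omega> \<in> space M. \<forall>i\<in>I. cmod (Y 0 (x i) \<omega>) \<le> R / real n} =
      expectation (\<lambda>\<omega>. exp (- 1 / 2 :: real) ^ card I * indicator {\<omega> \<in> space M. \<forall>i\<in>I. cmod (Y 0 (x i) \<omega>) \<le> R / real n} \<omega>)"
    using I by (simp add: Int_def conj_ac cong: conj_cong)
  also have "\<dots> \<le> expectation b"
  proof (intro integral_mono bint)
    have "{\<omega> \<in> space M. \<forall>i\<in>I. cmod (Y 0 (x i) \<omega>) \<le> R / real n} \<in> sets M" using I by measurable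
    then show "integrable M (\<lambda>\<omega>. exp (- 1 / 2 :: real) ^ card I * indicator {\<omega> \<in> space M. \<forall>i\<in>I. cmod (Y 0 (x i) \<omega>) \<le> R / real n} \<omega>)"
      by (auto intro!: integrable_mult_right integrable_real_indicator simp: emeasure_eq_measure)
    fix \<omega>
    show "exp (- 1 / 2 :: real) ^ card I * indicator {\<omega> \<in> space M. \<forall>i\<in>I. cmod (Y 0 (x i) \<omega>) \<le> R / real n} \<omega> \<le> b \<omega>"
    proof (cases "\<forall>i\<in>I. cmod (Y 0 (x i) \<omega>) \<le> R / real n")
      case True
      have "exp (- 1 / 2 :: real) \<le> exp (- (r * norm (Y 0 (x i) \<omega> - 0))\<^sup>2 / 2)" if "i \<in> I" for i
      proof -
        have "r * cmod (Y 0 (x i) \<omega>) \<le> 1" using True that r R n by (auto simp: r_def field_simps)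
        then have "(r * cmod (Y 0 (x i) \<omega>))\<^sup>2 \<le> 1" using r by (intro power_le_one) auto
        then show ?thesis by simp
      qed
      then have "(\<Prod>i\<in>I. exp (- 1 / 2 :: real)) \<le> b \<omega>" unfolding b_def by (intro prod_mono) auto
      then show ?thesis by (auto simp: indicator_def b_def prod_nonneg)
    next
      case False
      then show ?thesis by (auto simp: indicator_def b_def prod_nonneg)
    qed
  qed
  finally have "exp (- 1 / 2 :: real) ^ card I * prob {\<omega> \<in> space M. \<forall>i\<in>I. cmod (Y 0 (x i) \<omega>) \<le> R / real n} \<le> (4 * R\<^sup>2 / (lm * (real n)\<^sup>2)) ^ card I"
    using b1 by linarith
  then show ?thesis by (simp add: power_mult_distrib exp_minus field_simps)
qed

end

section \<open>Local geometry near a small value\<close>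

lemma has_vector_derivative_bound:
  fixes f :: "real \<Rightarrow> complex"
  assumes f: "\<And>x. (f has_vector_derivative f' x) (at x)"
    and B: "\<And>x. x \<in> closed_segment a b \<Longrightarrow> cmod (f' x) \<le> B"
  shows "cmod (f b - f a) \<le> B * \<bar>b - a\<bar>"
proof -
  have "norm (f b - f a) \<le> B * norm (b - a)"
  proof (rule differentiable_bound [of "closed_segment a b" f "\<lambda>x t. t *\<^sub>R f' x"])
    show "(f has_derivative (\<lambda>t. t *\<^sub>R f' x)) (at x within closed_segment a b)" for x
      using f [of x] unfolding has_vector_derivative_def by (rule has_derivative_at_withinI)
    show "onorm (\<lambda>t. t *\<^sub>R f' x) \<le> B" if "x \<in> closed_segment a b" for x
      using B [OF that] by (intro onorm_le) (simp add: mult.commute [of B] mult_left_mono)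
  qed auto
  then show ?thesis by simp
qed

context
  fixes n :: nat and a :: "int \<Rightarrow> complex" and S :: real
  assumes n: "n > 0" and S: "\<And>x. cmod (scaled_deriv n 2 a x) \<le> S"
begin

lemma S_nonneg: "S \<ge> 0"
  using S [of 0] norm_ge_zero order_trans by blast

lemma scaled_deriv1_lipschitz: "cmod (scaled_deriv n 1 a (x + h) - scaled_deriv n 1 a x) \<le> deriv_sd n * \<bar>h\<bar> * S"
proof -
  have "cmod (scaled_deriv n 1 a (x + h) - scaled_deriv n 1 a x) \<le> (deriv_sd n * S) * \<bar>x + h - x\<bar>"
  proof (rule has_vector_derivative_bound)
    show "(scaled_deriv n 1 a has_vector_derivative of_real (deriv_sd n) * scaled_deriv n (Suc 1) a x) (at x)" for x
      by (rule scaled_deriv_deriv [OF n])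
    show "cmod (of_real (deriv_sd n) * scaled_deriv n (Suc 1) a x) \<le> deriv_sd n * S" for x
      using S [of x] deriv_sd_pos [OF n] by (simp add: norm_mult numeral_2_eq_2)
  qed
  then show ?thesis by (simp add: mult_ac)
qed

lemma scaled_deriv0_taylor: "cmod (scaled_deriv n 0 a (x + h) - scaled_deriv n 0 a x - of_real (deriv_sd n * h) * scaled_deriv n 1 a x) \<le> (deriv_sd n * h)\<^sup>2 * S"
proof -
  have s: "deriv_sd n > 0" by (rule deriv_sd_pos [OF n])
  \<comment> \<open>Subtracting the tangent leaves a function with derivative of order |h|, and the
    mean value inequality makes the error quadratic.\<close>
  define F where "F y = scaled_deriv n 0 a y - of_real (deriv_sd n * y) * scaled_deriv n 1 a x" for y
  have "cmod (F (x + h) - F x) \<le> (deriv_sd n * (deriv_sd n * \<bar>h\<bar> * S)) * \<bar>x + h - x\<bar>"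
  proof (rule has_vector_derivative_bound)
    show "(F has_vector_derivative of_real (deriv_sd n) * (scaled_deriv n 1 a y - scaled_deriv n 1 a x)) (at y)" for y
    proof -
      have "(scaled_deriv n 0 a has_vector_derivative of_real (deriv_sd n) * scaled_deriv n (Suc 0) a y) (at y)"
        by (rule scaled_deriv_deriv [OF n])
      moreover have "((\<lambda>y. of_real (deriv_sd n * y) * scaled_deriv n 1 a x) has_vector_derivative of_real (deriv_sd n) * scaled_deriv n 1 a x) (at y)"
        by (auto intro!: derivative_eq_intros simp: has_vector_derivative_def scaleR_conv_of_real mult_ac)
      ultimately have "(F has_vector_derivative (of_real (deriv_sd n) * scaled_deriv n (Suc 0) a y - of_real (deriv_sd n) * scaled_deriv n 1 a x)) (at y)"
        unfolding F_def [abs_def] by (rule has_vector_derivative_diff)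
      then show ?thesis by (simp add: right_diff_distrib)
    qed
    fix y assume "y \<in> closed_segment x (x + h)"
    then have yh: "\<bar>y - x\<bar> \<le> \<bar>h\<bar>"
      by (auto simp: closed_segment_eq_real_ivl split: if_splits)
    have "cmod (scaled_deriv n 1 a (x + (y - x)) - scaled_deriv n 1 a x) \<le> deriv_sd n * \<bar>y - x\<bar> * S" by (rule scaled_deriv1_lipschitz)
    also have "\<dots> \<le> deriv_sd n * \<bar>h\<bar> * S" using yh s S_nonneg by (intro mult_right_mono mult_left_mono) auto
    finally show "cmod (of_real (deriv_sd n) * (scaled_deriv n 1 a y - scaled_deriv n 1 a x)) \<le> deriv_sd n * (deriv_sd n * \<bar>h\<bar> * S)"
      using s by (simp add: norm_mult)
  qed
  moreover have "(deriv_sd n * (deriv_sd n * \<bar>h\<bar> * S)) * \<bar>x + h - x\<bar> = (deriv_sd n * h)\<^sup>2 * S"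
    by (simp add: power2_eq_square mult_ac)
  moreover have "F (x + h) - F x = scaled_deriv n 0 a (x + h) - scaled_deriv n 0 a x - of_real (deriv_sd n * h) * scaled_deriv n 1 a x"
    by (simp add: F_def algebra_simps)
  ultimately show ?thesis by (simp only:)
qed

text \<open>One unit of \<open>t\<close> moves the argument by \<open>1 / (n * deriv_sd n)\<close>; on this scale \<open>n P\<close> is affine up to
  \<open>O(S / n)\<close>.\<close>

lemma scaled_deriv_affine:
  "cmod (of_nat n * scaled_deriv n 0 a (x + t / (real n * deriv_sd n)) - (of_nat n * scaled_deriv n 0 a x + of_real t * scaled_deriv n 1 a x)) \<le> t\<^sup>2 * S / real n"
proof -
  have s: "deriv_sd n > 0" by (rule deriv_sd_pos [OF n])
  let ?h = "t / (real n * deriv_sd n)"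
  have sh: "deriv_sd n * ?h = t / real n" using s by simp
  have "cmod (of_nat n * (scaled_deriv n 0 a (x + ?h) - scaled_deriv n 0 a x - of_real (t / real n) * scaled_deriv n 1 a x)) \<le> real n * ((t / real n)\<^sup>2 * S)"
    using scaled_deriv0_taylor [of x ?h] n unfolding sh norm_mult by (intro mult_mono) auto
  moreover have "of_nat n * (scaled_deriv n 0 a (x + ?h) - scaled_deriv n 0 a x - of_real (t / real n) * scaled_deriv n 1 a x) =
     of_nat n * scaled_deriv n 0 a (x + ?h) - (of_nat n * scaled_deriv n 0 a x + of_real t * scaled_deriv n 1 a x)"
    using n by (simp add: field_simps)
  moreover have "real n * ((t / real n)\<^sup>2 * S) = t\<^sup>2 * S / real n"
    using n by (simp add: power2_eq_square)
  ultimately show ?thesis by simp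
qed

end

text \<open>The line \<open>t \<mapsto> y + t w\<close> crosses \<open>Re = 0\<close> at a time in \<open>(t0, t1)\<close> and passes the origin at distance
  less than \<open>\<tau>\<close>. For fixed \<open>w\<close> this is a parallelogram with vertical sides, so that Fubini gives its area.\<close>

definition parallelogram :: "real \<Rightarrow> real \<Rightarrow> real \<Rightarrow> real \<Rightarrow> real \<Rightarrow> (complex \<times> complex) set" where
  "parallelogram t0 t1 c C \<tau> = {(y, w). c < \<bar>Re w\<bar> \<and> cmod w < C \<and>
     t0 * (Re w)\<^sup>2 < - (Re y * Re w) \<and> - (Re y * Re w) < t1 * (Re w)\<^sup>2 \<and>
     \<bar>Re y * Im w - Im y * Re w\<bar> < \<tau> * cmod w}"

lemma open_parallelogram: "open (parallelogram t0 t1 c C \<tau>)"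
proof -
  have "parallelogram t0 t1 c C \<tau> = {p. c < \<bar>Re (snd p)\<bar>} \<inter> {p. cmod (snd p) < C} \<inter>
     {p. t0 * (Re (snd p))\<^sup>2 < - (Re (fst p) * Re (snd p))} \<inter> {p. - (Re (fst p) * Re (snd p)) < t1 * (Re (snd p))\<^sup>2} \<inter>
     {p. \<bar>Re (fst p) * Im (snd p) - Im (fst p) * Re (snd p)\<bar> < \<tau> * cmod (snd p)}"
    by (auto simp: parallelogram_def)
  then show ?thesis
    by (simp only:) (intro open_Int open_Collect_less continuous_intros)
qed

text \<open>Bounds |y| as the sum of |Re y|, which is at most a crossing time times C, and of |Im
  y|, obtained from the distance condition divided by |Re w| > c. The summand 1 makes it
  positive.\<close>

definition parallelogram_radius :: "real \<Rightarrow> real \<Rightarrow> real \<Rightarrow> real \<Rightarrow> real \<Rightarrow> real" where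
  "parallelogram_radius t0 t1 c C \<tau> = (\<bar>t0\<bar> + \<bar>t1\<bar>) * C + (\<tau> * C + (\<bar>t0\<bar> + \<bar>t1\<bar>) * C * C) / c + 1"

text \<open>The definition multiplies the crossing time - Re y / Re w by (Re w)^2, which keeps its
  conditions continuous in (y, w) and independent of the sign of Re w. Here the division is
  undone.\<close>

lemma parallelogram_crossing:
  assumes "(y, w) \<in> parallelogram t0 t1 c C \<tau>" "c > 0"
  obtains t where "t0 < t" "t < t1" "Re y = - t * Re w"
proof
  have w: "Re w \<noteq> 0" "(Re w)\<^sup>2 > 0" using assms by (auto simp: parallelogram_def)
  show "Re y = - (- (Re y / Re w)) * Re w" using w by simp
  have "- (Re y / Re w) * (Re w)\<^sup>2 = - (Re y * Re w)" using w by (simp add: power2_eq_square)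
  then have "t0 * (Re w)\<^sup>2 < - (Re y / Re w) * (Re w)\<^sup>2" "- (Re y / Re w) * (Re w)\<^sup>2 < t1 * (Re w)\<^sup>2"
    using assms by (simp_all add: parallelogram_def)
  then show "t0 < - (Re y / Re w)" "- (Re y / Re w) < t1" using w(2) by (metis mult_less_cancel_right_pos)+
qed

lemma parallelogram_bounded:
  assumes B: "(y, w) \<in> parallelogram t0 t1 c C \<tau>" and c: "c > 0" and \<tau>: "\<tau> > 0"
  shows "cmod y \<le> parallelogram_radius t0 t1 c C \<tau>"
proof -
  obtain t where t: "t0 < t" "t < t1" "Re y = - t * Re w" using parallelogram_crossing [OF B c] .
  have w: "c < \<bar>Re w\<bar>" "cmod w < C" "\<bar>Re y * Im w - Im y * Re w\<bar> < \<tau> * cmod w"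
    using B by (auto simp: parallelogram_def)
  have C: "C > 0" using w norm_ge_zero [of w] by linarith
  have rw: "\<bar>Re w\<bar> \<le> C" "\<bar>Im w\<bar> \<le> C" using w abs_Re_le_cmod [of w] abs_Im_le_cmod [of w] by linarith+
  have T: "\<bar>t\<bar> \<le> \<bar>t0\<bar> + \<bar>t1\<bar>" using t by linarith
  have ry: "\<bar>Re y\<bar> \<le> (\<bar>t0\<bar> + \<bar>t1\<bar>) * C"
    unfolding t(3) abs_mult abs_minus_cancel using T rw by (intro mult_mono) auto
  have "\<bar>Im y\<bar> * c \<le> \<bar>Im y\<bar> * \<bar>Re w\<bar>" using w by (intro mult_left_mono) auto
  also have "\<dots> = \<bar>Im y * Re w\<bar>" by (simp add: abs_mult)
  also have "\<dots> \<le> \<tau> * cmod w + \<bar>Re y * Im w\<bar>" using w by linarith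
  also have "\<dots> \<le> \<tau> * C + (\<bar>t0\<bar> + \<bar>t1\<bar>) * C * C"
    unfolding abs_mult using w rw ry \<tau> C by (intro add_mono mult_mono) auto
  finally have "\<bar>Im y\<bar> \<le> (\<tau> * C + (\<bar>t0\<bar> + \<bar>t1\<bar>) * C * C) / c" using c by (simp add: field_simps)
  then show ?thesis using ry cmod_le [of y] unfolding parallelogram_radius_def by linarith
qed

lemma parallelogram_radius_pos: "c > 0 \<Longrightarrow> C > 0 \<Longrightarrow> \<tau> > 0 \<Longrightarrow> parallelogram_radius t0 t1 c C \<tau> > 0"
  unfolding parallelogram_radius_def by (intro add_nonneg_pos add_nonneg_nonneg divide_nonneg_nonneg mult_nonneg_nonneg) auto

lemma bounded_parallelogram:
  assumes "c > 0" "\<tau> > 0"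
  shows "bounded (parallelogram t0 t1 c C \<tau>)"
proof -
  have "parallelogram t0 t1 c C \<tau> \<subseteq> cball 0 (parallelogram_radius t0 t1 c C \<tau>) \<times> cball 0 C"
    using parallelogram_bounded [OF _ assms] by (auto simp: parallelogram_def)
  then show ?thesis by (rule bounded_subset [rotated]) (intro bounded_Times bounded_cball)
qed

text \<open>The time t is the foot of the perpendicular from the origin to the line. There (y + t w)
  times the conjugate of w is purely imaginary, with modulus the expression bounded in the
  definition.\<close>

lemma parallelogram_close:
  assumes B: "(y, w) \<in> parallelogram t0 t1 c C \<tau>" and c: "c > 0" and \<tau>: "\<tau> > 0"
  obtains t where "\<bar>t\<bar> \<le> parallelogram_radius t0 t1 c C \<tau> / c" "cmod (y + of_real t * w) < \<tau>"
proof
  have w: "c < \<bar>Re w\<bar>" "\<bar>Re y * Im w - Im y * Re w\<bar> < \<tau> * cmod w"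
    using B by (auto simp: parallelogram_def)
  then have cw: "c < cmod w" "cmod w > 0" "w \<noteq> 0" using abs_Re_le_cmod [of w] c by auto
  define t where "t = - (Re (y * cnj w) / (cmod w)\<^sup>2)"
  have "\<bar>Re (y * cnj w)\<bar> \<le> cmod y * cmod w" using abs_Re_le_cmod [of "y * cnj w"] by (simp add: norm_mult)
  then have "\<bar>t\<bar> \<le> cmod y / cmod w" using cw by (simp add: t_def field_simps power2_eq_square)
  also have "\<dots> \<le> parallelogram_radius t0 t1 c C \<tau> / c"
    using parallelogram_bounded [OF B c \<tau>] c cw norm_ge_zero [of y] by (intro frac_le) linarith+
  finally show "\<bar>- (Re (y * cnj w) / (cmod w)\<^sup>2)\<bar> \<le> parallelogram_radius t0 t1 c C \<tau> / c" by (simp only: t_def)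
  have "(y + of_real t * w) * cnj w = of_real (t * (cmod w)\<^sup>2) + y * cnj w"
    by (simp add: distrib_right mult.assoc complex_norm_square [symmetric])
  also have "t * (cmod w)\<^sup>2 = - Re (y * cnj w)" using cw by (simp add: t_def)
  finally have "(y + of_real t * w) * cnj w = \<i> * of_real (Im (y * cnj w))"
    by (simp add: complex_eq_iff)
  then have "cmod (y + of_real t * w) * cmod w = \<bar>Im (y * cnj w)\<bar>"
    by (metis complex_mod_cnj norm_mult norm_ii norm_of_real mult_1)
  also have "\<dots> < \<tau> * cmod w" using w(2) by (simp add: algebra_simps abs_minus_commute)
  finally show "cmod (y + of_real (- (Re (y * cnj w) / (cmod w)\<^sup>2)) * w) < \<tau>"
    using cw unfolding t_def by simp
qed

text \<open>If two grid points carried crossings of \<open>Re P = 0\<close>, then between the two crossings \<open>Re P\<close>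
  would have to turn around, which costs a distance of order \<open>1 / S\<close>.\<close>

lemma parallelogram_exclusion:
  assumes n: "n > 0" and S: "\<And>x. cmod (scaled_deriv n 2 a x) \<le> S"
    and c: "c > 0" and L: "L > 2" and d: "d > 0" "(L - 1) / real n \<le> deriv_sd n * d"
    and B1: "(of_nat n * scaled_deriv n 0 a x, scaled_deriv n 1 a x) \<in> parallelogram 1 (L - 1) c C \<tau>"
    and B2: "(of_nat n * scaled_deriv n 0 a (x + d), scaled_deriv n 1 a (x + d)) \<in> parallelogram 1 (L - 1) c C \<tau>"
  shows "c \<le> 2 * L * S * (deriv_sd n * d)"
proof -
  define D where "D = deriv_sd n * d"
  have D: "D > 0" "(L - 1) / real n \<le> D" using d deriv_sd_pos [OF n] by (simp_all add: D_def)
  have S0: "S \<ge> 0" using S [of 0] norm_ge_zero order_trans by blast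
  obtain t where t: "1 < t" "t < L - 1" "Re (of_nat n * scaled_deriv n 0 a x) = - t * Re (scaled_deriv n 1 a x)"
    using parallelogram_crossing [OF B1 c] .
  obtain t' where t': "1 < t'" "t' < L - 1" "Re (of_nat n * scaled_deriv n 0 a (x + d)) = - t' * Re (scaled_deriv n 1 a (x + d))"
    using parallelogram_crossing [OF B2 c] .
  define R where "R = Re (scaled_deriv n 1 a x)"
  define E1 where "E1 = Re (scaled_deriv n 0 a (x + d)) - Re (scaled_deriv n 0 a x) - D * R"
  define E2 where "E2 = Re (scaled_deriv n 1 a (x + d)) - R"
  have R: "\<bar>R\<bar> > c" using B1 by (simp add: parallelogram_def R_def)
  have E1: "\<bar>E1\<bar> \<le> D\<^sup>2 * S"
    using order_trans [OF abs_Re_le_cmod scaled_deriv0_taylor [OF n S, of x d]] by (simp add: E1_def D_def R_def)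
  have E2: "\<bar>E2\<bar> \<le> D * S"
    using order_trans [OF abs_Re_le_cmod scaled_deriv1_lipschitz [OF n S, of x d]] d by (simp add: E2_def D_def R_def)
  define h where "h = t / real n"
  define h' where "h' = t' / real n"
  have n0: "real n > 0" using n by simp
  have X: "Re (scaled_deriv n 0 a x) = - h * R" "Re (scaled_deriv n 0 a (x + d)) = - h' * (R + E2)"
    using t(3) t'(3) n0 by (simp_all add: h_def h'_def R_def E2_def field_simps)
  \<comment> \<open>D - h + h' is the distance between the two linearised crossings, in units of 1 /
    \<open>deriv_sd n\<close>. It is nonzero only because of the curvature terms E1 and E2.\<close>
  have eq: "(D - h + h') * R = - E1 - h' * E2"
    using X unfolding E1_def by (simp add: algebra_simps)
  have hh: "h - h' \<le> (L - 2) / real n" "0 < h'" "h' < (L - 1) / real n"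
    using t t' n0 by (simp_all add: h_def h'_def divide_strict_right_mono flip: diff_divide_distrib) (simp add: divide_right_mono)
  \<comment> \<open>Here the trimming counts: crossing times differ by less than L - 2, while the
    grid points are at least L - 1 apart in the same units, so the crossings keep at least the share
    1 / L of the distance D.\<close>
  have "(L - 2) / real n \<le> D * (L - 2) / (L - 1)"
  proof -
    have "(L - 1) / real n * ((L - 2) / (L - 1)) \<le> D * ((L - 2) / (L - 1))" using D L by (intro mult_right_mono) auto
    then show ?thesis using L by simp
  qed
  moreover have "D - D * (L - 2) / (L - 1) = D / (L - 1)" using L by (simp add: field_simps)
  moreover have "D / L \<le> D / (L - 1)" using L D by (intro divide_left_mono) auto
  ultimately have lower: "D / L \<le> D - h + h'" using hh by linarith
  moreover have "0 < D / L" using D L by simp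
  ultimately have Dh: "D - h + h' \<ge> 0" by linarith
  have "D / L * c \<le> (D - h + h') * \<bar>R\<bar>"
    using lower R c Dh by (intro mult_mono) auto
  also have "\<dots> = \<bar>(D - h + h') * R\<bar>"
    using Dh by (simp add: abs_mult)
  also have "\<dots> \<le> \<bar>E1\<bar> + h' * \<bar>E2\<bar>"
    unfolding eq using hh abs_triangle_ineq4 [of "- E1" "h' * E2"] by (simp add: abs_mult)
  also have "\<dots> \<le> D\<^sup>2 * S + D * (D * S)"
    using E1 E2 hh D S0 by (intro add_mono mult_mono) auto
  also have "\<dots> = D * (2 * D * S)" by (simp add: power2_eq_square)
  finally have "D * (c / L) \<le> D * (2 * D * S)" by simp
  then have "c / L \<le> 2 * D * S" using D(1) by (simp only: mult_le_cancel_left_pos)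
  then show ?thesis using L by (simp add: D_def field_simps)
qed

lemma min_modulus_le: "min_modulus a n \<le> cmod (scaled_deriv n 0 a x)"
  unfolding min_modulus_def trig_poly_scaled_deriv by (rule cINF_lower) (auto intro: bdd_belowI [of _ 0])

text \<open>The foot of the perpendicular is reached within a bounded time, so P is within O(S /
  n^2) of its affine approximation there. This point may lie outside the grid cell, which does no
  harm for an upper bound on the minimum.\<close>

lemma parallelogram_min_modulus:
  assumes n: "n > 0" and S: "\<And>x. cmod (scaled_deriv n 2 a x) \<le> S"
    and c: "c > 0" and \<tau>: "\<tau> > 0"
    and B: "(of_nat n * scaled_deriv n 0 a x, scaled_deriv n 1 a x) \<in> parallelogram t0 t1 c C \<tau>"
  shows "min_modulus a n < (\<tau> + (parallelogram_radius t0 t1 c C \<tau> / c)\<^sup>2 * S / real n) / real n"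
proof -
  have S0: "S \<ge> 0" using S [of 0] norm_ge_zero order_trans by blast
  obtain t where t: "\<bar>t\<bar> \<le> parallelogram_radius t0 t1 c C \<tau> / c" "cmod (of_nat n * scaled_deriv n 0 a x + of_real t * scaled_deriv n 1 a x) < \<tau>"
    using parallelogram_close [OF B c \<tau>] .
  have "t\<^sup>2 \<le> (parallelogram_radius t0 t1 c C \<tau> / c)\<^sup>2" using t(1) by (rule abs_le_square_iff [THEN iffD1, OF order_trans [OF _ abs_ge_self]])
  then have "t\<^sup>2 * S / real n \<le> (parallelogram_radius t0 t1 c C \<tau> / c)\<^sup>2 * S / real n"
    using S0 by (intro divide_right_mono mult_right_mono) auto
  moreover have "cmod (of_nat n * scaled_deriv n 0 a (x + t / (real n * deriv_sd n))) \<le>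
     cmod (of_nat n * scaled_deriv n 0 a x + of_real t * scaled_deriv n 1 a x) + t\<^sup>2 * S / real n"
    using scaled_deriv_affine [OF n S, of x t] norm_triangle_sub [of "of_nat n * scaled_deriv n 0 a (x + t / (real n * deriv_sd n))"
      "of_nat n * scaled_deriv n 0 a x + of_real t * scaled_deriv n 1 a x"] by linarith
  ultimately have "real n * cmod (scaled_deriv n 0 a (x + t / (real n * deriv_sd n))) < \<tau> + (parallelogram_radius t0 t1 c C \<tau> / c)\<^sup>2 * S / real n"
    using t(2) by (simp add: norm_mult)
  then have "real n * min_modulus a n < \<tau> + (parallelogram_radius t0 t1 c C \<tau> / c)\<^sup>2 * S / real n"
    using min_modulus_le [of a n "x + t / (real n * deriv_sd n)"] by (smt (verit) mult_left_mono of_nat_0_le_iff)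
  then show ?thesis using n by (simp add: pos_less_divide_eq mult.commute)
qed

text \<open>The condition that a small value inside the cell to the right of a grid point forces, up
  to linearisation. The trimmed parallelogram misses part of it, at the ends of the cell and at
  extreme slopes.\<close>

definition strip :: "real \<Rightarrow> real \<Rightarrow> (complex \<times> complex) set" where
  "strip L \<tau> = {(y, w). \<exists>t\<in>{0..L}. cmod (y + of_real t * w) < \<tau>}"

definition grid :: "nat \<Rightarrow> nat \<Rightarrow> real" where
  "grid K k = 2 * pi * real k / real K"

lemma scaled_deriv_periodic: "scaled_deriv n p a (x + 2 * pi * of_int m) = scaled_deriv n p a x"
proof -
  have "cis (of_int k * (x + 2 * pi * of_int m)) = cis (of_int k * x)" for k :: int
  proof -
    have "cis (2 * pi * of_int (k * m)) = 1" by (rule cis_multiple_2pi) simp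
    moreover have "of_int k * (x + 2 * pi * of_int m) = of_int k * x + 2 * pi * of_int (k * m)"
      by (simp add: algebra_simps)
    ultimately show ?thesis by (simp only: cis_mult [symmetric] mult_1_right)
  qed
  then show ?thesis by (simp add: scaled_deriv_def trig_coeff_def)
qed

lemma grid_point:
  assumes K: "K > 0"
  obtains k m h where "k < K" "0 \<le> h" "h < 2 * pi / real K" "x = (grid K k + h) + 2 * pi * of_int m"
proof -
  define j where "j = \<lfloor>x * real K / (2 * pi)\<rfloor>"
  define k where "k = nat (j mod int K)"
  define h where "h = x - 2 * pi * of_int j / real K"
  have j: "of_int j \<le> x * real K / (2 * pi)" "x * real K / (2 * pi) < of_int j + 1" unfolding j_def by linarith+
  have k: "int k = j mod int K" using K by (simp add: k_def)
  show thesis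
  proof
    show "k < K" using k K by (metis of_nat_less_iff pos_mod_bound of_nat_0_less_iff)
    have "h = (x * real K / (2 * pi) - of_int j) * (2 * pi / real K)"
      using K by (simp add: h_def field_simps)
    moreover have "2 * pi / real K > 0" using K by simp
    ultimately show "0 \<le> h" "h < 2 * pi / real K"
      using j mult_strict_right_mono [of "x * real K / (2 * pi) - of_int j" 1 "2 * pi / real K"] by auto
    have "real_of_int j = of_int (int K) * of_int (j div int K) + real k"
      using mult_div_mod_eq [of "int K" j] k by (metis of_int_add of_int_mult of_int_of_nat_eq)
    then show "x = (grid K k + h) + 2 * pi * of_int (j div int K)"
      using K by (simp add: h_def grid_def field_simps)
  qed
qed

text \<open>The minimiser lies, modulo the period, in the cell to the right of some grid point; its
  offset corresponds to a time t in [0, L], and linearisation costs at most L^2 S / n in the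
  level.\<close>

lemma min_modulus_strip:
  assumes n: "n > 0" and S: "\<And>x. cmod (scaled_deriv n 2 a x) \<le> S" and K: "K > 0" "2 * pi * (real n * deriv_sd n) / real K \<le> L"
    and m: "min_modulus a n < \<tau> / real n"
  shows "\<exists>k<K. (of_nat n * scaled_deriv n 0 a (grid K k), scaled_deriv n 1 a (grid K k)) \<in> strip L (\<tau> + L\<^sup>2 * S / real n)"
proof -
  have s: "deriv_sd n > 0" by (rule deriv_sd_pos [OF n])
  have S0: "S \<ge> 0" using S [of 0] norm_ge_zero order_trans by blast
  obtain x where x: "min_modulus a n = cmod (trig_poly a n x)" using min_modulus_attained by metis
  obtain k q h where k: "k < K" "0 \<le> h" "h < 2 * pi / real K" "x = (grid K k + h) + 2 * pi * of_int q"
    using grid_point [OF K(1), of x] .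
  define t where "t = real n * deriv_sd n * h"
  have "t \<le> real n * deriv_sd n * (2 * pi / real K)" unfolding t_def using k s n by (intro mult_left_mono) auto
  then have t: "t \<in> {0..L}" using k s K by (auto simp: t_def mult_ac)
  then have tL: "t\<^sup>2 \<le> L\<^sup>2" by (intro power_mono) auto
  have "cmod (scaled_deriv n 0 a (grid K k + h)) < \<tau> / real n"
    using m unfolding x trig_poly_scaled_deriv k(4) scaled_deriv_periodic .
  moreover have "h = t / (real n * deriv_sd n)" using s n by (simp add: t_def)
  ultimately have "cmod (of_nat n * scaled_deriv n 0 a (grid K k + t / (real n * deriv_sd n))) < \<tau>"
    using n by (simp add: norm_mult field_simps)
  then have "cmod (of_nat n * scaled_deriv n 0 a (grid K k) + of_real t * scaled_deriv n 1 a (grid K k)) < \<tau> + t\<^sup>2 * S / real n"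
    using scaled_deriv_affine [OF n S, of "grid K k" t]
      norm_triangle_sub [of "of_nat n * scaled_deriv n 0 a (grid K k) + of_real t * scaled_deriv n 1 a (grid K k)" "of_nat n * scaled_deriv n 0 a (grid K k + t / (real n * deriv_sd n))"]
    by (simp add: norm_minus_commute)
  also have "\<dots> \<le> \<tau> + L\<^sup>2 * S / real n"
    using tL S0 by (intro add_left_mono divide_right_mono mult_right_mono) auto
  finally show ?thesis using k(1) t unfolding strip_def by blast
qed

section \<open>A uniform bound on the second derivative\<close>

lemma abs_div_deriv_sd_le:
  assumes "n > 0" "k \<in> {- int n..int n}"
  shows "\<bar>of_int k / deriv_sd n\<bar> \<le> sqrt 3"
proof -
  have "\<bar>real_of_int k\<bar> \<le> real n" using assms by auto
  then have "(of_int k)\<^sup>2 \<le> (real n)\<^sup>2" using abs_le_square_iff [of "of_int k" "real n"] by simp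
  also have "\<dots> \<le> 3 * (deriv_sd n)\<^sup>2" by (simp add: deriv_sd_square) (simp add: power2_eq_square algebra_simps)
  finally have "(of_int k / deriv_sd n)\<^sup>2 \<le> 3" using deriv_sd_pos [OF assms(1)] by (simp add: power_divide field_simps)
  then show ?thesis by (metis real_sqrt_abs real_sqrt_le_iff)
qed

lemma norm_trig_coeff_le:
  assumes "n > 0" "k \<in> {- int n..int n}"
  shows "cmod (trig_coeff n p x k) \<le> sqrt 3 ^ p / sqrt (2 * real n + 1)"
proof -
  have "cmod (trig_coeff n p x k) = \<bar>of_int k / deriv_sd n\<bar> ^ p / sqrt (2 * real n + 1)"
    unfolding trig_coeff_def norm_mult norm_power norm_of_real norm_cis norm_ii by simp
  also have "\<dots> \<le> sqrt 3 ^ p / sqrt (2 * real n + 1)"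
    using abs_div_deriv_sd_le [OF assms] by (intro divide_right_mono power_mono) auto
  finally show ?thesis .
qed

text \<open>The bound at grid points extends to the circle through a crude bound of order sqrt n on
  the third derivative: a grid step has length at most L / n in units of 1 /
  \<open>deriv_sd n\<close>, so the change in between is O(L / sqrt n) times s.\<close>

lemma sup_second_derivative:
  assumes n: "n > 0" and K: "K > 0" "2 * pi * (real n * deriv_sd n) / real K \<le> L" and s: "s \<ge> 0"
    and grid: "\<And>k. k < K \<Longrightarrow> cmod (scaled_deriv n 2 a (grid K k)) \<le> 3 * s"
    and coeff: "\<And>k. k \<in> {- int n..int n} \<Longrightarrow> cmod (a k) \<le> s"
    and large: "6 * L * sqrt (2 * real n + 1) \<le> real n"
  shows "cmod (scaled_deriv n 2 a x) \<le> 4 * s"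
proof -
  have s0: "deriv_sd n > 0" by (rule deriv_sd_pos [OF n])
  let ?N = "2 * real n + 1"
  have sq3: "sqrt 3 ^ 3 \<le> (6 :: real)"
  proof -
    have "sqrt 3 ^ 3 = 3 * sqrt (3::real)" by (simp add: power3_eq_cube)
    also have "\<dots> \<le> 3 * 2" by (intro mult_left_mono real_le_lsqrt) auto
    finally show ?thesis by simp
  qed
  have f3: "cmod (scaled_deriv n (Suc 2) a y) \<le> 6 * sqrt ?N * s" for y
  proof -
    have "cmod (scaled_deriv n (Suc 2) a y) \<le> (\<Sum>k = - int n..int n. 6 / sqrt ?N * s)"
      unfolding scaled_deriv_def
    proof (intro sum_norm_le)
      fix k assume k: "k \<in> {- int n..int n}"
      have "cmod (trig_coeff n (Suc 2) y k) \<le> sqrt 3 ^ Suc 2 / sqrt ?N" by (rule norm_trig_coeff_le [OF n k])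
      also have "\<dots> \<le> 6 / sqrt ?N" using sq3 by (intro divide_right_mono) (auto simp: eval_nat_numeral)
      finally show "cmod (trig_coeff n (Suc 2) y k * a k) \<le> 6 / sqrt ?N * s"
        unfolding norm_mult using coeff [OF k] by (intro mult_mono) auto
    qed
    also have "\<dots> = 6 * (?N / sqrt ?N) * s" by (simp add: algebra_simps)
    also have "?N / sqrt ?N = sqrt ?N" by (rule real_div_sqrt) simp
    finally show ?thesis .
  qed
  obtain k m h where k: "k < K" "0 \<le> h" "h < 2 * pi / real K" "x = (grid K k + h) + 2 * pi * of_int m"
    using grid_point [OF K(1), of x] .
  have "cmod (scaled_deriv n 2 a (grid K k + h) - scaled_deriv n 2 a (grid K k)) \<le> (deriv_sd n * (6 * sqrt ?N * s)) * \<bar>grid K k + h - grid K k\<bar>"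
  proof (rule has_vector_derivative_bound)
    show "(scaled_deriv n 2 a has_vector_derivative of_real (deriv_sd n) * scaled_deriv n (Suc 2) a y) (at y)" for y
      by (rule scaled_deriv_deriv [OF n])
    show "cmod (of_real (deriv_sd n) * scaled_deriv n (Suc 2) a y) \<le> deriv_sd n * (6 * sqrt ?N * s)" for y
      unfolding norm_mult using f3 [of y] s0 by (intro mult_mono) auto
  qed
  also have "\<dots> = (deriv_sd n * h) * (6 * sqrt ?N * s)" using k by simp
  also have "\<dots> \<le> (L / real n) * (6 * sqrt ?N * s)"
  proof (intro mult_right_mono)
    have "deriv_sd n * h \<le> deriv_sd n * (2 * pi / real K)" using k s0 by (intro mult_left_mono) auto
    also have "\<dots> \<le> L / real n" using K n by (simp add: field_simps)
    finally show "deriv_sd n * h \<le> L / real n" .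
  qed (use s in auto)
  also have "\<dots> = (6 * L * sqrt ?N) / real n * s" by simp
  also have "\<dots> \<le> 1 * s" using large n s by (intro mult_right_mono) auto
  finally have "cmod (scaled_deriv n 2 a (grid K k + h)) \<le> 4 * s"
    using grid [OF k(1)] norm_triangle_sub [of "scaled_deriv n 2 a (grid K k + h)" "scaled_deriv n 2 a (grid K k)"] by linarith
  then show ?thesis unfolding k(4) scaled_deriv_periodic .
qed

context gaussian_trig
begin

definition good :: "nat \<Rightarrow> real \<Rightarrow> 'a set" where
  "good K s = {\<omega> \<in> space M. (\<forall>k<K. cmod (Y 2 (grid K k) \<omega>) \<le> 3 * s) \<and> (\<forall>j\<in>{- int n..int n}. cmod (\<zeta> j \<omega>) \<le> s)}"

lemma good_prob:
  assumes s: "s \<ge> 0"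
  shows "prob (space M - good K s) \<le> 2 * (real K + (2 * real n + 1)) * exp (- (s\<^sup>2 / 2))"
proof -
  let ?A = "\<lambda>k. {\<omega> \<in> space M. cmod (Y 2 (grid K k) \<omega>) > 3 * s}"
  let ?B = "\<lambda>j. {\<omega> \<in> space M. cmod (\<zeta> j \<omega>) > s}"
  have A: "prob (?A k) \<le> 2 * exp (- (s\<^sup>2 / 2))" for k
  proof -
    \<comment> \<open>The variance is at most (sqrt 3)^4 = 9, so the threshold 3 s gives the
      exponent s^2 / 2, the same as for one coefficient at threshold s.\<close>
    have "(\<Sum>j = - int n..int n. (cmod (trig_coeff n 2 (grid K k) j))\<^sup>2) \<le> (\<Sum>j = - int n..int n. 9 / (2 * real n + 1))"
    proof (intro sum_mono)
      fix j assume j: "j \<in> {- int n..int n}"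
      have "(cmod (trig_coeff n 2 (grid K k) j))\<^sup>2 \<le> (sqrt 3 ^ 2 / sqrt (2 * real n + 1))\<^sup>2"
        by (intro power_mono norm_trig_coeff_le n j) simp
      then show "(cmod (trig_coeff n 2 (grid K k) j))\<^sup>2 \<le> 9 / (2 * real n + 1)" by (simp add: power_divide)
    qed
    also have "(\<Sum>j = - int n..int n. 9 / (2 * real n + 1)) = 9" by (simp add: field_simps)
    finally have "(\<Sum>j = - int n..int n. (cmod (trig_coeff n 2 (grid K k) j))\<^sup>2) \<le> 9" .
    from linear_tail [OF this, of "3 * s"] s show ?thesis
      by (simp add: Y_def scaled_deriv_def power_mult_distrib)
  qed
  have B: "prob (?B j) \<le> 2 * exp (- (s\<^sup>2 / 2))" if j: "j \<in> {- int n..int n}" for j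
  proof -
    \<comment> \<open>A single coefficient is the linear form of a unit vector.\<close>
    have "(\<Sum>k = - int n..int n. (cmod (if k = j then 1 else 0))\<^sup>2) \<le> 1"
      using j by (simp add: if_distrib [of cmod] if_distrib [of "\<lambda>x. x ^ 2"] sum.delta' cong: if_cong)
    from linear_tail [OF this, of s] s show ?thesis using j
      by (simp add: if_distribR sum.delta' if_distrib [of "\<lambda>x. x * _"] cong: if_cong)
  qed
  have "space M - good K s \<subseteq> (\<Union>k\<in>{..<K}. ?A k) \<union> (\<Union>j\<in>{- int n..int n}. ?B j)"
    by (auto simp: good_def not_le)
  then have "prob (space M - good K s) \<le> prob ((\<Union>k\<in>{..<K}. ?A k) \<union> (\<Union>j\<in>{- int n..int n}. ?B j))"
    by (intro finite_measure_mono) auto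
  also have "\<dots> \<le> prob (\<Union>k\<in>{..<K}. ?A k) + prob (\<Union>j\<in>{- int n..int n}. ?B j)"
    by (intro measure_Un_le) auto
  also have "\<dots> \<le> (\<Sum>k\<in>{..<K}. prob (?A k)) + (\<Sum>j\<in>{- int n..int n}. prob (?B j))"
    by (intro add_mono finite_measure_subadditive_finite) auto
  also have "\<dots> \<le> (\<Sum>k\<in>{..<K}. 2 * exp (- (s\<^sup>2 / 2))) + (\<Sum>j\<in>{- int n..int n}. 2 * exp (- (s\<^sup>2 / 2)))"
    by (intro add_mono sum_mono A B)
  also have "\<dots> = 2 * (real K + (2 * real n + 1)) * exp (- (s\<^sup>2 / 2))" by (simp add: algebra_simps)
  finally show ?thesis .
qed

end

section \<open>Poisson limit for events in blocks\<close>

text \<open>Pascal's rule makes the sum telescope; the sign of the remainder decides the direction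
  of each Bonferroni inequality.\<close>

lemma alternating_binomial_sum:
  assumes "V > 0"
  shows "(\<Sum>j\<le>m. (- 1) ^ j * real (V choose j)) = (- 1) ^ m * real ((V - 1) choose m)"
proof (induction m)
  case (Suc m)
  have "V choose Suc m = (V - 1 choose m) + (V - 1 choose Suc m)"
    using assms by (cases V) auto
  then show ?case using Suc by (simp add: algebra_simps)
qed simp

lemma bonferroni_pointwise:
  "(if V = 0 then 1 else 0) \<le> (\<Sum>j\<le>2 * r. (- 1) ^ j * real (V choose j))"
  "(\<Sum>j\<le>2 * r + 1. (- 1) ^ j * real (V choose j)) \<le> (if V = 0 then 1 else 0)"
proof -
  have z: "(\<Sum>j\<le>k. (- 1) ^ j * real (0 choose j)) = 1" for k
    by (induction k) auto
  show "(if V = 0 then 1 else 0) \<le> (\<Sum>j\<le>2 * r. (- 1) ^ j * real (V choose j))"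
    using z [of "2 * r"] alternating_binomial_sum [of V "2 * r"] by (cases "V = 0") auto
  show "(\<Sum>j\<le>2 * r + 1. (- 1) ^ j * real (V choose j)) \<le> (if V = 0 then 1 else 0)"
    using z [of "2 * r + 1"] alternating_binomial_sum [of V "2 * r + 1"] by (cases "V = 0") auto
qed

context prob_space
begin

text \<open>The binomial coefficient counts the j-subsets of events that all occur.\<close>

lemma choose_expectation:
  fixes E :: "'i \<Rightarrow> 'a set"
  assumes I: "finite I" and E: "\<And>b. b \<in> I \<Longrightarrow> E b \<in> events"
  shows "expectation (\<lambda>\<omega>. real (card {b \<in> I. \<omega> \<in> E b} choose j)) =
      (\<Sum>S | S \<subseteq> I \<and> card S = j. prob {\<omega> \<in> space M. \<forall>b\<in>S. \<omega> \<in> E b})"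
    "integrable M (\<lambda>\<omega>. real (card {b \<in> I. \<omega> \<in> E b} choose j))"
proof -
  have fin: "finite {S. S \<subseteq> I \<and> card S = j}"
    using I by (rule_tac finite_subset [of _ "Pow I"]) auto
  have ev [measurable]: "{\<omega> \<in> space M. \<forall>b\<in>S. \<omega> \<in> E b} \<in> events" if "S \<subseteq> I" for S
  proof -
    have "finite S" using that I by (rule finite_subset)
    then show ?thesis using that E by (intro sets.sets_Collect_finite_All) (auto simp: sets.Int_space_eq2 Collect_conj_eq)
  qed
  have eq: "real (card {b \<in> I. \<omega> \<in> E b} choose j) =
      (\<Sum>S | S \<subseteq> I \<and> card S = j. indicator {\<omega> \<in> space M. \<forall>b\<in>S. \<omega> \<in> E b} \<omega>)" if "\<omega> \<in> space M" for \<omega>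
  proof -
    have "card {b \<in> I. \<omega> \<in> E b} choose j = card {S. S \<subseteq> {b \<in> I. \<omega> \<in> E b} \<and> card S = j}"
      using I by (subst n_subsets) auto
    also have "{S. S \<subseteq> {b \<in> I. \<omega> \<in> E b} \<and> card S = j} = {S \<in> {S. S \<subseteq> I \<and> card S = j}. \<forall>b\<in>S. \<omega> \<in> E b}"
      by auto
    also have "real (card \<dots>) = (\<Sum>S | S \<subseteq> I \<and> card S = j. if \<forall>b\<in>S. \<omega> \<in> E b then 1 else 0)"
      using fin by (simp add: sum.If_cases Int_def)
    also have "\<dots> = (\<Sum>S | S \<subseteq> I \<and> card S = j. indicator {\<omega> \<in> space M. \<forall>b\<in>S. \<omega> \<in> E b} \<omega>)"
      using that by (intro sum.cong) (auto simp: indicator_def)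
    finally show ?thesis .
  qed
  have int: "integrable M (\<lambda>\<omega>. \<Sum>S | S \<subseteq> I \<and> card S = j. indicator {\<omega> \<in> space M. \<forall>b\<in>S. \<omega> \<in> E b} \<omega> :: real)"
    by (intro Bochner_Integration.integrable_sum integrable_real_indicator ev) (auto simp: emeasure_eq_measure)
  then show "integrable M (\<lambda>\<omega>. real (card {b \<in> I. \<omega> \<in> E b} choose j))"
    by (subst Bochner_Integration.integrable_cong [OF refl eq]) auto
  have "expectation (\<lambda>\<omega>. real (card {b \<in> I. \<omega> \<in> E b} choose j)) =
     expectation (\<lambda>\<omega>. \<Sum>S | S \<subseteq> I \<and> card S = j. indicator {\<omega> \<in> space M. \<forall>b\<in>S. \<omega> \<in> E b} \<omega>)"
    by (intro Bochner_Integration.integral_cong refl eq)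
  also have "\<dots> = (\<Sum>S | S \<subseteq> I \<and> card S = j. expectation (indicator {\<omega> \<in> space M. \<forall>b\<in>S. \<omega> \<in> E b}))"
    by (intro Bochner_Integration.integral_sum integrable_real_indicator ev) (auto simp: emeasure_eq_measure)
  also have "\<dots> = (\<Sum>S | S \<subseteq> I \<and> card S = j. prob {\<omega> \<in> space M. \<forall>b\<in>S. \<omega> \<in> E b})"
    by (intro sum.cong refl) (simp add: Int_def conj_ac cong: conj_cong)
  finally show "expectation (\<lambda>\<omega>. real (card {b \<in> I. \<omega> \<in> E b} choose j)) =
      (\<Sum>S | S \<subseteq> I \<and> card S = j. prob {\<omega> \<in> space M. \<forall>b\<in>S. \<omega> \<in> E b})" .
qed

text \<open>The pointwise inequalities for the number V of occurring events are integrated; T j is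
  the expectation of V choose j.\<close>

lemma bonferroni:
  fixes E :: "'i \<Rightarrow> 'a set"
  assumes I: "finite I" and E: "\<And>b. b \<in> I \<Longrightarrow> E b \<in> events"
  defines "T \<equiv> \<lambda>j. (\<Sum>S | S \<subseteq> I \<and> card S = j. prob {\<omega> \<in> space M. \<forall>b\<in>S. \<omega> \<in> E b})"
  shows "prob {\<omega> \<in> space M. \<forall>b\<in>I. \<omega> \<notin> E b} \<le> (\<Sum>j\<le>2 * r. (- 1) ^ j * T j)"
    and "(\<Sum>j\<le>2 * r + 1. (- 1) ^ j * T j) \<le> prob {\<omega> \<in> space M. \<forall>b\<in>I. \<omega> \<notin> E b}"
proof -
  define V where "V \<omega> = card {b \<in> I. \<omega> \<in> E b}" for \<omega>
  have V0: "(if V \<omega> = 0 then 1 else 0) = indicator {\<omega> \<in> space M. \<forall>b\<in>I. \<omega> \<notin> E b} \<omega>" if "\<omega> \<in> space M" for \<omega>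
    using that I by (auto simp: V_def indicator_def)
  have ev: "{\<omega> \<in> space M. \<forall>b\<in>I. \<omega> \<notin> E b} \<in> events"
  proof -
    have "{\<omega> \<in> space M. \<forall>b\<in>I. \<omega> \<notin> E b} = space M - (\<Union>b\<in>I. E b)" by auto
    then show ?thesis using I E by (auto intro!: sets.Diff sets.finite_UN)
  qed
  have intV: "integrable M (\<lambda>\<omega>. real (V \<omega> choose j))" and expV: "expectation (\<lambda>\<omega>. real (V \<omega> choose j)) = T j" for j
    unfolding V_def T_def by (rule choose_expectation [OF I E]; assumption)+
  have int: "integrable M (\<lambda>\<omega>. \<Sum>j\<le>k. (- 1) ^ j * real (V \<omega> choose j))" for k
    by (intro Bochner_Integration.integrable_sum integrable_mult_right intV)
  have exps: "expectation (\<lambda>\<omega>. \<Sum>j\<le>k. (- 1) ^ j * real (V \<omega> choose j)) = (\<Sum>j\<le>k. (- 1) ^ j * T j)" for k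
    by (subst Bochner_Integration.integral_sum) (auto intro!: integrable_mult_right intV simp: expV)
  have p: "prob {\<omega> \<in> space M. \<forall>b\<in>I. \<omega> \<notin> E b} = expectation (indicator {\<omega> \<in> space M. \<forall>b\<in>I. \<omega> \<notin> E b})"
    by (simp add: Int_def conj_ac cong: conj_cong)
  have intI: "integrable M (indicator {\<omega> \<in> space M. \<forall>b\<in>I. \<omega> \<notin> E b} :: _ \<Rightarrow> real)"
    using ev by (intro integrable_real_indicator) (auto simp: emeasure_eq_measure)
  show "prob {\<omega> \<in> space M. \<forall>b\<in>I. \<omega> \<notin> E b} \<le> (\<Sum>j\<le>2 * r. (- 1) ^ j * T j)"
    unfolding p exps [symmetric]
    by (intro integral_mono intI int, subst V0 [symmetric]) (simp_all only: bonferroni_pointwise)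
  show "(\<Sum>j\<le>2 * r + 1. (- 1) ^ j * T j) \<le> prob {\<omega> \<in> space M. \<forall>b\<in>I. \<omega> \<notin> E b}"
    unfolding p exps [symmetric]
    by (intro integral_mono intI int, subst V0 [symmetric]) (simp_all only: bonferroni_pointwise)
qed

text \<open>Apart from \<open>G\<close>, at most one selection \<open>f\<close> of one index per block can occur unless some block is hit twice;
  every selection occurring in the latter case is paid for by a double hit.\<close>

lemma block_intersection:
  fixes A :: "'i \<Rightarrow> nat \<Rightarrow> 'a set"
  assumes S: "finite S" and A: "\<And>b k. b \<in> S \<Longrightarrow> A b k \<in> events" and G: "G \<in> events"
    and tuple: "\<And>f. f \<in> S \<rightarrow>\<^sub>E {..<h} \<Longrightarrow> \<bar>prob {\<omega> \<in> space M. \<forall>b\<in>S. \<omega> \<in> A b (f b)} - q\<bar> \<le> \<epsilon>"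
    and double: "\<And>f b0 l. f \<in> S \<rightarrow>\<^sub>E {..<h} \<Longrightarrow> b0 \<in> S \<Longrightarrow> l < h \<Longrightarrow> l \<noteq> f b0 \<Longrightarrow>
       prob {\<omega> \<in> G. (\<forall>b\<in>S. \<omega> \<in> A b (f b)) \<and> \<omega> \<in> A b0 l} \<le> e"
    and e: "e \<ge> 0"
  shows "\<bar>prob {\<omega> \<in> space M. \<forall>b\<in>S. \<omega> \<in> (\<Union>k<h. A b k)} - real h ^ card S * q\<bar> \<le>
      real h ^ card S * (\<epsilon> + real (card S) * real h * e + prob (space M - G))"
proof -
  let ?F = "S \<rightarrow>\<^sub>E {..<h}"
  define X where "X f = {\<omega> \<in> space M. \<forall>b\<in>S. \<omega> \<in> A b (f b)}" for f
  define Z where "Z f b l = {\<omega> \<in> G. (\<forall>b\<in>S. \<omega> \<in> A b (f b)) \<and> \<omega> \<in> A b l}" for f b l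
  define U where "U = {\<omega> \<in> space M. \<forall>b\<in>S. \<omega> \<in> (\<Union>k<h. A b k)}"
  have finF: "finite ?F" using S by (intro finite_PiE) auto
  have cardF: "real (card ?F) = real h ^ card S" using S by (subst card_PiE) (auto simp: prod_constant)
  have Xev: "X f \<in> events" for f
    unfolding X_def using S A by (intro sets.sets_Collect_finite_All) (auto simp: Int_def [symmetric] Collect_conj_eq intro: sets.Int)
  have GM: "G \<subseteq> space M" using G by (rule sets.sets_into_space)
  have Zeq: "Z f b l = G \<inter> X f \<inter> A b l" for f b l using GM by (auto simp: Z_def X_def)
  have Zev: "Z f b l \<in> events" if "b \<in> S" for f b l unfolding Zeq using that Xev G A by auto
  have UX: "U = (\<Union>f\<in>?F. X f)"
  proof (intro equalityI subsetI)
    fix \<omega> assume w: "\<omega> \<in> U"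
    then have "\<forall>b\<in>S. \<exists>k. k < h \<and> \<omega> \<in> A b k" by (auto simp: U_def)
    then obtain g where g: "\<forall>b\<in>S. g b < h \<and> \<omega> \<in> A b (g b)" by metis
    then have "restrict g S \<in> ?F" "\<omega> \<in> X (restrict g S)" using w by (auto simp: X_def U_def)
    then show "\<omega> \<in> (\<Union>f\<in>?F. X f)" by blast
  next
    fix \<omega> assume "\<omega> \<in> (\<Union>f\<in>?F. X f)"
    then show "\<omega> \<in> U" by (force simp: X_def U_def PiE_def Pi_def)
  qed
  have Uev: "U \<in> events" unfolding UX using finF Xev by auto
  have Xq: "prob (X f) \<le> q + \<epsilon>" "q - \<epsilon> \<le> prob (X f)" if "f \<in> ?F" for f
    using tuple [OF that] by (auto simp: X_def abs_le_iff)
  have "prob U \<le> (\<Sum>f\<in>?F. prob (X f))"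
    unfolding UX using finF Xev by (intro finite_measure_subadditive_finite) auto
  also have "\<dots> \<le> (\<Sum>f\<in>?F. q + \<epsilon>)" by (intro sum_mono Xq)
  finally have upper: "prob U \<le> real h ^ card S * (q + \<epsilon>)" by (simp add: cardF)
  let ?L = "\<lambda>f b. {l. l < h \<and> l \<noteq> f b}"
  have pw: "(\<Sum>f\<in>?F. indicator (G \<inter> X f) \<omega>) \<le>
     (indicator U \<omega> + (\<Sum>f\<in>?F. \<Sum>b\<in>S. \<Sum>l\<in>?L f b. indicator (Z f b l) \<omega>) :: real)" for \<omega>
  proof (cases "\<exists>f\<in>?F. \<exists>b\<in>S. \<exists>l\<in>?L f b. \<omega> \<in> Z f b l")
    case True
    then obtain f0 b l where fbl: "f0 \<in> ?F" "b \<in> S" "l < h" "l \<noteq> f0 b" "\<omega> \<in> Z f0 b l" by auto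
    have "indicator (G \<inter> X f) \<omega> \<le> (\<Sum>b\<in>S. \<Sum>l\<in>?L f b. indicator (Z f b l) \<omega> :: real)" if f: "f \<in> ?F" for f
    proof (cases "\<omega> \<in> G \<inter> X f")
      case True
      \<comment> \<open>Block b is hit both at l and at \<open>f0 b\<close>, and at least one of
        these differs from \<open>f b\<close>. So f has a double hit of its own.\<close>
      obtain l' where l': "l' \<in> ?L f b" "\<omega> \<in> A b l'"
      proof (cases "f b = l")
        case True
        have "f0 b < h" "\<omega> \<in> A b (f0 b)" using fbl by (auto simp: Z_def PiE_def Pi_def)
        then show ?thesis using that [of "f0 b"] True fbl by auto
      next
        case False
        then show ?thesis using that [of l] fbl by (auto simp: Z_def)
      qed
      have "indicator (Z f b l') \<omega> \<le> (\<Sum>l\<in>?L f b. indicator (Z f b l) \<omega> :: real)"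
        using l' by (intro member_le_sum) auto
      also have "\<dots> \<le> (\<Sum>b\<in>S. \<Sum>l\<in>?L f b. indicator (Z f b l) \<omega>)"
        using fbl S by (intro member_le_sum [of b S "\<lambda>b. \<Sum>l\<in>?L f b. indicator (Z f b l) \<omega>"]) (auto intro!: sum_nonneg)
      finally have "indicator (Z f b l') \<omega> \<le> (\<Sum>b\<in>S. \<Sum>l\<in>?L f b. indicator (Z f b l) \<omega> :: real)" .
      moreover have "\<omega> \<in> Z f b l'" using True l' by (auto simp: Zeq)
      ultimately show ?thesis using True by simp
    qed (auto intro!: sum_nonneg)
    then have "(\<Sum>f\<in>?F. indicator (G \<inter> X f) \<omega>) \<le> (\<Sum>f\<in>?F. \<Sum>b\<in>S. \<Sum>l\<in>?L f b. indicator (Z f b l) \<omega> :: real)"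
      by (rule sum_mono)
    then show ?thesis by (simp add: indicator_def)
  next
    case False
    have one: "f = g" if "f \<in> ?F" "g \<in> ?F" "\<omega> \<in> G \<inter> X f" "\<omega> \<in> G \<inter> X g" for f g
    proof (rule PiE_ext [OF that(1,2)])
      fix b assume b: "b \<in> S"
      show "f b = g b"
      proof (rule ccontr)
        assume ne: "f b \<noteq> g b"
        have "g b < h" "\<omega> \<in> A b (g b)" using that b by (auto simp: X_def PiE_def Pi_def)
        then have "g b \<in> ?L f b" "\<omega> \<in> Z f b (g b)" using ne that by (auto simp: Zeq)
        then show False using False that(1) b by blast
      qed
    qed
    show ?thesis
    proof (cases "\<exists>f\<in>?F. \<omega> \<in> G \<inter> X f")
      case True
      then obtain f where f: "f \<in> ?F" "\<omega> \<in> G \<inter> X f" by auto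
      have "(\<Sum>g\<in>?F. indicator (G \<inter> X g) \<omega>) = (\<Sum>g\<in>?F. if g = f then 1 else 0 :: real)"
        using one f by (intro sum.cong refl) (auto simp: indicator_def)
      also have "\<dots> = 1" using finF f by simp
      finally have "(\<Sum>g\<in>?F. indicator (G \<inter> X g) \<omega>) = (1 :: real)" .
      moreover have "\<omega> \<in> U" using f unfolding UX by auto
      ultimately show ?thesis by (simp add: sum_nonneg)
    next
      case False
      then have "(\<Sum>g\<in>?F. indicator (G \<inter> X g) \<omega>) = (0 :: real)" by (intro sum.neutral) auto
      then show ?thesis by (simp add: sum_nonneg)
    qed
  qed
  have ind: "integrable M (indicator B :: _ \<Rightarrow> real)" "expectation (indicator B) = prob B" if "B \<in> events" for B
    using that sets.sets_into_space [OF that] by (auto simp: emeasure_eq_measure Int_absorb2 intro!: integrable_real_indicator)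
  have indGX: "integrable M (indicator (G \<inter> X f) :: _ \<Rightarrow> real)" "expectation (indicator (G \<inter> X f)) = prob (G \<inter> X f)" for f
    using ind [of "G \<inter> X f"] Xev G by auto
  have "(\<Sum>f\<in>?F. prob (G \<inter> X f)) = expectation (\<lambda>\<omega>. \<Sum>f\<in>?F. indicator (G \<inter> X f) \<omega>)"
    by (subst Bochner_Integration.integral_sum) (use indGX in auto)
  also have "\<dots> \<le> expectation (\<lambda>\<omega>. indicator U \<omega> + (\<Sum>f\<in>?F. \<Sum>b\<in>S. \<Sum>l\<in>?L f b. indicator (Z f b l) \<omega>))"
    by (intro integral_mono Bochner_Integration.integrable_sum Bochner_Integration.integrable_add ind indGX Uev Zev pw)
  also have "\<dots> = prob U + (\<Sum>f\<in>?F. \<Sum>b\<in>S. \<Sum>l\<in>?L f b. prob (Z f b l))"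
    using ind Uev Zev
    by (subst Bochner_Integration.integral_add) (auto intro!: Bochner_Integration.integrable_sum sum.cong simp: Bochner_Integration.integral_sum Bochner_Integration.integrable_sum)
  also have "\<dots> \<le> prob U + (\<Sum>f\<in>?F. \<Sum>b\<in>S. \<Sum>l<h. e)"
  proof (intro add_left_mono sum_mono)
    fix f b assume fb: "f \<in> ?F" "b \<in> S"
    have "(\<Sum>l\<in>?L f b. prob (Z f b l)) \<le> (\<Sum>l\<in>?L f b. e)"
      unfolding Z_def using fb by (intro sum_mono double) auto
    also have "\<dots> \<le> (\<Sum>l<h. e)" using e by (intro sum_mono2) auto
    finally show "(\<Sum>l\<in>?L f b. prob (Z f b l)) \<le> (\<Sum>l<h. e)" .
  qed
  also have "\<dots> = prob U + real h ^ card S * (real (card S) * real h * e)"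
    by (simp add: cardF mult_ac)
  finally have 1: "(\<Sum>f\<in>?F. prob (G \<inter> X f)) \<le> prob U + real h ^ card S * (real (card S) * real h * e)" .
  have "(\<Sum>f\<in>?F. q - \<epsilon> - prob (space M - G)) \<le> (\<Sum>f\<in>?F. prob (G \<inter> X f))"
  proof (intro sum_mono)
    fix f assume f: "f \<in> ?F"
    have "prob (X f) \<le> prob ((G \<inter> X f) \<union> (space M - G))"
      using Xev G by (intro finite_measure_mono) (auto simp: X_def)
    also have "\<dots> \<le> prob (G \<inter> X f) + prob (space M - G)"
      using Xev G by (intro measure_Un_le) auto
    finally show "q - \<epsilon> - prob (space M - G) \<le> prob (G \<inter> X f)" using Xq(2) [OF f] by linarith
  qed
  then have "real h ^ card S * (q - \<epsilon> - prob (space M - G)) \<le> (\<Sum>f\<in>?F. prob (G \<inter> X f))"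
    by (simp add: cardF)
  with 1 have lower: "real h ^ card S * q \<le> prob U + real h ^ card S * (\<epsilon> + real (card S) * real h * e + prob (space M - G))"
    by (simp add: algebra_simps)
  have "real h ^ card S * \<epsilon> \<le> real h ^ card S * (\<epsilon> + real (card S) * real h * e + prob (space M - G))"
    using e by (intro mult_left_mono) auto
  then show ?thesis
    unfolding U_def [symmetric] abs_le_iff using lower upper by (auto simp: distrib_left)
qed

end

section \<open>Convergence of factorial moments\<close>

lemma choose_limit:
  assumes m: "filterlim m at_top sequentially" and \<mu>: "(\<lambda>n. real (m n) * x n) \<longlonglongrightarrow> \<mu>"
  shows "(\<lambda>n. real (m n choose j) * x n ^ j) \<longlonglongrightarrow> \<mu> ^ j / fact j"
proof -
  have rm: "filterlim (\<lambda>n. real (m n)) at_top sequentially"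
    by (rule filterlim_compose [OF filterlim_real_sequentially m])
  have "(\<lambda>n. (real (m n) * x n) / real (m n)) \<longlonglongrightarrow> 0"
    by (rule tendsto_divide_0 [OF \<mu>]) (rule filterlim_at_top_imp_at_infinity [OF rm])
  moreover have "eventually (\<lambda>n. real (m n) > 0) sequentially"
    using rm unfolding filterlim_at_top_dense by (rule spec)
  then have "eventually (\<lambda>n. (real (m n) * x n) / real (m n) = x n) sequentially"
    by eventually_elim simp
  ultimately have x0: "x \<longlonglongrightarrow> 0" by (rule Lim_transform_eventually)
  \<comment> \<open>Each factor m - i of the falling factorial takes one factor x; the corrections i
    x vanish because m x converges while m tends to infinity.\<close>
  have "(\<lambda>n. (\<Prod>i = 0..<j. real (m n) * x n - real i * x n) / fact j) \<longlonglongrightarrow> (\<Prod>i = 0..<j. \<mu> - real i * 0) / fact j"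
    by (intro tendsto_intros \<mu> x0) simp
  moreover have "real (m n choose j) * x n ^ j = (\<Prod>i = 0..<j. real (m n) * x n - real i * x n) / fact j" for n
  proof -
    have "real (m n choose j) = (\<Prod>i = 0..<j. real (m n) - real i) / fact j"
      by (simp add: binomial_gbinomial gbinomial_prod_rev)
    moreover have "(\<Prod>i = 0..<j. real (m n) * x n - real i * x n) = (\<Prod>i = 0..<j. real (m n) - real i) * x n ^ j"
      by (simp add: left_diff_distrib [symmetric] prod.distrib)
    ultimately show ?thesis by simp
  qed
  ultimately show ?thesis by simp
qed

text \<open>The truncation level is fixed first, close to the exponential series, and only then n is
  taken large. So T n j has to converge merely for each fixed j.\<close>

lemma alternating_sum_limit:
  fixes p :: "nat \<Rightarrow> real" and T :: "nat \<Rightarrow> nat \<Rightarrow> real"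
  assumes upper: "\<And>r n. p n \<le> (\<Sum>j\<le>2 * r. (- 1) ^ j * T n j)"
    and lower: "\<And>r n. (\<Sum>j\<le>2 * r + 1. (- 1) ^ j * T n j) \<le> p n"
    and T: "\<And>j. (\<lambda>n. T n j) \<longlonglongrightarrow> \<mu> ^ j / fact j"
  shows "p \<longlonglongrightarrow> exp (- \<mu>)"
proof (rule LIMSEQ_I)
  fix e :: real assume e: "e > 0"
  define s where "s k = (\<Sum>j\<le>k. (- 1) ^ j * (\<mu> ^ j / fact j))" for k
  have "(\<lambda>j. (- 1) ^ j * (\<mu> ^ j / fact j)) sums exp (- \<mu>)"
    using exp_converges [of "- \<mu>"] by (simp add: power_minus [of \<mu>] field_simps)
  then have "s \<longlonglongrightarrow> exp (- \<mu>)" unfolding s_def sums_def_le .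
  then obtain k0 where k0: "\<And>k. k \<ge> k0 \<Longrightarrow> \<bar>s k - exp (- \<mu>)\<bar> < e / 2"
    using LIMSEQ_D [OF \<open>s \<longlonglongrightarrow> exp (- \<mu>)\<close>, of "e / 2"] e by auto
  have lim: "(\<lambda>n. \<Sum>j\<le>k. (- 1) ^ j * T n j) \<longlonglongrightarrow> s k" for k
    unfolding s_def by (intro tendsto_intros T)
  have "eventually (\<lambda>n. \<bar>(\<Sum>j\<le>k. (- 1) ^ j * T n j) - s k\<bar> < e / 2) sequentially" for k
    using tendstoD [OF lim, of "e / 2" k] e by (simp add: dist_real_def)
  then have "eventually (\<lambda>n. \<bar>(\<Sum>j\<le>2 * k0. (- 1) ^ j * T n j) - s (2 * k0)\<bar> < e / 2 \<and>
      \<bar>(\<Sum>j\<le>2 * k0 + 1. (- 1) ^ j * T n j) - s (2 * k0 + 1)\<bar> < e / 2) sequentially"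
    by (intro eventually_conj)
  then obtain n0 where n0: "\<And>n. n \<ge> n0 \<Longrightarrow> \<bar>(\<Sum>j\<le>2 * k0. (- 1) ^ j * T n j) - s (2 * k0)\<bar> < e / 2 \<and>
      \<bar>(\<Sum>j\<le>2 * k0 + 1. (- 1) ^ j * T n j) - s (2 * k0 + 1)\<bar> < e / 2"
    by (auto simp: eventually_sequentially)
  have "\<bar>p n - exp (- \<mu>)\<bar> < e" if "n \<ge> n0" for n
    using n0 [OF that] k0 [of "2 * k0"] k0 [of "2 * k0 + 1"] upper [of n k0] lower [of n k0]
    by (simp only: abs_less_iff) linarith
  then show "\<exists>n0. \<forall>n\<ge>n0. norm (p n - exp (- \<mu>)) < e" by (auto simp: real_norm_def)
qed

text \<open>There are m blocks of h points, each hit with probability p, and (m h)^j bounds the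
  number of selections; hence the weights in the limit hypotheses, with one more factor h for the
  second hit. Truncated inclusion-exclusion uses finitely many j at a time, so the estimates may
  hold only eventually, with a threshold depending on j.\<close>

theorem (in prob_space) poisson_blocks:
  fixes A :: "nat \<Rightarrow> nat \<Rightarrow> nat \<Rightarrow> 'a set"
  assumes A: "\<And>n b k. A n b k \<in> events" and G: "\<And>n. G n \<in> events"
    and m: "filterlim m at_top sequentially" and \<mu>: "(\<lambda>n. real (m n) * (real (h n) * p n)) \<longlonglongrightarrow> \<mu>"
    and e: "\<And>j n. e j n \<ge> 0" and \<epsilon>: "\<And>j n. \<epsilon> j n \<ge> 0"
    and tuple: "\<And>j. eventually (\<lambda>n. \<forall>S\<subseteq>{..<m n}. card S = j \<longrightarrow> (\<forall>f\<in>S \<rightarrow>\<^sub>E {..<h n}.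
        \<bar>prob {\<omega> \<in> space M. \<forall>b\<in>S. \<omega> \<in> A n b (f b)} - p n ^ j\<bar> \<le> \<epsilon> j n)) sequentially"
    and double: "\<And>j. eventually (\<lambda>n. \<forall>S\<subseteq>{..<m n}. card S = j \<longrightarrow> (\<forall>f\<in>S \<rightarrow>\<^sub>E {..<h n}. \<forall>b0\<in>S. \<forall>l<h n. l \<noteq> f b0 \<longrightarrow>
        prob {\<omega> \<in> G n. (\<forall>b\<in>S. \<omega> \<in> A n b (f b)) \<and> \<omega> \<in> A n b0 l} \<le> e j n)) sequentially"
    and lim_\<epsilon>: "\<And>j. (\<lambda>n. real (m n * h n) ^ j * \<epsilon> j n) \<longlonglongrightarrow> 0"
    and lim_e: "\<And>j. (\<lambda>n. real (m n * h n) ^ j * (real (h n) * e j n)) \<longlonglongrightarrow> 0"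
    and lim_G: "\<And>j. (\<lambda>n. real (m n * h n) ^ j * prob (space M - G n)) \<longlonglongrightarrow> 0"
  shows "(\<lambda>n. prob {\<omega> \<in> space M. \<forall>b<m n. \<forall>k<h n. \<omega> \<notin> A n b k}) \<longlonglongrightarrow> exp (- \<mu>)"
proof -
  define E where "E n b = (\<Union>k<h n. A n b k)" for n b
  have E: "E n b \<in> events" for n b unfolding E_def using A by auto
  define T where "T n j = (\<Sum>S | S \<subseteq> {..<m n} \<and> card S = j. prob {\<omega> \<in> space M. \<forall>b\<in>S. \<omega> \<in> E n b})" for n j
  have cardS: "card {S. S \<subseteq> {..<m n} \<and> card S = j} = m n choose j" for n j
    using n_subsets [of "{..<m n}" j] by simp
  define err where "err j n = real (m n * h n) ^ j * \<epsilon> j n + real j * (real (m n * h n) ^ j * (real (h n) * e j n))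
      + real (m n * h n) ^ j * prob (space M - G n)" for j n
  have err0: "err j \<longlonglongrightarrow> 0" for j
    using tendsto_add [OF tendsto_add [OF lim_\<epsilon> [of j] tendsto_mult_left [OF lim_e [of j], where c = "real j"]] lim_G [of j]]
    unfolding err_def by simp
  have main: "eventually (\<lambda>n. \<bar>T n j - real (m n choose j) * (real (h n) * p n) ^ j\<bar> \<le> err j n) sequentially" for j
    using tuple [of j] double [of j]
  proof eventually_elim
    case (elim n)
    let ?r = "real (h n) ^ j * (\<epsilon> j n + real j * real (h n) * e j n + prob (space M - G n))"
    have one: "\<bar>prob {\<omega> \<in> space M. \<forall>b\<in>S. \<omega> \<in> E n b} - (real (h n) * p n) ^ j\<bar> \<le> ?r"
      if S: "S \<subseteq> {..<m n}" "card S = j" for S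
    proof -
      have "finite S" using S finite_subset by auto
      from block_intersection [OF this, where A = "A n" and G = "G n" and h = "h n" and q = "p n ^ j"
          and \<epsilon> = "\<epsilon> j n" and e = "e j n"] elim S e A G
      show ?thesis unfolding E_def by (auto simp: power_mult_distrib)
    qed
    have eq: "T n j - real (m n choose j) * (real (h n) * p n) ^ j =
      (\<Sum>S | S \<subseteq> {..<m n} \<and> card S = j. prob {\<omega> \<in> space M. \<forall>b\<in>S. \<omega> \<in> E n b} - (real (h n) * p n) ^ j)"
      unfolding T_def by (simp add: sum_subtractf cardS)
    have "\<bar>T n j - real (m n choose j) * (real (h n) * p n) ^ j\<bar> \<le> (\<Sum>S | S \<subseteq> {..<m n} \<and> card S = j. ?r)"
      unfolding eq by (rule order_trans [OF sum_abs]) (intro sum_mono one; simp)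
    also have "\<dots> = real (m n choose j) * ?r" by (simp add: cardS)
    also have "\<dots> \<le> real (m n) ^ j * ?r"
    proof (intro mult_right_mono)
      show "real (m n choose j) \<le> real (m n) ^ j"
        using binomial_le_pow2 binomial_maximum by (cases "j \<le> m n")
          (metis binomial_le_pow of_nat_le_iff of_nat_power, simp add: binomial_eq_0)
      show "0 \<le> ?r" using e \<epsilon> by (intro mult_nonneg_nonneg add_nonneg_nonneg) auto
    qed
    also have "\<dots> = err j n" by (simp add: err_def power_mult_distrib algebra_simps)
    finally show ?case .
  qed
  have T: "(\<lambda>n. T n j) \<longlonglongrightarrow> \<mu> ^ j / fact j" for j
  proof -
    have "(\<lambda>n. T n j - real (m n choose j) * (real (h n) * p n) ^ j) \<longlonglongrightarrow> 0"
      by (rule Lim_null_comparison [OF _ err0 [of j]]) (use main [of j] in simp)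
    from tendsto_add [OF this choose_limit [OF m \<mu>, of j]] show ?thesis by simp
  qed
  have "(\<lambda>n. prob {\<omega> \<in> space M. \<forall>b\<in>{..<m n}. \<omega> \<notin> E n b}) \<longlonglongrightarrow> exp (- \<mu>)"
  proof (rule alternating_sum_limit [OF _ _ T])
    show "prob {\<omega> \<in> space M. \<forall>b\<in>{..<m n}. \<omega> \<notin> E n b} \<le> (\<Sum>j\<le>2 * r. (- 1) ^ j * T n j)" for r n
      unfolding T_def by (rule bonferroni(1)) (auto intro: E)
    show "(\<Sum>j\<le>2 * r + 1. (- 1) ^ j * T n j) \<le> prob {\<omega> \<in> space M. \<forall>b\<in>{..<m n}. \<omega> \<notin> E n b}" for r n
      unfolding T_def by (rule bonferroni(2)) (auto intro: E)
  qed
  moreover have "{\<omega> \<in> space M. \<forall>b\<in>{..<m n}. \<omega> \<notin> E n b} = {\<omega> \<in> space M. \<forall>b<m n. \<forall>k<h n. \<omega> \<notin> A n b k}" for n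
    by (auto simp: E_def)
  ultimately show ?thesis by simp
qed

section \<open>The limiting intensity\<close>

lemma fst_borel_complex [measurable]: "(fst :: complex \<times> complex \<Rightarrow> complex) \<in> borel_measurable borel"
  and snd_borel_complex [measurable]: "(snd :: complex \<times> complex \<Rightarrow> complex) \<in> borel_measurable borel"
  by (intro borel_measurable_continuous_onI continuous_intros)+

section \<open>Change of scale in the first coordinate\<close>

lemma nn_integral_complex_scale:
  fixes f :: "complex \<Rightarrow> ennreal"
  assumes n: "n > 0" and [measurable]: "f \<in> borel_measurable borel"
  shows "(\<integral>\<^sup>+z. f (of_nat n * z) \<partial>lborel) = ennreal (1 / (real n)\<^sup>2) * (\<integral>\<^sup>+z. f z \<partial>lborel)"
proof -
  have "(\<integral>\<^sup>+z. f z \<partial>lborel) = (\<integral>\<^sup>+z. f z \<partial>density (distr lborel borel (\<lambda>x. 0 + real n *\<^sub>R x)) (\<lambda>_. ennreal (\<bar>real n\<bar> ^ DIM(complex))))"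
    by (subst lborel_affine [of "real n" 0]) (use n in auto)
  also have "\<dots> = (\<integral>\<^sup>+z. ennreal ((real n)\<^sup>2) * f (real n *\<^sub>R z) \<partial>lborel)"
    by (subst nn_integral_density, simp, simp, subst nn_integral_distr) simp_all
  also have "\<dots> = ennreal ((real n)\<^sup>2) * (\<integral>\<^sup>+z. f (of_nat n * z) \<partial>lborel)"
    by (subst nn_integral_cmult) (simp_all add: scaleR_conv_of_real)
  finally have "ennreal (1 / (real n)\<^sup>2) * (\<integral>\<^sup>+z. f z \<partial>lborel) =
     (ennreal (1 / (real n)\<^sup>2) * ennreal ((real n)\<^sup>2)) * (\<integral>\<^sup>+z. f (of_nat n * z) \<partial>lborel)"
    by (simp add: mult.assoc)
  also have "ennreal (1 / (real n)\<^sup>2) * ennreal ((real n)\<^sup>2) = 1"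
    using n by (simp flip: ennreal_mult')
  finally show ?thesis by simp
qed

lemma nn_integral_complex_pair:
  assumes [measurable]: "f \<in> borel_measurable (borel :: (complex \<times> complex) measure)"
  shows "(\<integral>\<^sup>+p. f p \<partial>lborel) = (\<integral>\<^sup>+w. \<integral>\<^sup>+y. f (y, w) \<partial>lborel \<partial>lborel)"
proof -
  have "sets (lborel \<Otimes>\<^sub>M lborel :: (complex \<times> complex) measure) = sets borel"
    by (simp only: lborel_prod sets_lborel)
  then have [measurable]: "f \<in> borel_measurable (lborel \<Otimes>\<^sub>M lborel)"
    using assms measurable_cong_sets by blast
  show ?thesis
    unfolding lborel_prod [symmetric] by (rule lborel_pair.nn_integral_snd [symmetric]) simp
qed

lemma nn_integral_pair_scale:
  assumes n: "n > 0" and [measurable]: "f \<in> borel_measurable (borel :: (complex \<times> complex) measure)"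
  shows "(\<integral>\<^sup>+p. f (of_nat n * fst p, snd p) \<partial>lborel) = ennreal (1 / (real n)\<^sup>2) * (\<integral>\<^sup>+p. f p \<partial>lborel)"
proof -
  have *: "(\<lambda>w. \<integral>\<^sup>+ y. f (y, w) \<partial>lborel) \<in> borel_measurable lborel"
    by (rule lborel.borel_measurable_nn_integral) (simp add: borel_prod case_prod_unfold)
  have m: "(\<lambda>p. f (of_nat n * fst p, snd p)) \<in> borel_measurable borel" by (simp add: borel_prod [symmetric])
  have "(\<integral>\<^sup>+p. f (of_nat n * fst p, snd p) \<partial>lborel) = (\<integral>\<^sup>+w. \<integral>\<^sup>+y. f (of_nat n * y, w) \<partial>lborel \<partial>lborel)"
    by (subst nn_integral_complex_pair [OF m]) simp
  also have "\<dots> = (\<integral>\<^sup>+w. ennreal (1 / (real n)\<^sup>2) * (\<integral>\<^sup>+y. f (y, w) \<partial>lborel) \<partial>lborel)"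
    by (intro nn_integral_cong nn_integral_complex_scale n) measurable
  also have "\<dots> = ennreal (1 / (real n)\<^sup>2) * (\<integral>\<^sup>+p. f p \<partial>lborel)"
    by (subst nn_integral_cmult [OF *], subst nn_integral_complex_pair) simp_all
  finally show ?thesis .
qed

text \<open>Moves the factor n from the random pair to the set, since it is the pair without this
  factor that has a standard Gaussian law.\<close>

definition rescale :: "nat \<Rightarrow> (complex \<times> complex) set \<Rightarrow> (complex \<times> complex) set" where
  "rescale n U = {(z, w). (of_nat n * z, w) \<in> U}"

lemma rescale_vimage: "rescale n U = (\<lambda>p. (of_nat n * fst p, snd p)) -` U"
  by (auto simp: rescale_def)

lemma indicator_rescale: "indicator (rescale n U) p = indicator U (of_nat n * fst p, snd p)"
  by (auto simp: rescale_vimage indicator_def)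

lemma open_rescale: "open U \<Longrightarrow> open (rescale n U)"
  unfolding rescale_vimage by (auto intro!: open_vimage continuous_intros)

lemma rescale_measurable [measurable]: "U \<in> sets borel \<Longrightarrow> rescale n U \<in> sets borel"
proof -
  have "(\<lambda>p :: complex \<times> complex. (of_nat n * fst p, snd p)) \<in> borel_measurable borel"
    by (intro borel_measurable_continuous_onI continuous_intros)
  then show "U \<in> sets borel \<Longrightarrow> rescale n U \<in> sets borel"
    unfolding rescale_vimage by (rule measurable_sets_borel)
qed

lemma bounded_rescale:
  assumes n: "n > 0" and U: "bounded U"
  shows "bounded (rescale n U)"
proof -
  obtain B where B: "\<And>p. p \<in> U \<Longrightarrow> norm p \<le> B" using U by (auto simp: bounded_iff)
  have "norm p \<le> B + B" if "p \<in> rescale n U" for p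
  proof -
    obtain z w where p: "p = (z, w)" by (cases p)
    have le: "norm (of_nat n * z, w) \<le> B" using B that by (auto simp: rescale_def p)
    have "real n * cmod z \<le> B" "cmod w \<le> B"
      using le norm_fst_le [of "of_nat n * z" w] norm_snd_le [of w "of_nat n * z"] by (auto simp: norm_mult)
    moreover have "cmod z \<le> real n * cmod z" using n by (simp add: mult_le_cancel_right1)
    moreover have "norm p \<le> cmod z + cmod w" unfolding p by (rule norm_Pair_le)
    ultimately show ?thesis by linarith
  qed
  then show ?thesis unfolding bounded_iff by blast
qed

lemma volume_rescale:
  assumes n: "n > 0" and [measurable]: "U \<in> sets borel"
  shows "measure lborel (rescale n U) = measure lborel U / (real n)\<^sup>2"
proof -
  have "emeasure lborel (rescale n U) = (\<integral>\<^sup>+p. indicator U (of_nat n * fst p, snd p) \<partial>lborel)"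
  proof -
    have "emeasure lborel (rescale n U) = (\<integral>\<^sup>+p. indicator (rescale n U) p \<partial>lborel)"
      using rescale_measurable [OF assms(2)] by simp
    then show ?thesis by (simp add: indicator_rescale)
  qed
  also have "\<dots> = ennreal (1 / (real n)\<^sup>2) * emeasure lborel U"
    by (subst nn_integral_pair_scale [OF n]) auto
  finally show ?thesis by (simp add: measure_def enn2real_mult)
qed

text \<open>\<open>intensity\<close> is the limit of \<open>n\<^sup>2\<close> times the law of \<open>(n P(x), P'(x) / deriv_sd n)\<close>: flat in the first
  coordinate, Gaussian in the second.\<close>

definition intensity :: "(complex \<times> complex) measure" where
  "intensity = density lborel (\<lambda>p. ennreal (exp (- (cmod (snd p))\<^sup>2) / pi\<^sup>2))"

lemma sets_intensity [measurable_cong, simp]: "sets intensity = sets borel"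
  by (simp add: intensity_def)

text \<open>After the substitution the Gaussian in the first coordinate becomes exp (- |y / n|^2),
  which is at most 1 and tends to 1. So \<open>intensity\<close> is both an upper bound for every n
  and the limit.\<close>

lemma emeasure_gaussian_measure_rescale:
  assumes n: "n > 0" and [measurable]: "U \<in> sets borel"
  shows "emeasure (gaussian_measure (1 / sqrt 2)) (rescale n U) = ennreal (1 / (real n)\<^sup>2) *
     (\<integral>\<^sup>+p. ennreal (exp (- (cmod (fst p) / real n)\<^sup>2)) * indicator U p \<partial>intensity)"
proof -
  let ?f = "\<lambda>p :: complex \<times> complex. ennreal (exp (- (cmod (snd p))\<^sup>2) / pi\<^sup>2) * (ennreal (exp (- (cmod (fst p) / real n)\<^sup>2)) * indicator U p)"
  have gd: "gaussian_density (1 / sqrt 2) p = exp (- (cmod (snd p))\<^sup>2) / pi\<^sup>2 * exp (- (cmod (fst p))\<^sup>2)" for p :: "complex \<times> complex"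
  proof -
    have "(sqrt (2 * pi) * (1 / sqrt 2)) ^ DIM(complex \<times> complex) = (sqrt pi) ^ 4"
      by (simp add: real_sqrt_mult)
    also have "\<dots> = pi\<^sup>2" by (simp add: power4_eq_xxxx power2_eq_square)
    finally show ?thesis
      by (subst normal_density_prod) (simp_all add: power_divide norm_prod_def flip: exp_add)
  qed
  have mf: "?f \<in> borel_measurable borel" by measurable
  have "emeasure (gaussian_measure (1 / sqrt 2)) (rescale n U) = (\<integral>\<^sup>+p. ?f (of_nat n * fst p, snd p) \<partial>lborel)"
    unfolding gaussian_measure_def using n
  proof -
    have pt: "ennreal (gaussian_density (1 / sqrt 2) p) = ennreal (exp (- (cmod (snd p))\<^sup>2) / pi\<^sup>2) * ennreal (exp (- (cmod (fst p))\<^sup>2))"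
      for p :: "complex \<times> complex"
      unfolding gd by (rule ennreal_mult') simp
    show "emeasure (density lborel (\<lambda>p. ennreal (gaussian_density (1 / sqrt 2) p))) (rescale n U) = (\<integral>\<^sup>+p. ?f (of_nat n * fst p, snd p) \<partial>lborel)"
      unfolding pt using rescale_measurable [OF assms(2)] n
      by (subst emeasure_density) (simp_all add: indicator_rescale norm_mult mult.assoc)
  qed
  also have "\<dots> = ennreal (1 / (real n)\<^sup>2) * (\<integral>\<^sup>+p. ?f p \<partial>lborel)"
    by (rule nn_integral_pair_scale [OF n mf])
  also have "(\<integral>\<^sup>+p. ?f p \<partial>lborel) = (\<integral>\<^sup>+p. ennreal (exp (- (cmod (fst p) / real n)\<^sup>2)) * indicator U p \<partial>intensity)"
    unfolding intensity_def by (rule nn_integral_density [symmetric]) measurable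
  finally show ?thesis .
qed

lemma gaussian_measure_rescale_le:
  assumes n: "n > 0" and [measurable]: "U \<in> sets borel" and fin: "emeasure intensity U < \<infinity>"
  shows "measure (gaussian_measure (1 / sqrt 2)) (rescale n U) \<le> measure intensity U / (real n)\<^sup>2"
proof -
  interpret G: prob_space "gaussian_measure (1 / sqrt 2) :: (complex \<times> complex) measure" by (rule prob_space_gaussian_measure) simp
  have "(\<integral>\<^sup>+p. ennreal (exp (- (cmod (fst p) / real n)\<^sup>2)) * indicator U p \<partial>intensity) \<le> (\<integral>\<^sup>+p. indicator U p \<partial>intensity)"
    by (intro nn_integral_mono) (auto simp: indicator_def)
  then have "emeasure (gaussian_measure (1 / sqrt 2)) (rescale n U) \<le> ennreal (1 / (real n)\<^sup>2) * emeasure intensity U"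
    unfolding emeasure_gaussian_measure_rescale [OF n assms(2)] by (intro mult_left_mono) auto
  also have "\<dots> = ennreal (measure intensity U / (real n)\<^sup>2)"
    using fin by (simp add: emeasure_eq_ennreal_measure less_top flip: ennreal_mult')
  finally show ?thesis by (simp add: G.emeasure_eq_measure)
qed

lemma gaussian_measure_rescale_limit:
  assumes [measurable]: "U \<in> sets borel" and fin: "emeasure intensity U < \<infinity>"
  shows "(\<lambda>n. (real n)\<^sup>2 * measure (gaussian_measure (1 / sqrt 2)) (rescale n U)) \<longlonglongrightarrow> measure intensity U"
proof -
  interpret G: prob_space "gaussian_measure (1 / sqrt 2) :: (complex \<times> complex) measure" by (rule prob_space_gaussian_measure) simp
  have lim: "(\<lambda>n. \<integral>\<^sup>+p. ennreal (exp (- (cmod (fst p) / real n)\<^sup>2)) * indicator U p \<partial>intensity) \<longlonglongrightarrow> (\<integral>\<^sup>+p. ennreal 1 * indicator U p \<partial>intensity)"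
  proof (rule nn_integral_dominated_convergence [where w = "indicator U"])
    show "AE p in intensity. (\<lambda>n. ennreal (exp (- (cmod (fst p) / real n)\<^sup>2)) * indicator U p) \<longlonglongrightarrow> ennreal 1 * indicator U p"
    proof (rule AE_I2)
      fix p :: "complex \<times> complex"
      have "(\<lambda>n. exp (- (cmod (fst p) / real n)\<^sup>2)) \<longlonglongrightarrow> exp (- 0\<^sup>2)"
        by (intro tendsto_intros lim_const_over_n)
      then have "(\<lambda>n. ennreal (exp (- (cmod (fst p) / real n)\<^sup>2))) \<longlonglongrightarrow> ennreal 1" by (intro tendsto_ennrealI) simp
      then show "(\<lambda>n. ennreal (exp (- (cmod (fst p) / real n)\<^sup>2)) * indicator U p) \<longlonglongrightarrow> ennreal 1 * indicator U p"
        by (cases "p \<in> U") auto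
    qed
    show "AE p in intensity. ennreal (exp (- (cmod (fst p) / real n)\<^sup>2)) * indicator U p \<le> indicator U p" for n
      by (intro AE_I2) (auto simp: indicator_def)
  qed (use fin assms(1) in simp_all)
  have "eventually (\<lambda>n. (\<integral>\<^sup>+p. ennreal (exp (- (cmod (fst p) / real n)\<^sup>2)) * indicator U p \<partial>intensity) =
      ennreal ((real n)\<^sup>2 * measure (gaussian_measure (1 / sqrt 2)) (rescale n U))) sequentially"
    using eventually_gt_at_top [of 0]
  proof eventually_elim
    case (elim n)
    have "ennreal ((real n)\<^sup>2) * emeasure (gaussian_measure (1 / sqrt 2)) (rescale n U) =
      (ennreal ((real n)\<^sup>2) * ennreal (1 / (real n)\<^sup>2)) * (\<integral>\<^sup>+p. ennreal (exp (- (cmod (fst p) / real n)\<^sup>2)) * indicator U p \<partial>intensity)"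
      unfolding emeasure_gaussian_measure_rescale [OF elim assms(1)] by (simp add: mult.assoc)
    also have "ennreal ((real n)\<^sup>2) * ennreal (1 / (real n)\<^sup>2) = 1" using elim by (simp flip: ennreal_mult')
    finally show ?case by (simp add: G.emeasure_eq_measure ennreal_mult')
  qed
  from Lim_transform_eventually [OF lim this]
  have "(\<lambda>n. ennreal ((real n)\<^sup>2 * measure (gaussian_measure (1 / sqrt 2)) (rescale n U))) \<longlonglongrightarrow> ennreal (measure intensity U)"
    using fin by (simp add: emeasure_eq_ennreal_measure less_top)
  then show ?thesis by (rule tendsto_ennrealD) auto
qed

text \<open>The width of the section is (t1 - t0) |Re w| and its vertical height is 2 \<tau> |w| /
  |Re w|. The factor |Re w| cancels, and what remains is the weight |w| behind E|Z|.\<close>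

lemma parallelogram_section:
  assumes w: "c < \<bar>Re w\<bar>" "cmod w < C" and c: "c > 0" and t: "t0 \<le> t1" and \<tau>: "\<tau> > 0"
  shows "emeasure lborel {y. (y, w) \<in> parallelogram t0 t1 c C \<tau>} = ennreal (2 * \<tau> * (t1 - t0) * cmod w)"
proof -
  define r where "r = Re w"
  have r: "r \<noteq> 0" using w c by (auto simp: r_def)
  have meas: "{y. (y, w) \<in> parallelogram t0 t1 c C \<tau>} \<in> sets borel"
  proof -
    have "open ((\<lambda>y. (y, w)) -` parallelogram t0 t1 c C \<tau>)"
      by (rule open_vimage [OF open_parallelogram]) (intro continuous_intros)
    then show ?thesis by (simp add: vimage_def)
  qed
  let ?A = "{a. t0 * r\<^sup>2 < - (a * r) \<and> - (a * r) < t1 * r\<^sup>2}"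
  have A: "?A = (if r > 0 then {- t1 * r<..<- t0 * r} else {- t0 * r<..<- t1 * r})"
  proof -
    have "t0 * r\<^sup>2 < - (a * r) \<longleftrightarrow> (t0 * r + a) * r < 0" "- (a * r) < t1 * r\<^sup>2 \<longleftrightarrow> 0 < (t1 * r + a) * r" for a
      by (auto simp: algebra_simps power2_eq_square)
    then show ?thesis using r by (auto simp: mult_less_0_iff zero_less_mult_iff)
  qed
  have emA: "emeasure lborel ?A = ennreal ((t1 - t0) * \<bar>r\<bar>)"
  proof (cases "r > 0")
    case True
    then have "t0 * r \<le> t1 * r" using t by simp
    then show ?thesis unfolding A using True by (simp add: algebra_simps)
  next
    case False
    then have "t1 * r \<le> t0 * r" using t by (intro mult_right_mono_neg) auto
    then show ?thesis unfolding A using False by (simp add: algebra_simps)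
  qed
  have "emeasure lborel {y. (y, w) \<in> parallelogram t0 t1 c C \<tau>} = (\<integral>\<^sup>+y. indicator {y. (y, w) \<in> parallelogram t0 t1 c C \<tau>} y \<partial>lborel)"
    using meas by simp
  also have "\<dots> = (\<integral>\<^sup>+a. \<integral>\<^sup>+b. indicator {y. (y, w) \<in> parallelogram t0 t1 c C \<tau>} (Complex a b) \<partial>lborel \<partial>lborel)"
    using meas by (intro nn_integral_complex) simp
  also have "\<dots> = (\<integral>\<^sup>+a. indicator ?A a * ennreal (2 * \<tau> * cmod w / \<bar>r\<bar>) \<partial>lborel)"
  proof (intro nn_integral_cong)
    fix a
    define m where "m = a * Im w / r"
    define H where "H = \<tau> * cmod w / \<bar>r\<bar>"
    have H: "H \<ge> 0" using \<tau> by (simp add: H_def)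
    have iff: "\<bar>a * Im w - b * r\<bar> < \<tau> * cmod w \<longleftrightarrow> b \<in> {m - H<..<m + H}" for b
    proof -
      have "a * Im w - b * r = (m - b) * r" using r by (simp add: m_def algebra_simps)
      then have "\<bar>a * Im w - b * r\<bar> < \<tau> * cmod w \<longleftrightarrow> \<bar>m - b\<bar> < H"
        using r by (simp add: abs_mult H_def pos_less_divide_eq)
      then show ?thesis by auto
    qed
    have "indicator {y. (y, w) \<in> parallelogram t0 t1 c C \<tau>} (Complex a b) = (indicator ?A a * indicator {m - H<..<m + H} b :: ennreal)" for b
      using w iff [of b] by (auto simp: parallelogram_def r_def [symmetric] indicator_def)
    then have "(\<integral>\<^sup>+b. indicator {y. (y, w) \<in> parallelogram t0 t1 c C \<tau>} (Complex a b) \<partial>lborel) = indicator ?A a * emeasure lborel {m - H<..<m + H}"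
      by (simp add: nn_integral_cmult)
    also have "emeasure lborel {m - H<..<m + H} = ennreal (2 * \<tau> * cmod w / \<bar>r\<bar>)"
      using H by simp (simp add: H_def)
    finally show "(\<integral>\<^sup>+b. indicator {y. (y, w) \<in> parallelogram t0 t1 c C \<tau>} (Complex a b) \<partial>lborel) = indicator ?A a * ennreal (2 * \<tau> * cmod w / \<bar>r\<bar>)" .
  qed
  also have "\<dots> = emeasure lborel ?A * ennreal (2 * \<tau> * cmod w / \<bar>r\<bar>)"
    by (subst nn_integral_multc) auto
  also have "\<dots> = ennreal (2 * \<tau> * (t1 - t0) * cmod w)"
    unfolding emA using r t \<tau> by (simp add: ennreal_mult' [symmetric])
  finally show ?thesis .
qed

definition core :: "real \<Rightarrow> real \<Rightarrow> complex set" where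
  "core c C = {w. c < \<bar>Re w\<bar> \<and> cmod w < C}"

lemma core_measurable [measurable]: "core c C \<in> sets borel"
proof -
  have "open (core c C)" unfolding core_def
    by (intro open_Collect_conj open_Collect_less continuous_intros)
  then show ?thesis by simp
qed

text \<open>The expectation of |Z| over the event that Z lies in \<open>core c C\<close>, for a
  standard complex Gaussian Z.\<close>

definition slope_integral :: "real \<Rightarrow> real \<Rightarrow> real" where
  "slope_integral c C = (\<integral>w. indicator (core c C) w * (cmod w * exp (- (cmod w)\<^sup>2) / pi) \<partial>lborel)"

text \<open>Instead of polar coordinates the layer-cake formula is used twice, once for |w| and once
  for exp (- |w|^2). This leaves areas of annuli and the fourth moment of a one-dimensional
  Gaussian.\<close>

lemma nn_integral_norm_gauss:
  "(\<integral>\<^sup>+w. ennreal (cmod w * exp (- (cmod w)\<^sup>2) / pi) \<partial>lborel) = ennreal (sqrt pi / 2)"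
proof -
  have ball: "emeasure lborel (ball (0::complex) r) = ennreal (pi * r\<^sup>2)" if "r \<ge> 0" for r
    using that by (simp add: emeasure_ball eval_unit_ball_vol)
  have m1: "(\<lambda>(w :: complex, t). indicator {x. 0 < snd x \<and> snd x \<le> cmod (fst x) \<and> cmod (fst x) < r} (w, t) :: ennreal) \<in> borel_measurable (borel \<Otimes>\<^sub>M borel)" for r :: real
    by measurable
  have inner: "(\<integral>\<^sup>+w. ennreal (cmod w) * indicator (ball 0 r) w \<partial>lborel) = ennreal (2 * pi / 3 * r ^ 3)" if r: "r > 0" for r
  proof -
    have "(\<integral>\<^sup>+w. ennreal (cmod w) * indicator (ball (0::complex) r) w \<partial>lborel) =
      (\<integral>\<^sup>+w. \<integral>\<^sup>+t. indicator {x. 0 < snd x \<and> snd x \<le> cmod (fst x) \<and> cmod (fst x) < r} (w, t) \<partial>lborel \<partial>lborel)"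
    proof (intro nn_integral_cong)
      fix w :: complex
      have "(\<integral>\<^sup>+t. indicator {x. 0 < snd x \<and> snd x \<le> cmod (fst x) \<and> cmod (fst x) < r} (w, t) \<partial>lborel) =
         (\<integral>\<^sup>+t. indicator (ball 0 r) w * indicator {0<..cmod w} t \<partial>lborel)"
        by (intro nn_integral_cong) (auto simp: indicator_def)
      also have "\<dots> = ennreal (cmod w) * indicator (ball 0 r) w"
        by (subst nn_integral_cmult) (auto simp: mult.commute)
      finally show "ennreal (cmod w) * indicator (ball 0 r) w = (\<integral>\<^sup>+t. indicator {x. 0 < snd x \<and> snd x \<le> cmod (fst x) \<and> cmod (fst x) < r} (w, t) \<partial>lborel)" ..
    qed
    also have "\<dots> = (\<integral>\<^sup>+t. \<integral>\<^sup>+w. indicator {x. 0 < snd x \<and> snd x \<le> cmod (fst x) \<and> cmod (fst x) < r} (w, t) \<partial>lborel \<partial>lborel)"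
      using m1 by (intro lborel_pair.Fubini') (simp add: case_prod_unfold)
    also have "\<dots> = (\<integral>\<^sup>+t. ennreal (pi * (r\<^sup>2 - t\<^sup>2)) * indicator {0..r} t \<partial>lborel)"
    proof (rule nn_integral_cong_AE)
      \<comment> \<open>The single value t = 0 is excluded: there the left side is 0 and the right
        side is not.\<close>
      have nz: "(\<integral>\<^sup>+w. indicator {x. 0 < snd x \<and> snd x \<le> cmod (fst x) \<and> cmod (fst x) < r} (w, t) \<partial>lborel) = ennreal (pi * (r\<^sup>2 - t\<^sup>2)) * indicator {0..r} t"
        if "t \<noteq> 0" for t
      proof (cases "0 < t \<and> t \<le> r")
        case True
        have "(\<integral>\<^sup>+w. indicator {x. 0 < snd x \<and> snd x \<le> cmod (fst x) \<and> cmod (fst x) < r} (w :: complex, t) \<partial>lborel) =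
          (\<integral>\<^sup>+w. indicator (ball (0::complex) r - ball 0 t) w \<partial>lborel)"
          using True by (intro nn_integral_cong) (auto simp: indicator_def)
        also have "\<dots> = emeasure lborel (ball (0::complex) r) - emeasure lborel (ball (0::complex) t)"
          using True by (subst nn_integral_indicator, simp, subst emeasure_Diff) (auto simp: emeasure_ball)
        also have "\<dots> = ennreal (pi * (r\<^sup>2 - t\<^sup>2))"
          using True r by (simp add: ball ennreal_minus right_diff_distrib)
        finally show ?thesis using True by simp
      next
        case False
        then have "indicator {x. 0 < snd x \<and> snd x \<le> cmod (fst x) \<and> cmod (fst x) < r} (w :: complex, t) = (0 :: ennreal)" for w
          by (auto simp: indicator_def)
        moreover have "indicator {0..r} t = (0 :: ennreal)" using False that by (auto simp: indicator_def)
        ultimately show ?thesis by (simp only: nn_integral_const mult_zero_left mult_zero_right)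
      qed
      show "AE t in lborel. (\<integral>\<^sup>+w. indicator {x. 0 < snd x \<and> snd x \<le> cmod (fst x) \<and> cmod (fst x) < r} (w :: complex, t) \<partial>lborel) = ennreal (pi * (r\<^sup>2 - t\<^sup>2)) * indicator {0..r} t"
        by (rule AE_mp [OF AE_lborel_singleton [of 0] AE_I2]) (use nz in blast)
    qed
    also have "\<dots> = ennreal ((pi * (r\<^sup>2 * r - r ^ 3 / 3)) - (pi * (r\<^sup>2 * 0 - 0 ^ 3 / 3)))"
    proof (rule nn_integral_FTC_Icc [where F = "\<lambda>t. pi * (r\<^sup>2 * t - t ^ 3 / 3)" and f = "\<lambda>t. pi * (r\<^sup>2 - t\<^sup>2)"])
      fix t assume t: "t \<in> {0..r}"
      show "((\<lambda>t. pi * (r\<^sup>2 * t - t ^ 3 / 3)) has_field_derivative pi * (r\<^sup>2 - t\<^sup>2)) (at t)"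
        by (auto intro!: derivative_eq_intros simp: power2_eq_square)
      show "0 \<le> pi * (r\<^sup>2 - t\<^sup>2)" using t by (auto intro!: mult_nonneg_nonneg power_mono)
    qed (use r in auto)
    also have "pi * (r\<^sup>2 * r - r ^ 3 / 3) - pi * (r\<^sup>2 * 0 - 0 ^ 3 / 3) = 2 * pi / 3 * r ^ 3"
      by (simp add: power2_eq_square power3_eq_cube algebra_simps)
    finally show ?thesis .
  qed
  have layer: "ennreal (exp (- (cmod w)\<^sup>2)) = (\<integral>\<^sup>+r. ennreal (2 * r * exp (- r\<^sup>2)) * indicator {cmod w<..} r \<partial>lborel)" for w :: complex
  proof -
    have "(\<integral>\<^sup>+r. ennreal (2 * r * exp (- r\<^sup>2)) * indicator {cmod w..} r \<partial>lborel) = ennreal (0 - (- exp (- (cmod w)\<^sup>2)))"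
    proof (rule nn_integral_FTC_atLeast)
      fix r assume r: "cmod w \<le> r"
      show "((\<lambda>r. - exp (- r\<^sup>2)) has_field_derivative 2 * r * exp (- r\<^sup>2)) (at r)"
        by (auto intro!: derivative_eq_intros)
      show "0 \<le> 2 * r * exp (- r\<^sup>2)" using r norm_ge_zero [of w] by (auto simp del: norm_ge_zero)
    next
      show "((\<lambda>r. - exp (- r\<^sup>2)) \<longlongrightarrow> (0::real)) at_top"
        by real_asymp
    qed measurable
    moreover have "(\<integral>\<^sup>+r. ennreal (2 * r * exp (- r\<^sup>2)) * indicator {cmod w<..} r \<partial>lborel) = (\<integral>\<^sup>+r. ennreal (2 * r * exp (- r\<^sup>2)) * indicator {cmod w..} r \<partial>lborel)"
      by (rule nn_integral_cong_AE) (use AE_lborel_singleton [of "cmod w"] in eventually_elim, auto simp: indicator_def)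
    ultimately show ?thesis by simp
  qed
  have "(\<integral>\<^sup>+w. ennreal (cmod w * exp (- (cmod w)\<^sup>2) / pi) \<partial>lborel) =
    (\<integral>\<^sup>+w. \<integral>\<^sup>+r. ennreal (1 / pi) * ennreal (cmod w) * (ennreal (2 * r * exp (- r\<^sup>2)) * indicator {x. cmod (fst x) < snd x} (w, r)) \<partial>lborel \<partial>lborel)"
  proof (intro nn_integral_cong)
    fix w :: complex
    have i: "indicator {x. cmod (fst x) < snd x} (w, r) = (indicator {cmod w<..} r :: ennreal)" for r by (auto simp: indicator_def)
    have "ennreal (cmod w * exp (- (cmod w)\<^sup>2) / pi) = ennreal (1 / pi) * ennreal (cmod w) * ennreal (exp (- (cmod w)\<^sup>2))"
      by (simp flip: ennreal_mult')
    then show "ennreal (cmod w * exp (- (cmod w)\<^sup>2) / pi) = (\<integral>\<^sup>+r. ennreal (1 / pi) * ennreal (cmod w) * (ennreal (2 * r * exp (- r\<^sup>2)) * indicator {x. cmod (fst x) < snd x} (w, r)) \<partial>lborel)"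
      unfolding i layer by (subst nn_integral_cmult) auto
  qed
  also have "\<dots> = (\<integral>\<^sup>+r. \<integral>\<^sup>+w. ennreal (1 / pi) * ennreal (cmod w) * (ennreal (2 * r * exp (- r\<^sup>2)) * indicator {x. cmod (fst x) < snd x} (w, r)) \<partial>lborel \<partial>lborel)"
    by (rule lborel_pair.Fubini') (simp add: case_prod_unfold)
  also have "\<dots> = (\<integral>\<^sup>+r. ennreal (indicator {0..} r *\<^sub>R (4 / 3 * (exp (- r\<^sup>2) * r ^ (2 * 2)))) \<partial>lborel)"
  proof (intro nn_integral_cong)
    fix r :: real
    show "(\<integral>\<^sup>+w. ennreal (1 / pi) * ennreal (cmod w) * (ennreal (2 * r * exp (- r\<^sup>2)) * indicator {x. cmod (fst x) < snd x} (w, r)) \<partial>lborel) =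
      ennreal (indicator {0..} r *\<^sub>R (4 / 3 * (exp (- r\<^sup>2) * r ^ (2 * 2))))"
    proof (cases "r > 0")
      case True
      have "(\<integral>\<^sup>+w. ennreal (1 / pi) * ennreal (cmod w) * (ennreal (2 * r * exp (- r\<^sup>2)) * indicator {x. cmod (fst x) < snd x} (w, r)) \<partial>lborel) =
        (\<integral>\<^sup>+w. ennreal (1 / pi) * ennreal (2 * r * exp (- r\<^sup>2)) * (ennreal (cmod w) * indicator (ball 0 r) w) \<partial>lborel)"
        by (intro nn_integral_cong) (auto simp: indicator_def mult_ac)
      also have "\<dots> = ennreal (1 / pi) * ennreal (2 * r * exp (- r\<^sup>2)) * ennreal (2 * pi / 3 * r ^ 3)"
      proof -
        have "(\<lambda>w :: complex. ennreal (cmod w) * indicator (ball 0 r) w) \<in> borel_measurable lborel"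
          by (intro borel_measurable_times_ennreal borel_measurable_indicator) auto
        from nn_integral_cmult [OF this] show ?thesis by (simp only: inner [OF True])
      qed
      also have "\<dots> = ennreal (1 / pi * (2 * r * exp (- r\<^sup>2)) * (2 * pi / 3 * r ^ 3))"
        using True by (simp only: ennreal_mult' [symmetric] mult_nonneg_nonneg divide_nonneg_nonneg pi_ge_zero zero_le_numeral zero_le_one exp_ge_zero less_imp_le zero_le_power)
      also have "1 / pi * (2 * r * exp (- r\<^sup>2)) * (2 * pi / 3 * r ^ 3) = indicator {0..} r *\<^sub>R (4 / 3 * (exp (- r\<^sup>2) * r ^ (2 * 2)))"
        using True by (simp add: field_simps eval_nat_numeral)
      finally show ?thesis .
    next
      case False
      then have "indicator {x. cmod (fst x) < snd x} (w, r) = (0 :: ennreal)" for w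
        using norm_ge_zero [of w] by (auto simp: indicator_def simp del: norm_ge_zero)
      then show ?thesis using False by (auto simp: indicator_def)
    qed
  qed
  \<comment> \<open>Half of a Gaussian fourth moment: 2 r / pi from the layers times 2 pi r^3 / 3
    from the disc.\<close>
  also have "\<dots> = ennreal (4 / 3 * (sqrt pi / 2 * (fact (2 * 2) / (2 ^ (2 * 2) * fact 2))))"
  proof -
    have "has_bochner_integral lborel (\<lambda>r::real. 4 / 3 * (indicator {0..} r *\<^sub>R (exp (- r\<^sup>2) * r ^ (2 * 2)))) (4 / 3 * (sqrt pi / 2 * (fact (2 * 2) / (2 ^ (2 * 2) * fact 2))))"
      by (intro has_bochner_integral_mult_right) (rule gaussian_moment_even_pos)
    then have hb: "has_bochner_integral lborel (\<lambda>r::real. indicator {0..} r *\<^sub>R (4 / 3 * (exp (- r\<^sup>2) * r ^ (2 * 2)))) (4 / 3 * (sqrt pi / 2 * (fact (2 * 2) / (2 ^ (2 * 2) * fact 2))))"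
      by (simp only: mult_scaleR_right)
    show ?thesis
      by (subst nn_integral_eq_integral)
         (use hb in \<open>auto simp: has_bochner_integral_iff indicator_def\<close>)
  qed
  also have "4 / 3 * (sqrt pi / 2 * (fact (2 * 2) / (2 ^ (2 * 2) * fact 2))) = sqrt pi / 2"
    by (simp add: fact_numeral)
  finally show ?thesis .
qed

lemma integrable_norm_gauss: "integrable lborel (\<lambda>w :: complex. cmod w * exp (- (cmod w)\<^sup>2) / pi)"
  and integral_norm_gauss: "(\<integral>w. cmod w * exp (- (cmod w)\<^sup>2) / pi \<partial>lborel) = sqrt pi / 2"
proof -
  have "has_bochner_integral lborel (\<lambda>w :: complex. cmod w * exp (- (cmod w)\<^sup>2) / pi) (sqrt pi / 2)"
    by (rule has_bochner_integral_nn_integral) (simp_all add: nn_integral_norm_gauss)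
  then show "integrable lborel (\<lambda>w :: complex. cmod w * exp (- (cmod w)\<^sup>2) / pi)"
    "(\<integral>w. cmod w * exp (- (cmod w)\<^sup>2) / pi \<partial>lborel) = sqrt pi / 2"
    by (simp_all add: has_bochner_integral_iff)
qed

lemma slope_integral_nonneg: "slope_integral c C \<ge> 0"
  unfolding slope_integral_def by (intro Bochner_Integration.integral_nonneg) simp

text \<open>Fubini over the slope: the area 2 \<tau> (t1 - t0) |w| of a section is integrated
  against exp (- |w|^2) / pi^2.\<close>

lemma emeasure_parallelogram:
  assumes c: "c > 0" and t: "t0 \<le> t1" and \<tau>: "\<tau> > 0"
  shows "emeasure intensity (parallelogram t0 t1 c C \<tau>) = ennreal (2 * \<tau> * (t1 - t0) / pi * slope_integral c C)"
proof -
  let ?B = "parallelogram t0 t1 c C \<tau>"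
  have [measurable]: "?B \<in> sets borel" using open_parallelogram by auto
  have m: "(\<lambda>p. ennreal (exp (- (cmod (snd p))\<^sup>2) / pi\<^sup>2) * indicator ?B p) \<in> borel_measurable borel"
    by measurable
  have "emeasure intensity ?B = (\<integral>\<^sup>+p. ennreal (exp (- (cmod (snd p))\<^sup>2) / pi\<^sup>2) * indicator ?B p \<partial>lborel)"
    unfolding intensity_def by (rule emeasure_density) measurable
  also have "\<dots> = (\<integral>\<^sup>+w. \<integral>\<^sup>+y. ennreal (exp (- (cmod w)\<^sup>2) / pi\<^sup>2) * indicator ?B (y, w) \<partial>lborel \<partial>lborel)"
    by (subst nn_integral_complex_pair [OF m]) simp
  also have "\<dots> = (\<integral>\<^sup>+w. ennreal (2 * \<tau> * (t1 - t0) / pi) * ennreal (indicator (core c C) w * (cmod w * exp (- (cmod w)\<^sup>2) / pi)) \<partial>lborel)"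
  proof (intro nn_integral_cong)
    fix w
    have sec: "{y. (y, w) \<in> ?B} \<in> sets borel"
    proof -
      have "open ((\<lambda>y. (y, w)) -` ?B)"
        by (rule open_vimage [OF open_parallelogram]) (intro continuous_intros)
      then show ?thesis by (simp add: vimage_def)
    qed
    have "(\<integral>\<^sup>+y. ennreal (exp (- (cmod w)\<^sup>2) / pi\<^sup>2) * indicator ?B (y, w) \<partial>lborel) =
        (\<integral>\<^sup>+y. ennreal (exp (- (cmod w)\<^sup>2) / pi\<^sup>2) * indicator {y. (y, w) \<in> ?B} y \<partial>lborel)"
      by (intro nn_integral_cong) (simp add: indicator_def)
    also have "\<dots> = ennreal (exp (- (cmod w)\<^sup>2) / pi\<^sup>2) * emeasure lborel {y. (y, w) \<in> ?B}"
      using sec by (simp add: nn_integral_cmult)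
    also have "\<dots> = ennreal (2 * \<tau> * (t1 - t0) / pi) * ennreal (indicator (core c C) w * (cmod w * exp (- (cmod w)\<^sup>2) / pi))"
    proof (cases "w \<in> core c C")
      case True
      then have "emeasure lborel {y. (y, w) \<in> ?B} = ennreal (2 * \<tau> * (t1 - t0) * cmod w)"
        by (intro parallelogram_section c t \<tau>) (auto simp: core_def)
      then show ?thesis using True t \<tau>
        by (simp add: ennreal_mult' [symmetric] power2_eq_square mult_ac)
    next
      case False
      then have "{y. (y, w) \<in> ?B} = {}" by (auto simp: core_def parallelogram_def)
      then show ?thesis using False by simp
    qed
    finally show "(\<integral>\<^sup>+y. ennreal (exp (- (cmod w)\<^sup>2) / pi\<^sup>2) * indicator ?B (y, w) \<partial>lborel) =
      ennreal (2 * \<tau> * (t1 - t0) / pi) * ennreal (indicator (core c C) w * (cmod w * exp (- (cmod w)\<^sup>2) / pi))" .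
  qed
  also have "\<dots> = ennreal (2 * \<tau> * (t1 - t0) / pi) * (\<integral>\<^sup>+w. ennreal (indicator (core c C) w * (cmod w * exp (- (cmod w)\<^sup>2) / pi)) \<partial>lborel)"
    by (rule nn_integral_cmult) measurable
  also have "(\<integral>\<^sup>+w. ennreal (indicator (core c C) w * (cmod w * exp (- (cmod w)\<^sup>2) / pi)) \<partial>lborel) = ennreal (slope_integral c C)"
    unfolding slope_integral_def
  proof (rule nn_integral_eq_integral)
    show "integrable lborel (\<lambda>w. indicator (core c C) w * (cmod w * exp (- (cmod w)\<^sup>2) / pi))"
      by (rule Bochner_Integration.integrable_bound [OF integrable_norm_gauss]) (auto simp: indicator_def)
  qed auto
  finally show ?thesis using t \<tau> slope_integral_nonneg [of c C] by (simp flip: ennreal_mult')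
qed

lemma AE_Re_nonzero: "AE w in (lborel :: complex measure). Re w \<noteq> 0"
proof (rule AE_I')
  have [measurable]: "{w :: complex. Re w = 0} \<in> sets borel"
    by (intro borel_closed closed_Collect_eq continuous_intros)
  have "emeasure lborel {w :: complex. Re w = 0} = (\<integral>\<^sup>+w. indicator {w :: complex. Re w = 0} w \<partial>lborel)" by simp
  also have "\<dots> = (\<integral>\<^sup>+a. \<integral>\<^sup>+b. indicator {w :: complex. Re w = 0} (Complex a b) \<partial>lborel \<partial>lborel)"
    by (rule nn_integral_complex) simp
  also have "\<dots> = (\<integral>\<^sup>+a. \<integral>\<^sup>+b. indicator {0::real} a \<partial>(lborel :: real measure) \<partial>lborel)"
    by (intro nn_integral_cong) (auto simp: indicator_def)
  also have "\<dots> = (\<integral>\<^sup>+a. \<infinity> * indicator {0::real} a \<partial>(lborel :: real measure))"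
    by (intro nn_integral_cong) (simp add: mult.commute)
  also have "\<dots> = 0" by (subst nn_integral_cmult) auto
  finally show "{w :: complex. Re w = 0} \<in> null_sets lborel" by (simp add: null_sets_def)
  show "{w \<in> space lborel. \<not> Re w \<noteq> 0} \<subseteq> {w. Re w = 0}" by auto
qed

text \<open>The cores exhaust the plane except for the null line Re w = 0.\<close>

lemma core_limit:
  "AE w in lborel. (\<lambda>i. indicator (core (1 / real (Suc i)) (real (Suc i))) w :: real) \<longlonglongrightarrow> 1"
  using AE_Re_nonzero
proof eventually_elim
  case (elim w)
  obtain i0 where i0: "max (1 / \<bar>Re w\<bar>) (cmod w) < real i0" using reals_Archimedean2 by blast
  have "indicator (core (1 / real (Suc i)) (real (Suc i))) w = (1 :: real)" if "i \<ge> i0" for i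
  proof -
    have "1 / \<bar>Re w\<bar> < real (Suc i)" "cmod w < real (Suc i)" using i0 that by auto
    then show ?thesis using elim by (auto simp: core_def indicator_def field_simps)
  qed
  then have "eventually (\<lambda>i. indicator (core (1 / real (Suc i)) (real (Suc i))) w = (1 :: real)) sequentially"
    by (auto simp: eventually_sequentially)
  then show ?case by (rule tendsto_eventually)
qed

lemma slope_integral_limit: "(\<lambda>i. slope_integral (1 / real (Suc i)) (real (Suc i))) \<longlonglongrightarrow> sqrt pi / 2"
  unfolding slope_integral_def integral_norm_gauss [symmetric]
proof (rule integral_dominated_convergence [OF _ _ integrable_norm_gauss])
  show "AE w in lborel. (\<lambda>i. indicator (core (1 / real (Suc i)) (real (Suc i))) w * (cmod w * exp (- (cmod w)\<^sup>2) / pi)) \<longlonglongrightarrow> cmod w * exp (- (cmod w)\<^sup>2) / pi"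
    using core_limit
  proof eventually_elim
    case (elim w)
    from tendsto_mult_right [OF this, of "cmod w * exp (- (cmod w)\<^sup>2) / pi"] show ?case by simp
  qed
qed (auto simp: indicator_def)

text \<open>The weight (\<tau> + |w|)^2 comes from discs covering a section of the strip. Up to a
  factor l + 1 this bounds the intensity of the strip over slopes outside
  \<open>core c C\<close>.\<close>

definition tail_integral :: "real \<Rightarrow> real \<Rightarrow> real \<Rightarrow> real" where
  "tail_integral \<tau> c C = (\<integral>w. (1 - indicator (core c C) w) * ((\<tau> + cmod w)\<^sup>2 * exp (- (cmod w)\<^sup>2) / pi) \<partial>lborel)"

text \<open>Half of the exponent absorbs the quadratic factor.\<close>

lemma integrable_square_gauss:
  "integrable lborel (\<lambda>w :: complex. (\<tau> + cmod w)\<^sup>2 * exp (- (cmod w)\<^sup>2) / pi)"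
proof (rule Bochner_Integration.integrable_bound)
  have "integrable lborel (\<lambda>w :: complex. exp (- (1 / 2 * (cmod w)\<^sup>2)))"
    using nn_integral_exp_norm [of "1 / 2", where 'e = complex] by (intro integrableI_nonneg) auto
  then show "integrable lborel (\<lambda>w :: complex. (2 * \<tau>\<^sup>2 + 4) / pi * exp (- (1 / 2 * (cmod w)\<^sup>2)))"
    by (rule integrable_mult_right)
  show "AE w in lborel. norm ((\<tau> + cmod w)\<^sup>2 * exp (- (cmod w)\<^sup>2) / pi) \<le> norm ((2 * \<tau>\<^sup>2 + 4) / pi * exp (- (1 / 2 * (cmod w)\<^sup>2)))"
  proof (rule AE_I2)
    fix w :: complex
    define x where "x = (cmod w)\<^sup>2"
    have x: "x \<ge> 0" by (simp add: x_def)
    have "(\<tau> + cmod w)\<^sup>2 \<le> 2 * \<tau>\<^sup>2 + 2 * x"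
      using sum_squares_bound [of \<tau> "cmod w"] by (simp add: x_def power2_sum)
    also have "\<dots> \<le> 2 * \<tau>\<^sup>2 * exp (x / 2) + 4 * exp (x / 2)"
    proof (rule add_mono)
      show "2 * \<tau>\<^sup>2 \<le> 2 * \<tau>\<^sup>2 * exp (x / 2)" using x by (simp add: mult_le_cancel_left1)
      show "2 * x \<le> 4 * exp (x / 2)" using exp_ge_add_one_self [of "x / 2"] by linarith
    qed
    finally have "(\<tau> + cmod w)\<^sup>2 * exp (- x) \<le> ((2 * \<tau>\<^sup>2 + 4) * exp (x / 2)) * exp (- x)"
      by (intro mult_right_mono) (auto simp: algebra_simps)
    also have "\<dots> = (2 * \<tau>\<^sup>2 + 4) * exp (- (1 / 2 * x))"
      by (simp add: mult.assoc flip: exp_add)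
    finally have "(\<tau> + cmod w)\<^sup>2 * exp (- x) / pi \<le> (2 * \<tau>\<^sup>2 + 4) * exp (- (1 / 2 * x)) / pi"
      by (intro divide_right_mono) auto
    then show "norm ((\<tau> + cmod w)\<^sup>2 * exp (- (cmod w)\<^sup>2) / pi) \<le> norm ((2 * \<tau>\<^sup>2 + 4) / pi * exp (- (1 / 2 * (cmod w)\<^sup>2)))"
      by (simp add: x_def abs_mult)
  qed
qed measurable

lemma tail_integral_limit: "(\<lambda>i. tail_integral \<tau> (1 / real (Suc i)) (real (Suc i))) \<longlonglongrightarrow> 0"
proof -
  have "(\<lambda>i. tail_integral \<tau> (1 / real (Suc i)) (real (Suc i))) \<longlonglongrightarrow> (\<integral>w. (0 :: real) \<partial>(lborel :: complex measure))"
    unfolding tail_integral_def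
  proof (rule integral_dominated_convergence [OF _ _ integrable_square_gauss])
    show "AE w in lborel. (\<lambda>i. (1 - indicator (core (1 / real (Suc i)) (real (Suc i))) w) * ((\<tau> + cmod w)\<^sup>2 * exp (- (cmod w)\<^sup>2) / pi)) \<longlonglongrightarrow> 0"
      using core_limit
    proof eventually_elim
      case (elim w)
      from tendsto_mult_right [OF tendsto_diff [OF tendsto_const this], of 1 "(\<tau> + cmod w)\<^sup>2 * exp (- (cmod w)\<^sup>2) / pi"]
      show ?case by simp
    qed
  qed (auto simp: indicator_def)
  then show ?thesis by simp
qed

lemma tail_integral_nonneg: "tail_integral \<tau> c C \<ge> 0"
  unfolding tail_integral_def by (intro Bochner_Integration.integral_nonneg) (auto simp: indicator_def)

section \<open>The part of the strip that the parallelogram misses\<close>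

lemma open_strip: "open (strip L \<tau>)"
proof -
  have "strip L \<tau> = (\<Union>t\<in>{0..L}. {p. cmod (fst p + of_real t * snd p) < \<tau>})" by (auto simp: strip_def)
  then show ?thesis by (simp only:) (intro open_UN ballI open_Collect_less continuous_intros)
qed

text \<open>Rounding the time down to an integer m \<le> l moves the point by at most |w|, so l + 1
  discs cover the section. The bound is crude but linear in l, which is matched by a number of grid
  points of order n^2 / l.\<close>

lemma strip_section:
  assumes \<tau>: "\<tau> > 0"
  shows "emeasure lborel {y. (y, w) \<in> strip (real l) \<tau>} \<le> ennreal ((real l + 1) * (pi * (\<tau> + cmod w)\<^sup>2))"
proof -
  have "{y. (y, w) \<in> strip (real l) \<tau>} \<subseteq> (\<Union>m\<le>l. ball (- (of_nat m * w)) (\<tau> + cmod w))"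
  proof
    fix y assume "y \<in> {y. (y, w) \<in> strip (real l) \<tau>}"
    then obtain t where t: "0 \<le> t" "t \<le> real l" "cmod (y + of_real t * w) < \<tau>" by (auto simp: strip_def)
    define m where "m = nat \<lfloor>t\<rfloor>"
    have m: "real m \<le> t" "t < real m + 1" "m \<le> l" using t unfolding m_def by linarith+
    have "cmod (y + of_nat m * w) \<le> cmod (y + of_real t * w) + cmod (of_real (t - real m) * w)"
      using norm_triangle_ineq4 [of "y + of_real t * w" "of_real (t - real m) * w"] by (simp add: algebra_simps)
    also have "cmod (of_real (t - real m) * w) \<le> 1 * cmod w"
      unfolding norm_mult norm_of_real using m by (intro mult_right_mono) auto
    finally have "cmod (y + of_nat m * w) < \<tau> + cmod w" using t by simp
    then show "y \<in> (\<Union>m\<le>l. ball (- (of_nat m * w)) (\<tau> + cmod w))"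
      using m by (auto simp: dist_norm norm_minus_commute intro!: bexI [of _ m])
  qed
  then have "emeasure lborel {y. (y, w) \<in> strip (real l) \<tau>} \<le> emeasure lborel (\<Union>m\<le>l. ball (- (of_nat m * w)) (\<tau> + cmod w))"
    by (intro emeasure_mono) auto
  also have "\<dots> \<le> (\<Sum>m\<le>l. emeasure lborel (ball (- (of_nat m * w)) (\<tau> + cmod w)))"
    by (intro emeasure_subadditive_finite) auto
  also have "\<dots> = (\<Sum>m\<le>l. ennreal (pi * (\<tau> + cmod w)\<^sup>2))"
    using \<tau> by (intro sum.cong refl) (simp add: emeasure_ball eval_unit_ball_vol)
  also have "\<dots> = ennreal ((real l + 1) * (pi * (\<tau> + cmod w)\<^sup>2))"
    by (subst sum_ennreal) (simp_all add: distrib_right)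
  finally show ?thesis .
qed

lemma emeasure_strip_tail:
  assumes \<tau>: "\<tau> > 0"
  shows "emeasure intensity (strip (real l) \<tau> \<inter> {p. snd p \<notin> core c C}) \<le> ennreal ((real l + 1) * tail_integral \<tau> c C)"
proof -
  let ?B = "strip (real l) \<tau> \<inter> {p. snd p \<notin> core c C}"
  have [measurable]: "strip (real l) \<tau> \<in> sets borel" using open_strip by auto
  have "{p :: complex \<times> complex. snd p \<notin> core c C} = snd -` (- core c C)" by auto
  moreover have "snd -` (- core c C) \<in> sets (borel :: (complex \<times> complex) measure)"
    by (rule measurable_sets_borel) measurable
  ultimately have [measurable]: "{p :: complex \<times> complex. snd p \<notin> core c C} \<in> sets borel" by simp
  have B [measurable]: "?B \<in> sets borel" by measurable
  have m: "(\<lambda>p. ennreal (exp (- (cmod (snd p))\<^sup>2) / pi\<^sup>2) * indicator ?B p) \<in> borel_measurable borel"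
    using B by measurable
  have "emeasure intensity ?B = (\<integral>\<^sup>+p. ennreal (exp (- (cmod (snd p))\<^sup>2) / pi\<^sup>2) * indicator ?B p \<partial>lborel)"
    unfolding intensity_def using B by (intro emeasure_density) simp_all
  also have "\<dots> = (\<integral>\<^sup>+w. \<integral>\<^sup>+y. ennreal (exp (- (cmod w)\<^sup>2) / pi\<^sup>2) * indicator ?B (y, w) \<partial>lborel \<partial>lborel)"
    by (subst nn_integral_complex_pair [OF m]) simp
  also have "\<dots> \<le> (\<integral>\<^sup>+w. ennreal (real l + 1) * ennreal ((1 - indicator (core c C) w) * ((\<tau> + cmod w)\<^sup>2 * exp (- (cmod w)\<^sup>2) / pi)) \<partial>lborel)"
  proof (intro nn_integral_mono)
    fix w
    have sec: "{y. (y, w) \<in> strip (real l) \<tau>} \<in> sets borel"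
    proof -
      have "open ((\<lambda>y. (y, w)) -` strip (real l) \<tau>)"
        by (rule open_vimage [OF open_strip]) (intro continuous_intros)
      then show ?thesis by (simp add: vimage_def)
    qed
    have "(\<integral>\<^sup>+y. ennreal (exp (- (cmod w)\<^sup>2) / pi\<^sup>2) * indicator ?B (y, w) \<partial>lborel) =
        (\<integral>\<^sup>+y. ennreal ((1 - indicator (core c C) w) * (exp (- (cmod w)\<^sup>2) / pi\<^sup>2)) * indicator {y. (y, w) \<in> strip (real l) \<tau>} y \<partial>lborel)"
      by (intro nn_integral_cong) (simp add: indicator_def)
    also have "\<dots> = ennreal ((1 - indicator (core c C) w) * (exp (- (cmod w)\<^sup>2) / pi\<^sup>2)) * emeasure lborel {y. (y, w) \<in> strip (real l) \<tau>}"
      using sec by (simp add: nn_integral_cmult)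
    also have "\<dots> \<le> ennreal ((1 - indicator (core c C) w) * (exp (- (cmod w)\<^sup>2) / pi\<^sup>2)) * ennreal ((real l + 1) * (pi * (\<tau> + cmod w)\<^sup>2))"
      by (intro mult_left_mono strip_section \<tau>) simp
    also have "\<dots> = ennreal (real l + 1) * ennreal ((1 - indicator (core c C) w) * ((\<tau> + cmod w)\<^sup>2 * exp (- (cmod w)\<^sup>2) / pi))"
    proof -
      have h: "0 \<le> (1 - indicator (core c C) w) * (exp (- (cmod w)\<^sup>2) / pi\<^sup>2)" "0 \<le> real l + 1"
        by (auto simp: indicator_def)
      show ?thesis
        unfolding ennreal_mult' [OF h(1), symmetric] ennreal_mult' [OF h(2), symmetric]
        by (rule arg_cong [of _ _ ennreal]) (simp add: power2_eq_square)
    qed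
    finally show "(\<integral>\<^sup>+y. ennreal (exp (- (cmod w)\<^sup>2) / pi\<^sup>2) * indicator ?B (y, w) \<partial>lborel) \<le>
      ennreal (real l + 1) * ennreal ((1 - indicator (core c C) w) * ((\<tau> + cmod w)\<^sup>2 * exp (- (cmod w)\<^sup>2) / pi))" .
  qed
  also have "\<dots> = ennreal (real l + 1) * (\<integral>\<^sup>+w. ennreal ((1 - indicator (core c C) w) * ((\<tau> + cmod w)\<^sup>2 * exp (- (cmod w)\<^sup>2) / pi)) \<partial>lborel)"
    by (rule nn_integral_cmult) measurable
  also have "(\<integral>\<^sup>+w. ennreal ((1 - indicator (core c C) w) * ((\<tau> + cmod w)\<^sup>2 * exp (- (cmod w)\<^sup>2) / pi)) \<partial>lborel) = ennreal (tail_integral \<tau> c C)"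
    unfolding tail_integral_def
  proof (rule nn_integral_eq_integral)
    show "integrable lborel (\<lambda>w. (1 - indicator (core c C) w) * ((\<tau> + cmod w)\<^sup>2 * exp (- (cmod w)\<^sup>2) / pi))"
      by (rule Bochner_Integration.integrable_bound [OF integrable_square_gauss [of \<tau>]]) (auto simp: indicator_def)
  qed (auto simp: indicator_def)
  also have "ennreal (real l + 1) * ennreal (tail_integral \<tau> c C) = ennreal ((real l + 1) * tail_integral \<tau> c C)" by (rule ennreal_mult' [symmetric]) simp
  finally show ?thesis .
qed

text \<open>At the time t of closeness |Re (y + t w)| < \<tau>, and |Re w| > c, so the crossing of
  Re = 0 happens within \<tau> / c of t.\<close>

lemma strip_subset:
  assumes c: "c > 0" and \<tau>: "\<tau> > 0" and p: "(y, w) \<in> strip L \<tau>" and w: "w \<in> core c C"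
  shows "(y, w) \<in> parallelogram (- (\<tau> / c)) (L + \<tau> / c) c C \<tau>"
proof -
  obtain t where t: "0 \<le> t" "t \<le> L" "cmod (y + of_real t * w) < \<tau>" using p by (auto simp: strip_def)
  have w': "c < \<bar>Re w\<bar>" "cmod w < C" using w by (auto simp: core_def)
  then have w0: "Re w \<noteq> 0" "cmod w > 0" using c abs_Re_le_cmod [of w] by auto
  define r where "r = Re y + t * Re w"
  have r: "\<bar>r\<bar> < \<tau>" using abs_Re_le_cmod [of "y + of_real t * w"] t by (simp add: r_def)
  have "\<bar>r * Re w\<bar> < \<tau> * \<bar>Re w\<bar>" using r w0 by (simp add: abs_mult)
  also have "\<tau> * \<bar>Re w\<bar> \<le> \<tau> / c * (Re w)\<^sup>2"
  proof -
    have "\<tau> * \<bar>Re w\<bar> * c \<le> \<tau> * \<bar>Re w\<bar> * \<bar>Re w\<bar>" using w' \<tau> by (intro mult_left_mono) auto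
    also have "\<dots> = \<tau> * (Re w)\<^sup>2" by (simp add: power2_eq_square)
    finally show ?thesis using c by (simp add: field_simps)
  qed
  finally have rw: "\<bar>r * Re w\<bar> < \<tau> / c * (Re w)\<^sup>2" .
  have yw: "- (Re y * Re w) = t * (Re w)\<^sup>2 - r * Re w" by (simp add: r_def algebra_simps power2_eq_square)
  have "0 \<le> t * (Re w)\<^sup>2" "t * (Re w)\<^sup>2 \<le> L * (Re w)\<^sup>2" using t by (auto intro: mult_right_mono)
  then have 1: "- (\<tau> / c) * (Re w)\<^sup>2 < - (Re y * Re w)" "- (Re y * Re w) < (L + \<tau> / c) * (Re w)\<^sup>2"
    unfolding yw using rw by (auto simp: algebra_simps abs_less_iff)
  have "Re y * Im w - Im y * Re w = - Im ((y + of_real t * w) * cnj w)"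
    by (simp add: algebra_simps)
  then have "\<bar>Re y * Im w - Im y * Re w\<bar> \<le> cmod ((y + of_real t * w) * cnj w)"
    using abs_Im_le_cmod [of "(y + of_real t * w) * cnj w"] by simp
  also have "\<dots> < \<tau> * cmod w" unfolding norm_mult complex_mod_cnj using t w0 by (intro mult_strict_right_mono) auto
  finally show ?thesis using 1 w' by (simp add: parallelogram_def)
qed

text \<open>Two sources of loss: the ends of the cell, of total length (l + 2 \<tau> / c) - (l - 2),
  which is independent of l, and the slopes outside the core, whose contribution grows with l but
  has a small factor.\<close>

lemma emeasure_strip_diff:
  assumes c: "c > 0" and \<tau>: "\<tau> > 0" and l: "l \<ge> 2"
  shows "emeasure intensity (strip (real l) \<tau> - parallelogram 1 (real l - 1) c C \<tau>) \<le>
    ennreal (2 * \<tau> * (2 + 2 * (\<tau> / c)) / pi * slope_integral c C + (real l + 1) * tail_integral \<tau> c C)"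
proof -
  let ?B = "parallelogram 1 (real l - 1) c C \<tau>" and ?B' = "parallelogram (- (\<tau> / c)) (real l + \<tau> / c) c C \<tau>"
  let ?T = "strip (real l) \<tau> \<inter> {p. snd p \<notin> core c C}"
  have [measurable]: "?B \<in> sets borel" "?B' \<in> sets borel" "strip (real l) \<tau> \<in> sets borel"
    using open_parallelogram open_strip by auto
  have "{p :: complex \<times> complex. snd p \<notin> core c C} = snd -` (- core c C)" by auto
  moreover have "snd -` (- core c C) \<in> sets (borel :: (complex \<times> complex) measure)"
    by (rule measurable_sets_borel) measurable
  ultimately have [measurable]: "{p :: complex \<times> complex. snd p \<notin> core c C} \<in> sets borel" by simp
  have tc: "\<tau> / c > 0" using c \<tau> by simp
  have sub: "?B \<subseteq> ?B'"
  proof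
    fix p assume p: "p \<in> ?B"
    obtain y w where yw: "p = (y, w)" by (cases p)
    have "- (\<tau> / c) * (Re w)\<^sup>2 \<le> 1 * (Re w)\<^sup>2" "(real l - 1) * (Re w)\<^sup>2 \<le> (real l + \<tau> / c) * (Re w)\<^sup>2"
      using tc by (intro mult_right_mono; simp)+
    then show "p \<in> ?B'" using p unfolding yw by (auto simp: parallelogram_def)
  qed
  have incl: "strip (real l) \<tau> - ?B \<subseteq> (?B' - ?B) \<union> ?T"
    using strip_subset [OF c \<tau>, of _ _ "real l" C] by auto
  have "emeasure intensity (strip (real l) \<tau> - ?B) \<le> emeasure intensity ((?B' - ?B) \<union> ?T)"
    by (rule emeasure_mono [OF incl]) simp
  also have "\<dots> \<le> emeasure intensity (?B' - ?B) + emeasure intensity ?T"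
    by (rule emeasure_subadditive) simp_all
  also have "emeasure intensity (?B' - ?B) = emeasure intensity ?B' - emeasure intensity ?B"
    using sub by (intro emeasure_Diff) (auto simp: emeasure_parallelogram [OF c _ \<tau>] l)
  also have "\<dots> = ennreal (2 * \<tau> * (real l + \<tau> / c - - (\<tau> / c)) / pi * slope_integral c C) - ennreal (2 * \<tau> * (real l - 1 - 1) / pi * slope_integral c C)"
    using tc l by (subst (1 2) emeasure_parallelogram [OF c _ \<tau>]) auto
  also have "\<dots> = ennreal (2 * \<tau> * (2 + 2 * (\<tau> / c)) / pi * slope_integral c C)"
  proof -
    have "0 \<le> 2 * \<tau> * (real l - 1 - 1) / pi * slope_integral c C"
      using \<tau> l slope_integral_nonneg [of c C] by simp
    moreover have "2 * \<tau> * (real l + \<tau> / c - - (\<tau> / c)) / pi * slope_integral c C - 2 * \<tau> * (real l - 1 - 1) / pi * slope_integral c C =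
      2 * \<tau> * (2 + 2 * (\<tau> / c)) / pi * slope_integral c C"
    proof -
      have "2 * \<tau> * (a + d - - d) / pi * s - 2 * \<tau> * (a - 1 - 1) / pi * s = 2 * \<tau> * (2 + 2 * d) / pi * s" for a d s
        by (simp add: field_simps)
      then show ?thesis by blast
    qed
    ultimately show ?thesis by (subst ennreal_minus) simp_all
  qed
  also have "ennreal (2 * \<tau> * (2 + 2 * (\<tau> / c)) / pi * slope_integral c C) + emeasure intensity ?T \<le>
     ennreal (2 * \<tau> * (2 + 2 * (\<tau> / c)) / pi * slope_integral c C) + ennreal ((real l + 1) * tail_integral \<tau> c C)"
    by (intro add_left_mono emeasure_strip_tail \<tau>)
  also have "\<dots> = ennreal (2 * \<tau> * (2 + 2 * (\<tau> / c)) / pi * slope_integral c C + (real l + 1) * tail_integral \<tau> c C)"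
    using \<tau> tc slope_integral_nonneg [of c C] tail_integral_nonneg [of \<tau> c C] by (subst ennreal_plus) simp_all
  finally show ?thesis by simp
qed

section \<open>The grid and its blocks\<close>

text \<open>The least number of grid points for which one step is at most l units of the time t in
  which n P is affine.\<close>

definition grid_size :: "nat \<Rightarrow> nat \<Rightarrow> nat" where
  "grid_size l n = nat \<lceil>2 * pi * (real n * deriv_sd n) / real l\<rceil>"

text \<open>A gap of n times this many grid points is an arc much longer than 1 / n, even after
  division by powers of ln n. A period then has at most n^(3/2) points, few enough to beat the
  number of double hits.\<close>

definition gap_factor :: "nat \<Rightarrow> nat" where
  "gap_factor n = nat \<lfloor>real n powr (1 / 4)\<rfloor>"

definition block_period :: "nat \<Rightarrow> nat" where
  "block_period n = n * (gap_factor n)\<^sup>2"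

text \<open>The last \<open>n * gap_factor n\<close> points of each period form the gap. Since g
  \<le> g^2 for natural numbers, the subtraction never truncates.\<close>

definition block_size :: "nat \<Rightarrow> nat" where
  "block_size n = block_period n - n * gap_factor n"

definition block_count :: "nat \<Rightarrow> nat \<Rightarrow> nat" where
  "block_count l n = grid_size l n div block_period n"

lemma gap_factor_bounds: "real n powr (1 / 4) - 1 \<le> real (gap_factor n)" "real (gap_factor n) \<le> real n powr (1 / 4)"
proof -
  have "real (gap_factor n) = of_int \<lfloor>real n powr (1 / 4)\<rfloor>" by (simp add: gap_factor_def)
  then show "real n powr (1 / 4) - 1 \<le> real (gap_factor n)" "real (gap_factor n) \<le> real n powr (1 / 4)"
    by linarith+
qed

lemma gap_factor_at_top: "filterlim (\<lambda>n. real (gap_factor n)) at_top sequentially"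
proof (rule filterlim_at_top_mono)
  show "filterlim (\<lambda>n. real n powr (1 / 4) - 1) at_top sequentially" by real_asymp
  show "eventually (\<lambda>n. real n powr (1 / 4) - 1 \<le> real (gap_factor n)) sequentially"
    by (intro always_eventually allI gap_factor_bounds)
qed

lemma gap_factor_ge_2: "eventually (\<lambda>n. gap_factor n \<ge> 2) sequentially"
proof -
  have "eventually (\<lambda>n. 2 \<le> real (gap_factor n)) sequentially"
    using gap_factor_at_top unfolding filterlim_at_top by blast
  then show ?thesis by eventually_elim simp
qed

lemma grid_size_bounds:
  "2 * pi * (real n * deriv_sd n) / real l \<le> real (grid_size l n)" "real (grid_size l n) \<le> 2 * pi * (real n * deriv_sd n) / real l + 1"
proof -
  have "0 \<le> 2 * pi * (real n * deriv_sd n) / real l" by (simp add: deriv_sd_def)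
  then have "real (grid_size l n) = of_int \<lceil>2 * pi * (real n * deriv_sd n) / real l\<rceil>" by (simp add: grid_size_def)
  then show "2 * pi * (real n * deriv_sd n) / real l \<le> real (grid_size l n)" "real (grid_size l n) \<le> 2 * pi * (real n * deriv_sd n) / real l + 1"
    by linarith+
qed

lemma grid_size_limit:
  "(\<lambda>n. real (grid_size l n) / (real n)\<^sup>2) \<longlonglongrightarrow> 2 * pi / (sqrt 3 * real l)"
proof -
  have s: "(\<lambda>n. real n * deriv_sd n / (real n)\<^sup>2) \<longlonglongrightarrow> 1 / sqrt 3"
  proof -
    have "(\<lambda>n. real n * deriv_sd n / (real n)\<^sup>2) \<longlonglongrightarrow> (1 / 3) powr (1 / 2)"
      unfolding deriv_sd_def by real_asymp
    then show ?thesis by (simp add: powr_half_sqrt real_sqrt_divide)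
  qed
  have 1: "(\<lambda>n. 2 * pi / real l * (real n * deriv_sd n / (real n)\<^sup>2)) \<longlonglongrightarrow> 2 * pi / real l * (1 / sqrt 3)"
    by (intro tendsto_intros s)
  have 2: "(\<lambda>n. 2 * pi / real l * (real n * deriv_sd n / (real n)\<^sup>2) + 1 / (real n)\<^sup>2) \<longlonglongrightarrow> 2 * pi / real l * (1 / sqrt 3) + 0"
    by (intro tendsto_add 1) real_asymp
  have "(\<lambda>n. real (grid_size l n) / (real n)\<^sup>2) \<longlonglongrightarrow> 2 * pi / real l * (1 / sqrt 3)"
  proof (rule tendsto_sandwich [OF _ _ 1])
    show "eventually (\<lambda>n. 2 * pi / real l * (real n * deriv_sd n / (real n)\<^sup>2) \<le> real (grid_size l n) / (real n)\<^sup>2) sequentially"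
      using grid_size_bounds(1) [of _ l] by (intro always_eventually allI)
        (metis (no_types, opaque_lifting) divide_right_mono times_divide_eq_left times_divide_eq_right zero_le_power2)
    show "eventually (\<lambda>n. real (grid_size l n) / (real n)\<^sup>2 \<le> 2 * pi / real l * (real n * deriv_sd n / (real n)\<^sup>2) + 1 / (real n)\<^sup>2) sequentially"
    proof (intro always_eventually allI)
      fix n
      have "real (grid_size l n) / (real n)\<^sup>2 \<le> (2 * pi * (real n * deriv_sd n) / real l + 1) / (real n)\<^sup>2"
        using grid_size_bounds(2) [of l n] by (intro divide_right_mono) auto
      also have "\<dots> = 2 * pi / real l * (real n * deriv_sd n / (real n)\<^sup>2) + 1 / (real n)\<^sup>2"
        by (simp add: add_divide_distrib)
      finally show "real (grid_size l n) / (real n)\<^sup>2 \<le> \<dots>" .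
    qed
    show "(\<lambda>n. 2 * pi / real l * (real n * deriv_sd n / (real n)\<^sup>2) + 1 / (real n)\<^sup>2) \<longlonglongrightarrow> 2 * pi / real l * (1 / sqrt 3)"
      using 2 by simp
  qed
  then show ?thesis by (simp add: mult.commute)
qed

lemma block_period_le: "real (block_period n) \<le> (real n) powr (3 / 2)"
proof (cases "n = 0")
  case False
  have "real (block_period n) = real n * (real (gap_factor n))\<^sup>2" by (simp add: block_period_def)
  also have "\<dots> \<le> real n * (real n powr (1 / 4))\<^sup>2"
    by (intro mult_left_mono power_mono gap_factor_bounds) auto
  also have "\<dots> = real n powr 1 * real n powr (1 / 2)" using False by (simp add: power2_eq_square flip: powr_add)
  also have "\<dots> = real n powr (1 + 1 / 2)" by (rule powr_add [symmetric])
  finally show ?thesis by simp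
qed (simp add: block_period_def)

lemma block_period_limit: "(\<lambda>n. real (block_period n) / (real n)\<^sup>2) \<longlonglongrightarrow> 0"
proof (rule tendsto_sandwich)
  show "(\<lambda>_. 0) \<longlonglongrightarrow> (0::real)" "(\<lambda>n. (real n) powr (3 / 2) / (real n)\<^sup>2) \<longlonglongrightarrow> 0"
    by real_asymp+
  show "eventually (\<lambda>n. real (block_period n) / (real n)\<^sup>2 \<le> (real n) powr (3 / 2) / (real n)\<^sup>2) sequentially"
    by (intro always_eventually allI divide_right_mono block_period_le) simp
qed simp

text \<open>Rounding down the number of blocks loses fewer points than one period, which is
  o(n^2).\<close>

lemma block_count_period_limit:
  "(\<lambda>n. real (block_count l n * block_period n) / (real n)\<^sup>2) \<longlonglongrightarrow> 2 * pi / (sqrt 3 * real l)"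
proof (rule tendsto_sandwich [OF _ _ _ grid_size_limit])
  have "(\<lambda>n. real (grid_size l n) / (real n)\<^sup>2 - real (block_period n) / (real n)\<^sup>2) \<longlonglongrightarrow> 2 * pi / (sqrt 3 * real l) - 0"
    by (intro tendsto_diff grid_size_limit block_period_limit)
  then show "(\<lambda>n. (real (grid_size l n) - real (block_period n)) / (real n)\<^sup>2) \<longlonglongrightarrow> 2 * pi / (sqrt 3 * real l)"
    by (simp add: diff_divide_distrib)
  show "eventually (\<lambda>n. (real (grid_size l n) - real (block_period n)) / (real n)\<^sup>2 \<le> real (block_count l n * block_period n) / (real n)\<^sup>2) sequentially"
    using gap_factor_ge_2 eventually_gt_at_top [of 0]
  proof eventually_elim
    case (elim n)
    then have "block_period n > 0" by (auto simp: block_period_def)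
    then have "grid_size l n mod block_period n < block_period n" by simp
    then have "grid_size l n \<le> block_count l n * block_period n + block_period n"
      unfolding block_count_def using div_mult_mod_eq [of "grid_size l n" "block_period n"] by linarith
    then have "real (grid_size l n) \<le> real (block_count l n * block_period n) + real (block_period n)"
      by (metis of_nat_add of_nat_le_iff)
    then show ?case by (intro divide_right_mono) auto
  qed
  show "eventually (\<lambda>n. real (block_count l n * block_period n) / (real n)\<^sup>2 \<le> real (grid_size l n) / (real n)\<^sup>2) sequentially"
    by (intro always_eventually allI divide_right_mono) (auto simp: block_count_def simp flip: of_nat_mult)
qed

lemma block_size_le: "block_size n \<le> block_period n"
  by (simp add: block_size_def)

lemma block_size_real: "real (block_size n) = real (block_period n) * (1 - 1 / real (gap_factor n))" if "gap_factor n \<ge> 2" for n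
proof -
  have "gap_factor n \<le> (gap_factor n)\<^sup>2" using that by (simp add: power2_eq_square)
  then have "n * gap_factor n \<le> block_period n" unfolding block_period_def by (rule mult_le_mono2)
  then have "real (block_size n) = real (block_period n) - real n * real (gap_factor n)"
    by (simp add: block_size_def of_nat_diff)
  also have "\<dots> = real (block_period n) * (1 - 1 / real (gap_factor n))"
    using that by (simp add: block_period_def field_simps power2_eq_square)
  finally show ?thesis .
qed

text \<open>Gaps take only the share 1 / \<open>gap_factor n\<close> of each period, so
  asymptotically all grid points lie in blocks.\<close>

lemma block_points_limit:
  "(\<lambda>n. real (block_count l n * block_size n) / (real n)\<^sup>2) \<longlonglongrightarrow> 2 * pi / (sqrt 3 * real l)"
proof -
  have "(\<lambda>n. real (block_count l n * block_period n) / (real n)\<^sup>2 * (1 - 1 / real (gap_factor n))) \<longlonglongrightarrow> 2 * pi / (sqrt 3 * real l) * (1 - 0)"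
    by (intro tendsto_mult block_count_period_limit tendsto_diff tendsto_const
        tendsto_divide_0 [OF tendsto_const filterlim_at_top_imp_at_infinity [OF gap_factor_at_top]])
  moreover have "eventually (\<lambda>n. real (block_count l n * block_period n) / (real n)\<^sup>2 * (1 - 1 / real (gap_factor n)) =
      real (block_count l n * block_size n) / (real n)\<^sup>2) sequentially"
    using gap_factor_ge_2 by eventually_elim (simp add: block_size_real)
  ultimately show ?thesis by (simp add: Lim_transform_eventually)
qed

lemma block_count_at_top:
  assumes l: "l > 0"
  shows "filterlim (block_count l) at_top sequentially"
proof -
  have "filterlim (\<lambda>n. real (block_count l n)) at_top sequentially"
  proof (rule filterlim_at_top_mono)
    let ?q = "2 * pi / (sqrt 3 * real l)"
    have "filterlim (\<lambda>n. real (block_count l n * block_period n) / (real n)\<^sup>2 * (real n) powr (1 / 2)) at_top sequentially"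
      by (rule filterlim_tendsto_pos_mult_at_top [OF block_count_period_limit]) (use l in simp, real_asymp)
    then show "filterlim (\<lambda>n. real (block_count l n * block_period n) / (real n)\<^sup>2 * (real n) powr (1 / 2)) at_top sequentially" .
    show "eventually (\<lambda>n. real (block_count l n * block_period n) / (real n)\<^sup>2 * (real n) powr (1 / 2) \<le> real (block_count l n)) sequentially"
      using eventually_gt_at_top [of 0]
    proof eventually_elim
      case (elim n)
      have "real (block_count l n * block_period n) / (real n)\<^sup>2 * (real n) powr (1 / 2) \<le>
          real (block_count l n) * (real n) powr (3 / 2) / (real n)\<^sup>2 * (real n) powr (1 / 2)"
        using block_period_le [of n] by (intro mult_right_mono divide_right_mono) (auto intro: mult_left_mono)
      also have "\<dots> = real (block_count l n) * ((real n) powr (3 / 2) * (real n) powr (1 / 2)) / (real n)\<^sup>2" by simp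
      also have "(real n) powr (3 / 2) * (real n) powr (1 / 2) = (real n)\<^sup>2" using elim by (simp flip: powr_add)
      finally show ?case using elim by simp
    qed
  qed
  then show ?thesis by (simp only: filterlim_sequentially_iff_filterlim_real)
qed

text \<open>The gap between consecutive blocks, also around the circle, is an arc \<open>\<delta> = 2 \<pi> n gap_factor / grid_size\<close>, and a
  chord is at least \<open>2 \<delta> / \<pi>\<close>.\<close>

definition block_sep :: "nat \<Rightarrow> nat \<Rightarrow> real" where
  "block_sep l n = 4 * (real n * real (gap_factor n)) / real (grid_size l n)"

lemma block_sep:
  assumes b: "b < block_count l n" "b' < block_count l n" "b \<noteq> b'" and k: "k < block_size n" "k' < block_size n"
  shows "cmod (1 - cis (grid (grid_size l n) (b * block_period n + k) - grid (grid_size l n) (b' * block_period n + k'))) \<ge> block_sep l n"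
proof -
  define K where "K = grid_size l n"
  define H where "H = block_period n"
  define g where "g = n * gap_factor n"
  have h: "block_size n = H - g" by (simp add: block_size_def H_def g_def)
  then have gH: "g < H" using k by simp
  have mH: "block_count l n * H \<le> K" by (simp add: block_count_def H_def K_def)
  have K: "K > 0" using mH b gH by (metis gr0I le_zero_eq mult_eq_0_iff not_less0)
  \<comment> \<open>The inequality d + g \<le> K is the gap around the circle: every block, the last
    one included, ends g points before the end of its period.\<close>
  have order: "\<exists>d. g \<le> d \<and> d + g \<le> K \<and> j * H + q = (i * H + p) + d"
    if ij: "i < j" "j < block_count l n" and pq: "p < H - g" "q < H - g" for i j p q
  proof -
    have 1: "i * H + H \<le> j * H" using ij(1) by (metis Suc_leI add.commute mult_Suc mult_le_mono1)
    have 2: "j * H + H \<le> K" using ij(2) mH by (metis Suc_leI add.commute mult_Suc mult_le_mono1 order_trans)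
    have "g \<le> j * H + q - (i * H + p)" "j * H + q - (i * H + p) + g \<le> K" "j * H + q = (i * H + p) + (j * H + q - (i * H + p))"
      using 1 2 pq gH by linarith+
    then show ?thesis by blast
  qed
  have bound: "2 * (2 * pi * real g / real K) / pi \<le> cmod (1 - cis e)"
    if e: "\<bar>e\<bar> = 2 * pi * real d / real K" and d: "g \<le> d" "d + g \<le> K" for d e
  proof (rule cmod_one_minus_cis_ge)
    show "0 \<le> 2 * pi * real g / real K" by simp
    show "2 * pi * real g / real K \<le> \<bar>e\<bar>" unfolding e using d by (intro divide_right_mono mult_left_mono) auto
    have "real d + real g \<le> real K" using d by (metis of_nat_add of_nat_le_iff)
    then have "(real d + real g) / real K \<le> 1" using K by simp
    then have "2 * pi * ((real d + real g) / real K) \<le> 2 * pi * 1" by (intro mult_left_mono) auto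
    then have "2 * pi * (real d + real g) / real K \<le> 2 * pi" by simp
    then show "\<bar>e\<bar> \<le> 2 * pi - 2 * pi * real g / real K" unfolding e by (simp add: distrib_left add_divide_distrib)
  qed
  have sep: "2 * (2 * pi * real g / real K) / pi = block_sep l n"
    by (simp add: block_sep_def K_def g_def)
  have diff: "grid K (x + d) - grid K x = 2 * pi * real d / real K" "grid K x - grid K (x + d) = - (2 * pi * real d / real K)" for x d
    by (simp_all add: grid_def add_divide_distrib distrib_left)
  show ?thesis
  proof (cases "b' < b")
    case True
    obtain d where d: "g \<le> d" "d + g \<le> K" "b * H + k = (b' * H + k') + d" using order [OF True b(1)] k h by auto
    show ?thesis unfolding sep [symmetric] K_def [symmetric] H_def [symmetric] d(3) diff
      by (rule bound [OF _ d(1,2)]) simp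
  next
    case False
    then have "b < b'" using b by simp
    then obtain d where d: "g \<le> d" "d + g \<le> K" "b' * H + k' = (b * H + k) + d" using order [of b b' k k'] b k h by auto
    show ?thesis unfolding sep [symmetric] K_def [symmetric] H_def [symmetric] d(3) diff
      by (rule bound [OF _ d(1,2)]) simp
  qed
qed

text \<open>n times the separation is of the order of \<open>gap_factor n\<close>, about n^(1/4).
  The numerator carries (ln n)^2 so that the correlations are negligible even compared with
  \<open>gapv\<close>.\<close>

lemma block_sep_limit:
  assumes l: "l > 0"
  shows "(\<lambda>n. (A * (ln (real n))\<^sup>2 + D) / (real n * block_sep l n)) \<longlonglongrightarrow> 0"
proof -
  have "(\<lambda>n. real (grid_size l n) / (real n)\<^sup>2 * ((A * (ln (real n))\<^sup>2 + D) / (4 * real (gap_factor n)))) \<longlonglongrightarrow> 2 * pi / (sqrt 3 * real l) * 0"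
  proof (intro tendsto_mult grid_size_limit)
    show "(\<lambda>n. (A * (ln (real n))\<^sup>2 + D) / (4 * real (gap_factor n))) \<longlonglongrightarrow> 0"
    proof (rule Lim_null_comparison)
      show "eventually (\<lambda>n. norm ((A * (ln (real n))\<^sup>2 + D) / (4 * real (gap_factor n))) \<le> \<bar>A * (ln (real n))\<^sup>2 + D\<bar> / (4 * (real n powr (1 / 4) - 1))) sequentially"
        using gap_factor_ge_2 eventually_gt_at_top [of 1]
      proof eventually_elim
        case (elim n)
        have "real n powr (1 / 4) - 1 > 0" using elim gr_one_powr [of "real n" "1 / 4"] by simp
        then show ?case using gap_factor_bounds(1) [of n] by (simp add: abs_divide) (intro frac_le; simp)
      qed
      show "(\<lambda>n. \<bar>A * (ln (real n))\<^sup>2 + D\<bar> / (4 * (real n powr (1 / 4) - 1))) \<longlonglongrightarrow> 0"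
      proof (rule Lim_null_comparison)
        show "eventually (\<lambda>n. norm (\<bar>A * (ln (real n))\<^sup>2 + D\<bar> / (4 * (real n powr (1 / 4) - 1))) \<le>
            \<bar>A\<bar> * ((ln (real n))\<^sup>2 / (4 * (real n powr (1 / 4) - 1))) + \<bar>D\<bar> * (1 / (4 * (real n powr (1 / 4) - 1)))) sequentially"
          using eventually_gt_at_top [of 1]
        proof eventually_elim
          case (elim n)
          have p: "real n powr (1 / 4) - 1 > 0" using elim gr_one_powr [of "real n" "1 / 4"] by simp
          have "\<bar>A * (ln (real n))\<^sup>2 + D\<bar> \<le> \<bar>A\<bar> * (ln (real n))\<^sup>2 + \<bar>D\<bar>"
            by (rule order_trans [OF abs_triangle_ineq]) (simp add: abs_mult)
          then have "\<bar>A * (ln (real n))\<^sup>2 + D\<bar> / (4 * (real n powr (1 / 4) - 1)) \<le> (\<bar>A\<bar> * (ln (real n))\<^sup>2 + \<bar>D\<bar>) / (4 * (real n powr (1 / 4) - 1))"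
            using p by (intro divide_right_mono) auto
          then show ?case using p by (simp add: add_divide_distrib)
        qed
        have "(\<lambda>n. (ln (real n))\<^sup>2 / (4 * (real n powr (1 / 4) - 1))) \<longlonglongrightarrow> 0" "(\<lambda>n. 1 / (4 * (real n powr (1 / 4) - 1))) \<longlonglongrightarrow> 0"
          by real_asymp+
        from tendsto_add [OF tendsto_mult_left [OF this(1), of "\<bar>A\<bar>"] tendsto_mult_left [OF this(2), of "\<bar>D\<bar>"]]
        show "(\<lambda>n. \<bar>A\<bar> * ((ln (real n))\<^sup>2 / (4 * (real n powr (1 / 4) - 1))) + \<bar>D\<bar> * (1 / (4 * (real n powr (1 / 4) - 1)))) \<longlonglongrightarrow> 0"
          by simp
      qed
    qed
  qed
  moreover have "real (grid_size l n) / (real n)\<^sup>2 * ((A * (ln (real n))\<^sup>2 + D) / (4 * real (gap_factor n))) =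
     (A * (ln (real n))\<^sup>2 + D) / (real n * block_sep l n)" for n
    by (simp add: block_sep_def power2_eq_square mult_ac)
  ultimately show ?thesis by simp
qed

text \<open>The power n^(-1/2) is distributed evenly over the j + 1 logarithmic factors.\<close>

lemma log_power_limit:
  fixes A D :: real
  assumes "A \<ge> 0" "D \<ge> 0"
  shows "(\<lambda>n. (A * (ln (real n))\<^sup>2 + D) ^ Suc j * (real n) powr (- 1 / 2)) \<longlonglongrightarrow> 0"
proof -
  define q where "q = 1 / (2 * real (Suc j))"
  have q: "q > 0" by (simp add: q_def)
  have "(\<lambda>n. (ln (real n))\<^sup>2 * (real n) powr (- q)) \<longlonglongrightarrow> 0" "(\<lambda>n. (real n) powr (- q)) \<longlonglongrightarrow> 0"
    using q by real_asymp+
  from tendsto_add [OF tendsto_mult_left [OF this(1), of A] tendsto_mult_left [OF this(2), of D]]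
  have "(\<lambda>n. (A * (ln (real n))\<^sup>2 + D) * (real n) powr (- q)) \<longlonglongrightarrow> 0" by (simp add: algebra_simps)
  from tendsto_power [OF this, of "Suc j"]
  have "(\<lambda>n. ((A * (ln (real n))\<^sup>2 + D) * (real n) powr (- q)) ^ Suc j) \<longlonglongrightarrow> 0" by simp
  moreover have "eventually (\<lambda>n. ((A * (ln (real n))\<^sup>2 + D) * (real n) powr (- q)) ^ Suc j =
     (A * (ln (real n))\<^sup>2 + D) ^ Suc j * (real n) powr (- 1 / 2)) sequentially"
    using eventually_gt_at_top [of 0]
  proof eventually_elim
    case (elim n)
    have "((real n) powr (- q)) ^ Suc j = (real n) powr (real (Suc j) * - q)"
      using elim by (subst powr_power) auto
    also have "real (Suc j) * - q = - 1 / 2" by (simp add: q_def field_simps)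
    finally show ?case by (simp only: power_mult_distrib)
  qed
  ultimately show ?thesis by (rule Lim_transform_eventually)
qed

section \<open>Hitting probabilities\<close>

text \<open>exp (- (ln n)^2 / 2) equals n^(- (ln n) / 2), which is smaller than every power of
  n.\<close>

lemma superpolynomial_limit: "(\<lambda>n. ((real n)\<^sup>2) ^ j * exp (- ((ln (real n))\<^sup>2 / 2))) \<longlonglongrightarrow> 0"
proof -
  define a where "a = real (2 * j)"
  have "(\<lambda>n. real n powr a * exp (- ((ln (real n))\<^sup>2 / 2))) \<longlonglongrightarrow> 0"
    by real_asymp
  moreover have "eventually (\<lambda>n. real n powr a * exp (- ((ln (real n))\<^sup>2 / 2)) = ((real n)\<^sup>2) ^ j * exp (- ((ln (real n))\<^sup>2 / 2))) sequentially"
    using eventually_gt_at_top [of 0] by eventually_elim (simp only: a_def powr_realpow power_mult of_nat_0_less_iff)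
  ultimately show ?thesis by (rule Lim_transform_eventually)
qed

section \<open>Hits at grid points and outcomes with controlled second derivative\<close>

locale gaussian_coefficients = prob_space M for M :: "'a measure" +
  fixes \<zeta> :: "int \<Rightarrow> 'a \<Rightarrow> complex"
  assumes indep: "indep_vars (\<lambda>_. borel) \<zeta> UNIV"
    and gauss: "\<And>j. std_complex_gaussian M (\<zeta> j)"
begin

lemma gaussian_trig: "n > 0 \<Longrightarrow> gaussian_trig M \<zeta> n"
  by unfold_locales (auto intro: indep_vars_subset [OF indep] gauss)

lemma zeta_measurable [measurable]: "\<zeta> j \<in> borel_measurable M"
  by (rule std_complex_gaussian_distr(2) [OF gauss])

lemma scaled_deriv_measurable [measurable]: "(\<lambda>\<omega>. scaled_deriv n p (\<lambda>k. \<zeta> k \<omega>) x) \<in> borel_measurable M"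
  unfolding scaled_deriv_def by measurable

definition hit :: "(complex \<times> complex) set \<Rightarrow> nat \<Rightarrow> real \<Rightarrow> 'a set" where
  "hit U n x = {\<omega> \<in> space M. (of_nat n * scaled_deriv n 0 (\<lambda>k. \<zeta> k \<omega>) x, scaled_deriv n 1 (\<lambda>k. \<zeta> k \<omega>) x) \<in> U}"

lemma hit_events: "U \<in> sets borel \<Longrightarrow> hit U n x \<in> events"
proof -
  assume U: "U \<in> sets borel"
  have "(\<lambda>\<omega>. (of_nat n * scaled_deriv n 0 (\<lambda>k. \<zeta> k \<omega>) x, scaled_deriv n 1 (\<lambda>k. \<zeta> k \<omega>) x)) \<in> borel_measurable M" by measurable
  from measurable_sets [OF this U] show ?thesis by (simp add: hit_def vimage_def Int_def conj_commute)
qed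

lemma hit_prob:
  assumes n: "n > 0" and U: "U \<in> sets borel"
  shows "prob (hit U n x) = measure (gaussian_measure (1 / sqrt 2)) (rescale n U)"
proof -
  interpret T: gaussian_trig M \<zeta> n using n by (rule gaussian_trig)
  show ?thesis
    using T.single_prob [OF rescale_measurable [OF U], where x = x] by (simp add: hit_def rescale_def T.Y_def)
qed

text \<open>The level ln n makes the exceptional outcomes rarer than any power of n, while the
  second derivative stays o(n), as linearisation requires.\<close>

definition tame :: "nat \<Rightarrow> nat \<Rightarrow> 'a set" where
  "tame l n = {\<omega> \<in> space M. (\<forall>k<grid_size l n. cmod (scaled_deriv n 2 (\<lambda>j. \<zeta> j \<omega>) (grid (grid_size l n) k)) \<le> 3 * ln (real n)) \<and>
     (\<forall>j\<in>{- int n..int n}. cmod (\<zeta> j \<omega>) \<le> ln (real n))}"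

lemma tame_events: "tame l n \<in> events"
  unfolding tame_def by measurable

lemma tame_prob:
  assumes "n > 0"
  shows "prob (space M - tame l n) \<le> 2 * (real (grid_size l n) + (2 * real n + 1)) * exp (- ((ln (real n))\<^sup>2 / 2))"
proof -
  interpret T: gaussian_trig M \<zeta> n using assms by (rule gaussian_trig)
  show ?thesis
    using T.good_prob [of "ln (real n)" "grid_size l n"] assms
    by (simp add: T.good_def T.Y_def tame_def)
qed

text \<open>One additional factor n^2 pays for the number of variables in the union bound.\<close>

lemma tame_limit: "(\<lambda>n. real (block_count l n * block_size n) ^ j * prob (space M - tame l n)) \<longlonglongrightarrow> 0"
proof (rule Lim_null_comparison)
  let ?a = "2 * pi / (sqrt 3 * real l)"
  let ?f = "\<lambda>n. (real (block_count l n * block_size n) / (real n)\<^sup>2) ^ j * (2 * (real (grid_size l n) / (real n)\<^sup>2 + (2 * real n + 1) / (real n)\<^sup>2)) *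
       (((real n)\<^sup>2) ^ Suc j * exp (- ((ln (real n))\<^sup>2 / 2)))"
  have "(\<lambda>n. (2 * real n + 1) / (real n)\<^sup>2) \<longlonglongrightarrow> 0" by real_asymp
  then have "?f \<longlonglongrightarrow> ?a ^ j * (2 * (?a + 0)) * 0"
    by (intro tendsto_mult tendsto_power block_points_limit tendsto_add grid_size_limit tendsto_const superpolynomial_limit)
  then show "?f \<longlonglongrightarrow> 0" by simp
  show "eventually (\<lambda>n. norm (real (block_count l n * block_size n) ^ j * prob (space M - tame l n)) \<le> ?f n) sequentially"
    using eventually_gt_at_top [of 0]
  proof eventually_elim
    case (elim n)
    have "real (block_count l n * block_size n) ^ j * prob (space M - tame l n) \<le>
      real (block_count l n * block_size n) ^ j * (2 * (real (grid_size l n) + (2 * real n + 1)) * exp (- ((ln (real n))\<^sup>2 / 2)))"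
      by (intro mult_left_mono tame_prob elim) simp
    also have "\<dots> = ?f n"
    proof -
      have eq: "X ^ j * (2 * (K + N) * E) = (X / q) ^ j * (2 * (K / q + N / q)) * (q ^ Suc j * E)" if "q \<noteq> 0" for X K N E q :: real
        using that by (simp add: power_divide field_simps)
      show ?thesis by (rule eq) (use elim in simp)
    qed
    finally show ?case by simp
  qed
qed

lemma tame_second_derivative:
  assumes n: "n \<ge> 1" and K: "grid_size l n > 0" and l: "l > 0" and large: "6 * real l * sqrt (2 * real n + 1) \<le> real n" and w: "\<omega> \<in> tame l n"
  shows "cmod (scaled_deriv n 2 (\<lambda>j. \<zeta> j \<omega>) x) \<le> 4 * ln (real n)"
proof (rule sup_second_derivative)
  show "2 * pi * (real n * deriv_sd n) / real (grid_size l n) \<le> real l"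
    using grid_size_bounds(1) [of n l] K l by (simp add: field_simps)
qed (use n K large w in \<open>auto simp: tame_def\<close>)

context
  fixes l :: nat and c C \<tau> :: real
  assumes l: "l \<ge> 3" and c: "c > 0" and C: "C > 0" and \<tau>: "\<tau> > 0"
begin

text \<open>A lower bound for 1 - |\<open>dirichlet\<close>| at two simultaneously hit points of a
  block: on tame outcomes exclusion gives n d \<ge> c / (8 l ln n), where 8 = 2 * 4 and 4 ln n
  bounds the second derivative, and \<open>dirichlet_gap\<close> does the rest.\<close>

definition gapv :: "nat \<Rightarrow> real" where
  "gapv n = min (1 / 2) ((c / (8 * real l * ln (real n)))\<^sup>2 / 24)"

abbreviation "cell \<equiv> parallelogram 1 (real l - 1) c C \<tau>"
abbreviation "rad \<equiv> parallelogram_radius 1 (real l - 1) c C \<tau>"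

lemma cell_borel: "cell \<in> sets borel" using open_parallelogram by auto

lemma gapv_inverse:
  assumes "n \<ge> 3"
  shows "gapv n > 0" "1 / gapv n \<le> (24 * 64 * (real l)\<^sup>2 / c\<^sup>2) * (ln (real n))\<^sup>2 + 2"
proof -
  define q where "q = (c / (8 * real l * ln (real n)))\<^sup>2 / 24"
  have ln: "ln (real n) > 0" using assms by simp
  have q: "q > 0" using ln c l by (simp add: q_def)
  have v: "gapv n = min (1 / 2) q" by (simp add: gapv_def q_def)
  show "gapv n > 0" using q by (simp add: v)
  have "1 / gapv n \<le> 1 / q + 2" using q by (cases "q \<le> 1 / 2") (auto simp: v min_def)
  also have "1 / q = (24 * 64 * (real l)\<^sup>2 / c\<^sup>2) * (ln (real n))\<^sup>2"
    using ln c l by (simp add: q_def power_divide power_mult_distrib field_simps)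
  finally show "1 / gapv n \<le> (24 * 64 * (real l)\<^sup>2 / c\<^sup>2) * (ln (real n))\<^sup>2 + 2" .
qed

lemma gapv_nonneg: "gapv n \<ge> 0" by (simp add: gapv_def)

lemma block_sep_nonneg: "block_sep l n \<ge> 0" by (simp add: block_sep_def)

text \<open>A block then spans at most half of the circle, so distances within it stay in the range
  [0, pi] of \<open>dirichlet_gap\<close>.\<close>

lemma eventually_grid_large: "eventually (\<lambda>n. 2 * block_period n \<le> grid_size l n \<and> grid_size l n > 0) sequentially"
proof -
  have a: "2 * pi / (sqrt 3 * real l) > 0" using l by simp
  have "(\<lambda>n. real (grid_size l n) / (real n)\<^sup>2 - 2 * (real (block_period n) / (real n)\<^sup>2)) \<longlonglongrightarrow> 2 * pi / (sqrt 3 * real l) - 2 * 0"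
    by (intro tendsto_intros grid_size_limit block_period_limit)
  then have "eventually (\<lambda>n. 0 < real (grid_size l n) / (real n)\<^sup>2 - 2 * (real (block_period n) / (real n)\<^sup>2)) sequentially"
    using a by (intro order_tendstoD(1)) auto
  then show ?thesis
    using eventually_gt_at_top [of 0]
  proof eventually_elim
    case (elim n)
    have "0 < (real (grid_size l n) - 2 * real (block_period n)) / (real n)\<^sup>2" using elim(1) by (simp add: diff_divide_distrib)
    then have "real (grid_size l n) - 2 * real (block_period n) > 0" using elim(2) by (simp add: zero_less_divide_iff)
    then show ?case by linarith
  qed
qed

text \<open>Rounding up the number of points shortens the step below l. For large n it is still at
  least l - 1, the upper end of the trimmed crossing times, as exclusion requires.\<close>

lemma eventually_grid_fine: "eventually (\<lambda>n. (real l - 1) / real n \<le> deriv_sd n * (2 * pi / real (grid_size l n))) sequentially"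
proof -
  have "filterlim (\<lambda>n. real n * deriv_sd n) at_top sequentially" unfolding deriv_sd_def by real_asymp
  then have "eventually (\<lambda>n. real l * real l \<le> real n * deriv_sd n) sequentially"
    unfolding filterlim_at_top by blast
  then show ?thesis
    using eventually_grid_large eventually_gt_at_top [of 0]
  proof eventually_elim
    case (elim n)
    define X where "X = 2 * pi * (real n * deriv_sd n)"
    have l0: "real l > 0" using l by simp
    have "real l * real l \<le> 1 * (real n * deriv_sd n)" using elim by simp
    also have "\<dots> \<le> (2 * pi) * (real n * deriv_sd n)"
      using pi_ge_two by (intro mult_right_mono) (auto simp: deriv_sd_def)
    finally have X: "real l * real l \<le> X" by (simp add: X_def mult.assoc)
    have "(real l - 1) * real (grid_size l n) \<le> (real l - 1) * (X / real l + 1)"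
      using grid_size_bounds(2) [of l n] l by (intro mult_left_mono) (auto simp: X_def)
    also have "\<dots> = X - X / real l + (real l - 1)" using l0 by (simp add: field_simps)
    also have "X / real l \<ge> real l" using X l0 by (simp add: field_simps)
    then have "X - X / real l + (real l - 1) \<le> X" by linarith
    finally show ?case using elim by (simp add: X_def field_simps)
  qed
qed

lemma eventually_second_derivative: "eventually (\<lambda>n. 6 * real l * sqrt (2 * real n + 1) \<le> real n) sequentially"
proof -
  have "(\<lambda>n. sqrt (2 * real n + 1) / real n) \<longlonglongrightarrow> 0" by real_asymp
  from tendsto_mult_left [OF this, of "6 * real l"]
  have "(\<lambda>n. 6 * real l * (sqrt (2 * real n + 1) / real n)) \<longlonglongrightarrow> 0" by simp
  then have "eventually (\<lambda>n. 6 * real l * (sqrt (2 * real n + 1) / real n) < 1) sequentially"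
    by (rule order_tendstoD(2)) simp
  then show ?thesis using eventually_gt_at_top [of 0] by eventually_elim (simp add: field_simps)
qed

text \<open>The correlations between blocks are of order n^(-1/4), the gap of a close pair is at
  least of order 1 / (ln n)^2; so the former are eventually at most half of the latter.\<close>

lemma eventually_gapv: "eventually (\<lambda>n. 18 / (real n * block_sep l n) * real j \<le> gapv n / 2) sequentially"
proof -
  let ?A = "24 * 64 * (real l)\<^sup>2 / c\<^sup>2"
  have "(\<lambda>n. (36 * real j * ?A * (ln (real n))\<^sup>2 + 36 * real j * 2) / (real n * block_sep l n)) \<longlonglongrightarrow> 0"
    by (rule block_sep_limit) (use l in simp)
  then have "eventually (\<lambda>n. (36 * real j * ?A * (ln (real n))\<^sup>2 + 36 * real j * 2) / (real n * block_sep l n) < 1) sequentially"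
    by (rule order_tendstoD(2)) simp
  then show ?thesis
    using eventually_ge_at_top [of 3]
  proof eventually_elim
    case (elim n)
    have g: "gapv n > 0" "1 / gapv n \<le> ?A * (ln (real n))\<^sup>2 + 2" using gapv_inverse [OF elim(2)] by auto
    have s: "0 \<le> real n * block_sep l n" using block_sep_nonneg by simp
    have "36 * real j * (1 / gapv n) / (real n * block_sep l n) \<le> 36 * real j * (?A * (ln (real n))\<^sup>2 + 2) / (real n * block_sep l n)"
      using s g by (intro divide_right_mono mult_left_mono) auto
    also have "\<dots> = (36 * real j * ?A * (ln (real n))\<^sup>2 + 36 * real j * 2) / (real n * block_sep l n)"
      by (simp add: algebra_simps)
    also have "\<dots> < 1" by (rule elim(1))
    finally have "(36 * real j / (real n * block_sep l n)) / gapv n < 1" by (simp add: mult_ac)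
    then have "36 * real j / (real n * block_sep l n) < gapv n" using g(1) by (simp only: pos_divide_less_eq mult_1)
    then show ?case by simp
  qed
qed

lemma eventually_block_sep: "eventually (\<lambda>n. block_sep l n > 0) sequentially"
  using eventually_grid_large gap_factor_ge_2 eventually_gt_at_top [of 0]
  by eventually_elim (simp add: block_sep_def)

abbreviation "pt n b k \<equiv> grid (grid_size l n) (b * block_period n + k)"

lemma tuple_hits:
  assumes n: "n > 0" and sep: "block_sep l n > 0" and \<eta>: "36 * real j / (real n * block_sep l n) \<le> 1 / 2"
    and S: "S \<subseteq> {..<block_count l n}" "card S = j" and f: "f \<in> S \<rightarrow>\<^sub>E {..<block_size n}"
  shows "\<bar>prob {\<omega> \<in> space M. \<forall>b\<in>S. \<omega> \<in> hit cell n (pt n b (f b))} - measure (gaussian_measure (1 / sqrt 2)) (rescale n cell) ^ j\<bar> \<le>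
    4 * (36 * real j / (real n * block_sep l n)) * (tuple_const * (measure lborel cell / (real n)\<^sup>2)) ^ j"
proof -
  interpret T: gaussian_trig M \<zeta> n using n by (rule gaussian_trig)
  have fin: "finite S" using S(1) by (rule finite_subset) simp
  have "\<bar>prob {\<omega> \<in> space M. \<forall>b\<in>S. (T.Y 0 (pt n b (f b)) \<omega>, T.Y 1 (pt n b (f b)) \<omega>) \<in> rescale n cell} - measure (gaussian_measure (1 / sqrt 2)) (rescale n cell) ^ card S\<bar>
    \<le> 4 * (36 * real j / (real n * block_sep l n)) * (tuple_const * measure lborel (rescale n cell)) ^ card S"
  proof (rule T.separated_tuple [OF fin sep])
    show "block_sep l n \<le> cmod (1 - cis (pt n i (f i) - pt n k (f k)))" if "k \<in> S" "i \<in> S" "k \<noteq> i" for i k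
      using that S f by (intro block_sep) auto
    show "open (rescale n cell)" by (intro open_rescale open_parallelogram)
    show "bounded (rescale n cell)" by (intro bounded_rescale n bounded_parallelogram c \<tau>)
  qed (use S \<eta> in auto)
  moreover have "{\<omega> \<in> space M. \<forall>b\<in>S. (T.Y 0 (pt n b (f b)) \<omega>, T.Y 1 (pt n b (f b)) \<omega>) \<in> rescale n cell} =
      {\<omega> \<in> space M. \<forall>b\<in>S. \<omega> \<in> hit cell n (pt n b (f b))}"
    by (auto simp: hit_def rescale_def T.Y_def)
  ultimately show ?thesis unfolding S(2) volume_rescale [OF n cell_borel] by simp
qed

text \<open>Exclusion keeps the two hit points of block b0 far enough apart for a spectral gap of
  size \<open>gapv n\<close>; all other pairs lie in different blocks. So
  \<open>close_pair_tuple\<close> bounds all j + 1 values at once.\<close>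

lemma double_hits:
  assumes n: "n \<ge> 3" and sep: "block_sep l n > 0" and gp: "18 / (real n * block_sep l n) * real (Suc j) \<le> gapv n / 2"
    and K: "2 * block_period n \<le> grid_size l n" "grid_size l n > 0"
    and fine: "(real l - 1) / real n \<le> deriv_sd n * (2 * pi / real (grid_size l n))"
    and large: "6 * real l * sqrt (2 * real n + 1) \<le> real n"
    and S: "S \<subseteq> {..<block_count l n}" "card S = j" and f: "f \<in> S \<rightarrow>\<^sub>E {..<block_size n}"
    and b0: "b0 \<in> S" and q: "q < block_size n" "q \<noteq> f b0"
  shows "prob {\<omega> \<in> tame l n. (\<forall>b\<in>S. \<omega> \<in> hit cell n (pt n b (f b))) \<and> \<omega> \<in> hit cell n (pt n b0 q)} \<le>
    (exp (1 / 2) * (4 * rad\<^sup>2 / (gapv n * (real n)\<^sup>2))) ^ Suc j" (is "prob ?E \<le> ?R")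
\<comment> \<open>One outcome in the event is enough: the distance it forces between the two grid
  points does not depend on the outcome.\<close>
proof (cases "?E = {}")
  case True
  have "0 \<le> ?R" by (rule zero_le_power) (simp add: gapv_nonneg)
  then show ?thesis unfolding True by simp
next
  case False
  have n0: "n > 0" using n by simp
  interpret T: gaussian_trig M \<zeta> n using n0 by (rule gaussian_trig)
  have fin: "finite S" using S(1) by (rule finite_subset) simp
  define lo where "lo = min (f b0) q"
  define hi where "hi = max (f b0) q"
  define d where "d = pt n b0 hi - pt n b0 lo"
  have lohi: "lo < hi" "hi < block_size n" using q f b0 by (auto simp: lo_def hi_def)
  have d: "d = 2 * pi / real (grid_size l n) * real (hi - lo)"
    using lohi by (simp add: d_def grid_def of_nat_diff ring_distribs add_divide_distrib diff_divide_distrib mult_ac)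
  have d1: "2 * pi / real (grid_size l n) * 1 \<le> d" unfolding d using lohi by (intro mult_left_mono) auto
  have d0: "d > 0" using d1 K(2) by (simp add: less_le_trans [rotated])
  have "2 * (hi - lo) \<le> grid_size l n" using lohi block_size_le [of n] K(1) by linarith
  then have "2 * real (hi - lo) \<le> real (grid_size l n)" by (metis of_nat_le_iff of_nat_mult of_nat_numeral)
  then have "2 * real (hi - lo) / real (grid_size l n) \<le> 1" using K(2) by simp
  then have "pi * (2 * real (hi - lo) / real (grid_size l n)) \<le> pi * 1" by (intro mult_left_mono) auto
  then have dpi: "d \<le> pi" unfolding d by (simp add: mult_ac)
  have fine': "(real l - 1) / real n \<le> deriv_sd n * d"
  proof -
    have "2 * pi / real (grid_size l n) \<le> d" using d1 by simp
    then have "deriv_sd n * (2 * pi / real (grid_size l n)) \<le> deriv_sd n * d"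
      using deriv_sd_pos [OF n0] by (intro mult_left_mono) auto
    with fine show ?thesis by linarith
  qed
  obtain \<omega> where w: "\<omega> \<in> ?E" using False by auto
  have two: "\<omega> \<in> hit cell n (pt n b0 (f b0))" "\<omega> \<in> hit cell n (pt n b0 q)" using w b0 by auto
  then have "\<omega> \<in> hit cell n (pt n b0 lo)" "\<omega> \<in> hit cell n (pt n b0 hi)"
    by (auto simp: lo_def hi_def min_def max_def)
  moreover have "pt n b0 hi = pt n b0 lo + d" by (simp add: d_def)
  ultimately have "c \<le> 2 * real l * (4 * ln (real n)) * (deriv_sd n * d)"
    using fine' l
    by (intro parallelogram_exclusion [OF n0 tame_second_derivative [OF _ K(2) _ large, of \<omega>] c _ d0])
       (use w n in \<open>auto simp: hit_def\<close>)
  then have "c / (8 * real l * ln (real n)) \<le> deriv_sd n * d"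
    using n l by (simp add: pos_divide_le_eq mult_ac)
  \<comment> \<open>\<open>deriv_sd n\<close> is replaced by n, in which
    \<open>dirichlet_gap\<close> is stated.\<close>
  also have "\<dots> \<le> real n * d"
  proof (intro mult_right_mono)
    have "real n * (real n + 1) \<le> real n * (3 * real n)" using n by (intro mult_left_mono) auto
    then have "(deriv_sd n)\<^sup>2 \<le> (real n)\<^sup>2" unfolding deriv_sd_square unfolding power2_eq_square by simp
    then show "deriv_sd n \<le> real n" by (rule power2_le_imp_le) simp
  qed (use d0 in auto)
  finally have "(c / (8 * real l * ln (real n)))\<^sup>2 \<le> (real n * d)\<^sup>2"
    using n c l by (intro power_mono) auto
  then have gd: "gapv n \<le> min (1 / 2) ((real n * d)\<^sup>2 / 24)" unfolding gapv_def by (intro min.mono) auto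
  have dir: "\<bar>dirichlet n d\<bar> \<le> 1 - gapv n" using dirichlet_gap [OF n0 d0 dpi] gd by linarith
  have dir_sym: "dirichlet n (- d) = dirichlet n d" by (simp add: dirichlet_def)
  \<comment> \<open>\<open>None\<close> stands for the second hit in block b0, \<open>Some b\<close>
    for the selected point of block b.\<close>
  define I where "I = insert None (Some ` S)"
  define \<beta> where "\<beta> i = (case i of None \<Rightarrow> b0 | Some b \<Rightarrow> b)" for i
  define \<pi> where "\<pi> i = (case i of None \<Rightarrow> q | Some b \<Rightarrow> f b)" for i
  define x where "x i = pt n (\<beta> i) (\<pi> i)" for i
  have I: "finite I" "card I = Suc j"
    using fin S by (auto simp: I_def card_image card_insert_if)
  have \<beta>: "\<beta> i < block_count l n" "\<pi> i < block_size n" if "i \<in> I" for i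
    using that S f b0 q by (auto simp: I_def \<beta>_def \<pi>_def split: option.splits)
  have rad: "rad > 0" by (rule parallelogram_radius_pos [OF c C \<tau>])
  have "prob {\<omega> \<in> space M. \<forall>i\<in>I. cmod (T.Y 0 (x i) \<omega>) \<le> rad / real n} \<le> (exp (1 / 2) * (4 * rad\<^sup>2 / (gapv n * (real n)\<^sup>2))) ^ card I"
  proof (rule T.close_pair_tuple [OF I(1) sep _ _ _ _ _ _ _ rad])
    show "None \<in> I" "Some b0 \<in> I" "None \<noteq> Some b0" using b0 by (auto simp: I_def)
    show "block_sep l n \<le> cmod (1 - cis (x k - x i))" if ik: "i \<in> I" "k \<in> I" "i \<noteq> k" "{i, k} \<noteq> {None, Some b0}" for i k
    proof -
      have "\<beta> k \<noteq> \<beta> i" using ik by (auto simp: \<beta>_def I_def split: option.splits)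
      then show ?thesis unfolding x_def using \<beta> ik by (intro block_sep) auto
    qed
    show "gapv n > 0" using gapv_inverse(1) [OF n] .
    have "x None - x (Some b0) = d \<or> x None - x (Some b0) = - d"
      by (auto simp: x_def \<beta>_def \<pi>_def d_def lo_def hi_def min_def max_def)
    then show "\<bar>dirichlet n (x None - x (Some b0))\<bar> \<le> 1 - gapv n" using dir dir_sym by auto
    show "18 / (real n * block_sep l n) * real (card I) \<le> gapv n / 2" unfolding I(2) by (rule gp)
  qed
  moreover have "prob ?E \<le> prob {\<omega> \<in> space M. \<forall>i\<in>I. cmod (T.Y 0 (x i) \<omega>) \<le> rad / real n}"
  proof (rule finite_measure_mono)
    show "{\<omega> \<in> space M. \<forall>i\<in>I. cmod (T.Y 0 (x i) \<omega>) \<le> rad / real n} \<in> events" using I by measurable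
    have hb: "cmod (T.Y 0 y \<omega>) \<le> rad / real n" if "\<omega> \<in> hit cell n y" for y \<omega>
      using parallelogram_bounded [OF _ c \<tau>, of "of_nat n * T.Y 0 y \<omega>" "T.Y 1 y \<omega>" 1 "real l - 1" C] that n0
      by (simp add: hit_def T.Y_def norm_mult field_simps)
    show "?E \<subseteq> {\<omega> \<in> space M. \<forall>i\<in>I. cmod (T.Y 0 (x i) \<omega>) \<le> rad / real n}"
      by (auto simp: I_def x_def \<beta>_def \<pi>_def tame_def intro!: hb)
  qed
  ultimately show ?thesis unfolding I(2) by linarith
qed

theorem block_hits_limit:
  "(\<lambda>n. prob {\<omega> \<in> space M. \<forall>b<block_count l n. \<forall>k<block_size n. \<omega> \<notin> hit cell n (pt n b k)})
    \<longlonglongrightarrow> exp (- (2 * pi / (sqrt 3 * real l) * measure intensity cell))"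
proof (rule poisson_blocks [where A = "\<lambda>n b k. hit cell n (pt n b k)" and G = "tame l"
      and e = "\<lambda>j n. (exp (1 / 2) * (4 * rad\<^sup>2 / (gapv n * (real n)\<^sup>2))) ^ Suc j"
      and \<epsilon> = "\<lambda>j n. 4 * (36 * real j / (real n * block_sep l n)) * (tuple_const * (measure lborel cell / (real n)\<^sup>2)) ^ j"
      and p = "\<lambda>n. measure (gaussian_measure (1 / sqrt 2)) (rescale n cell)"])
  show "hit cell n (pt n b k) \<in> events" for n b k by (rule hit_events [OF cell_borel])
  show "tame l n \<in> events" for n by (rule tame_events)
  show "filterlim (block_count l) at_top sequentially" by (rule block_count_at_top) (use l in simp)
  show "0 \<le> (exp (1 / 2) * (4 * rad\<^sup>2 / (gapv n * (real n)\<^sup>2))) ^ Suc j" for j n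
    by (rule zero_le_power) (simp add: gapv_nonneg)
  have tc: "tuple_const \<ge> 0" by (simp add: tuple_const_def)
  show "0 \<le> 4 * (36 * real j / (real n * block_sep l n)) * (tuple_const * (measure lborel cell / (real n)\<^sup>2)) ^ j" for j n
    using block_sep_nonneg tc by (intro zero_le_power mult_nonneg_nonneg divide_nonneg_nonneg) auto
  have fin: "emeasure intensity cell < \<infinity>" using l by (subst emeasure_parallelogram [OF c _ \<tau>]) auto
  have "(\<lambda>n. real (block_count l n * block_size n) / (real n)\<^sup>2 * ((real n)\<^sup>2 * measure (gaussian_measure (1 / sqrt 2)) (rescale n cell)))
     \<longlonglongrightarrow> 2 * pi / (sqrt 3 * real l) * measure intensity cell"
    by (intro tendsto_mult block_points_limit gaussian_measure_rescale_limit cell_borel fin)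
  moreover have "eventually (\<lambda>n. real (block_count l n * block_size n) / (real n)\<^sup>2 * ((real n)\<^sup>2 * measure (gaussian_measure (1 / sqrt 2)) (rescale n cell)) =
     real (block_count l n) * (real (block_size n) * measure (gaussian_measure (1 / sqrt 2)) (rescale n cell))) sequentially"
    using eventually_gt_at_top [of 0] by eventually_elim simp
  ultimately show "(\<lambda>n. real (block_count l n) * (real (block_size n) * measure (gaussian_measure (1 / sqrt 2)) (rescale n cell))) \<longlonglongrightarrow> 2 * pi / (sqrt 3 * real l) * measure intensity cell"
    by (rule Lim_transform_eventually)
  have \<eta>0: "(\<lambda>n. 36 * real j / (real n * block_sep l n)) \<longlonglongrightarrow> 0" for j
    using block_sep_limit [of l 0 "36 * real j"] l by simp
  show "eventually (\<lambda>n. \<forall>S\<subseteq>{..<block_count l n}. card S = j \<longrightarrow> (\<forall>f\<in>S \<rightarrow>\<^sub>E {..<block_size n}.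
        \<bar>prob {\<omega> \<in> space M. \<forall>b\<in>S. \<omega> \<in> hit cell n (pt n b (f b))} - measure (gaussian_measure (1 / sqrt 2)) (rescale n cell) ^ j\<bar> \<le>
        4 * (36 * real j / (real n * block_sep l n)) * (tuple_const * (measure lborel cell / (real n)\<^sup>2)) ^ j)) sequentially" for j
  proof -
    have "eventually (\<lambda>n. 36 * real j / (real n * block_sep l n) < 1 / 2) sequentially"
      by (rule order_tendstoD(2) [OF \<eta>0]) simp
    then show ?thesis
      using eventually_block_sep eventually_gt_at_top [of 0]
    proof eventually_elim
      case (elim n)
      then show ?case by (intro allI impI ballI tuple_hits) auto
    qed
  qed
  show "eventually (\<lambda>n. \<forall>S\<subseteq>{..<block_count l n}. card S = j \<longrightarrow> (\<forall>f\<in>S \<rightarrow>\<^sub>E {..<block_size n}. \<forall>b0\<in>S. \<forall>q<block_size n. q \<noteq> f b0 \<longrightarrow>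
        prob {\<omega> \<in> tame l n. (\<forall>b\<in>S. \<omega> \<in> hit cell n (pt n b (f b))) \<and> \<omega> \<in> hit cell n (pt n b0 q)} \<le>
        (exp (1 / 2) * (4 * rad\<^sup>2 / (gapv n * (real n)\<^sup>2))) ^ Suc j)) sequentially" for j
    using eventually_block_sep eventually_ge_at_top [of 3] eventually_gapv [of "Suc j"] eventually_grid_large
      eventually_grid_fine eventually_second_derivative
  proof eventually_elim
    case (elim n)
    then show ?case by (intro allI impI ballI double_hits) auto
  qed
  \<comment> \<open>The volume supplies n^(-2j), which balances the number of tuples; the relative
    error from the correlations tends to 0.\<close>
  show "(\<lambda>n. real (block_count l n * block_size n) ^ j * (4 * (36 * real j / (real n * block_sep l n)) * (tuple_const * (measure lborel cell / (real n)\<^sup>2)) ^ j)) \<longlonglongrightarrow> 0" for j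
  proof -
    have "(\<lambda>n. 4 * (36 * real j / (real n * block_sep l n)) * (real (block_count l n * block_size n) / (real n)\<^sup>2 * (tuple_const * measure lborel cell)) ^ j)
       \<longlonglongrightarrow> 4 * 0 * (2 * pi / (sqrt 3 * real l) * (tuple_const * measure lborel cell)) ^ j"
      by (intro tendsto_mult tendsto_power tendsto_const \<eta>0 block_points_limit)
    moreover have "X ^ j * (4 * E * (t * (v / N)) ^ j) = 4 * E * (X / N * (t * v)) ^ j" for X E t v N :: real
      by (simp add: power_mult_distrib power_divide)
    ultimately show ?thesis by (simp only: mult_zero_right mult_zero_left)
  qed
  \<comment> \<open>Here j factors n^(-2) balance the tuples. The remaining one meets the block
    size, at most n^(3/2), and leaves n^(-1/2) against powers of ln n.\<close>
  show "(\<lambda>n. real (block_count l n * block_size n) ^ j * (real (block_size n) * (exp (1 / 2) * (4 * rad\<^sup>2 / (gapv n * (real n)\<^sup>2))) ^ Suc j)) \<longlonglongrightarrow> 0" for j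
  proof (rule Lim_null_comparison)
    let ?A = "24 * 64 * (real l)\<^sup>2 / c\<^sup>2"
    let ?f = "\<lambda>n. (real (block_count l n * block_size n) / (real n)\<^sup>2) ^ j * ((exp (1 / 2) * (4 * rad\<^sup>2)) ^ Suc j * ((?A * (ln (real n))\<^sup>2 + 2) ^ Suc j * (real n) powr (- 1 / 2)))"
    have "?f \<longlonglongrightarrow> (2 * pi / (sqrt 3 * real l)) ^ j * ((exp (1 / 2) * (4 * rad\<^sup>2)) ^ Suc j * 0)"
      by (intro tendsto_mult tendsto_power tendsto_const block_points_limit log_power_limit) auto
    then show "?f \<longlonglongrightarrow> 0" by simp
    show "eventually (\<lambda>n. norm (real (block_count l n * block_size n) ^ j * (real (block_size n) * (exp (1 / 2) * (4 * rad\<^sup>2 / (gapv n * (real n)\<^sup>2))) ^ Suc j)) \<le> ?f n) sequentially"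
      using eventually_ge_at_top [of 3]
    proof eventually_elim
      case (elim n)
      have g: "gapv n > 0" "1 / gapv n \<le> ?A * (ln (real n))\<^sup>2 + 2" using gapv_inverse [OF elim] by auto
      have n0: "real n > 0" using elim by simp
      have hs: "real (block_size n) / (real n)\<^sup>2 \<le> (real n) powr (- 1 / 2)"
      proof -
        have "real (block_size n) \<le> (real n) powr (3 / 2)"
          using block_size_le [of n] block_period_le [of n] by linarith
        then have "real (block_size n) / (real n)\<^sup>2 \<le> (real n) powr (3 / 2) / (real n) powr 2"
          using n0 by (simp add: divide_right_mono)
        also have "\<dots> = (real n) powr (3 / 2 - 2)" by (rule powr_diff [symmetric])
        finally show ?thesis by simp
      qed
      have eq: "X ^ j * (h * (e * (r / (v * N))) ^ Suc j) = (X / N) ^ j * ((e * r) ^ Suc j * ((1 / v) ^ Suc j * (h / N)))" if "N > 0" for X h e r v N :: real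
        using that by (simp add: power_mult_distrib power_divide field_simps)
      have "real (block_count l n * block_size n) ^ j * (real (block_size n) * (exp (1 / 2) * (4 * rad\<^sup>2 / (gapv n * (real n)\<^sup>2))) ^ Suc j) =
        (real (block_count l n * block_size n) / (real n)\<^sup>2) ^ j * ((exp (1 / 2) * (4 * rad\<^sup>2)) ^ Suc j * ((1 / gapv n) ^ Suc j * (real (block_size n) / (real n)\<^sup>2)))"
        using n0 by (intro eq) simp
      also have "\<dots> \<le> ?f n"
        using g hs by (intro mult_left_mono mult_mono power_mono) auto
      finally have le: "real (block_count l n * block_size n) ^ j * (real (block_size n) * (exp (1 / 2) * (4 * rad\<^sup>2 / (gapv n * (real n)\<^sup>2))) ^ Suc j) \<le> ?f n" .
      have "0 \<le> real (block_count l n * block_size n) ^ j * (real (block_size n) * (exp (1 / 2) * (4 * rad\<^sup>2 / (gapv n * (real n)\<^sup>2))) ^ Suc j)"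
        using g by simp
      then show ?case using le by (simp only: real_norm_def abs_of_nonneg)
    qed
  qed
  show "(\<lambda>n. real (block_count l n * block_size n) ^ j * prob (space M - tame l n)) \<longlonglongrightarrow> 0" for j
    by (rule tame_limit)
qed

end

end

section \<open>The minimum modulus\<close>

context gaussian_coefficients
begin

text \<open>Continuity and the density of the rationals leave countably many conditions, which gives
  measurability of the events.\<close>

lemma min_modulus_ge_iff: "y \<le> min_modulus a n \<longleftrightarrow> (\<forall>x\<in>\<rat>. y \<le> cmod (scaled_deriv n 0 a x))"
proof
  assume r: "\<forall>x\<in>\<rat>. y \<le> cmod (scaled_deriv n 0 a x)"
  obtain x where x: "min_modulus a n = cmod (trig_poly a n x)" using min_modulus_attained by metis
  have "closed {x. y \<le> cmod (scaled_deriv n 0 a x)}"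
    unfolding scaled_deriv_def trig_coeff_def cis_conv_exp by (intro closed_Collect_le continuous_intros)
  then have "closure \<rat> \<subseteq> {x. y \<le> cmod (scaled_deriv n 0 a x)}"
    using r by (intro closure_minimal) auto
  then have "y \<le> cmod (scaled_deriv n 0 a x)" by (auto simp: Rats_closure_real)
  then show "y \<le> min_modulus a n" by (simp add: x trig_poly_scaled_deriv)
qed (use min_modulus_le order_trans in blast)

lemma min_modulus_events: "{\<omega> \<in> space M. y \<le> min_modulus (\<lambda>j. \<zeta> j \<omega>) n} \<in> events"
  unfolding min_modulus_ge_iff by (rule sets.sets_Collect_countable_All') (measurable, rule countable_rat)

definition missed :: "nat \<Rightarrow> real \<Rightarrow> real \<Rightarrow> real \<Rightarrow> nat \<Rightarrow> 'a set" where
  "missed l c C t n = {\<omega> \<in> space M. \<forall>b<block_count l n. \<forall>k<block_size n.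
     \<omega> \<notin> hit (parallelogram 1 (real l - 1) c C t) n (grid (grid_size l n) (b * block_period n + k))}"

lemma missed_events: "missed l c C t n \<in> events"
proof -
  have "missed l c C t n = space M - (\<Union>b<block_count l n. \<Union>k<block_size n.
     hit (parallelogram 1 (real l - 1) c C t) n (grid (grid_size l n) (b * block_period n + k)))"
    by (auto simp: missed_def)
  then show ?thesis using hit_events open_parallelogram by (auto intro!: sets.Diff sets.finite_UN)
qed

lemma ln_over_limit: "(\<lambda>n. A * (4 * ln (real n)) / real n) \<longlonglongrightarrow> 0"
proof -
  have "(\<lambda>n. 4 * ln (real n) / real n) \<longlonglongrightarrow> 0" by real_asymp
  from tendsto_mult_left [OF this, of A] show ?thesis by simp
qed

text \<open>A hit at level t forces n times the minimum below t + O(ln n / n), hence eventually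
  below \<tau>; the slack \<tau> - t absorbs the linearisation.\<close>

lemma min_modulus_upper:
  assumes l: "l \<ge> 3" and c: "c > 0" and C: "C > 0" and t: "0 < t" "t < \<tau>"
  shows "eventually (\<lambda>n. prob {\<omega> \<in> space M. \<tau> / real n \<le> min_modulus (\<lambda>j. \<zeta> j \<omega>) n} \<le>
    prob (missed l c C t n) + prob (space M - tame l n)) sequentially"
proof -
  let ?A = "(parallelogram_radius 1 (real l - 1) c C t / c)\<^sup>2"
  have "eventually (\<lambda>n. ?A * (4 * ln (real n)) / real n < \<tau> - t) sequentially"
    by (rule order_tendstoD(2) [OF ln_over_limit]) (use t in simp)
  then show ?thesis
    using eventually_grid_large [OF l c C t(1)] eventually_second_derivative [OF l c C t(1)] eventually_ge_at_top [of 1]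
  proof eventually_elim
    case (elim n)
    have "{\<omega> \<in> space M. \<tau> / real n \<le> min_modulus (\<lambda>j. \<zeta> j \<omega>) n} \<subseteq> missed l c C t n \<union> (space M - tame l n)"
    proof
      fix \<omega> assume w: "\<omega> \<in> {\<omega> \<in> space M. \<tau> / real n \<le> min_modulus (\<lambda>j. \<zeta> j \<omega>) n}"
      have False if tm: "\<omega> \<in> tame l n" and h: "\<omega> \<in> hit (parallelogram 1 (real l - 1) c C t) n x" for x
      proof -
        have S: "cmod (scaled_deriv n 2 (\<lambda>j. \<zeta> j \<omega>) y) \<le> 4 * ln (real n)" for y
          by (rule tame_second_derivative [OF _ _ _ _ tm]) (use elim l in auto)
        have "min_modulus (\<lambda>j. \<zeta> j \<omega>) n < (t + ?A * (4 * ln (real n)) / real n) / real n"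
          by (rule parallelogram_min_modulus [OF _ S c t(1)]) (use h elim in \<open>auto simp: hit_def\<close>)
        also have "\<dots> \<le> \<tau> / real n" using elim by (intro divide_right_mono) auto
        finally show False using w by simp
      qed
      then show "\<omega> \<in> missed l c C t n \<union> (space M - tame l n)" using w by (auto simp: missed_def)
    qed
    then have "prob {\<omega> \<in> space M. \<tau> / real n \<le> min_modulus (\<lambda>j. \<zeta> j \<omega>) n} \<le> prob (missed l c C t n \<union> (space M - tame l n))"
      using missed_events tame_events by (intro finite_measure_mono) auto
    also have "\<dots> \<le> prob (missed l c C t n) + prob (space M - tame l n)"
      using missed_events tame_events by (intro measure_Un_le) auto
    finally show ?case .
  qed
qed

lemma strip_mono: "t \<le> t' \<Longrightarrow> strip L t \<subseteq> strip L t'"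
  unfolding strip_def by force

lemma block_points:
  defines "Q \<equiv> \<lambda>l n. (\<lambda>(b, k). b * block_period n + k) ` ({..<block_count l n} \<times> {..<block_size n})"
  shows "Q l n \<subseteq> {..<grid_size l n}" "card (Q l n) = block_count l n * block_size n"
proof -
  have lt: "b * block_period n + k < grid_size l n" if "b < block_count l n" "k < block_size n" for b k
  proof -
    have "b * block_period n + k < b * block_period n + block_period n" using that block_size_le [of n] by linarith
    also have "\<dots> = Suc b * block_period n" by simp
    also have "\<dots> \<le> block_count l n * block_period n" using that by (intro mult_le_mono1) simp
    also have "\<dots> \<le> grid_size l n" by (simp add: block_count_def)
    finally show ?thesis .
  qed
  then show "Q l n \<subseteq> {..<grid_size l n}" by (auto simp: Q_def)
  have "inj_on (\<lambda>(b, k). b * block_period n + k) ({..<block_count l n} \<times> {..<block_size n})"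
  proof (rule inj_onI, clarsimp)
    fix b k b' k' assume a: "k < block_size n" "k' < block_size n" "b * block_period n + k = b' * block_period n + k'"
    have k: "k < block_period n" "k' < block_period n" using a block_size_le [of n] by linarith+
    have "(b * block_period n + k) div block_period n = b" "(b' * block_period n + k') div block_period n = b'"
      using k by simp_all
    then have "b = b'" using a(3) by simp
    then show "b = b' \<and> k = k'" using a(3) by simp
  qed
  then show "card (Q l n) = block_count l n * block_size n"
    by (simp add: Q_def card_image card_cartesian_product)
qed

lemma min_modulus_lower:
  assumes l: "l \<ge> 3" and c: "c > 0" and C: "C > 0" and t: "0 < \<tau>" "\<tau> < t"
  defines "B \<equiv> parallelogram 1 (real l - 1) c C t"
  shows "eventually (\<lambda>n. prob (missed l c C t n) - prob (space M - tame l n)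
      - real (grid_size l n) / (real n)\<^sup>2 * measure intensity (strip (real l) t - B)
      - (real (grid_size l n) / (real n)\<^sup>2 - real (block_count l n * block_size n) / (real n)\<^sup>2) * measure intensity B
    \<le> prob {\<omega> \<in> space M. \<tau> / real n \<le> min_modulus (\<lambda>j. \<zeta> j \<omega>) n}) sequentially"
proof -
  have t0: "t > 0" using t by simp
  have [measurable]: "B \<in> sets borel" "strip (real l) t \<in> sets borel"
    using open_parallelogram open_strip by (auto simp: B_def)
  have finB: "emeasure intensity B < \<infinity>" unfolding B_def using l by (subst emeasure_parallelogram [OF c _ t0]) auto
  have finD: "emeasure intensity (strip (real l) t - B) < \<infinity>"
    unfolding B_def using emeasure_strip_diff [OF c t0, of l C] l by (simp add: le_less_trans)
  have "eventually (\<lambda>n. (real l)\<^sup>2 * (4 * ln (real n)) / real n < t - \<tau>) sequentially"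
    by (rule order_tendstoD(2) [OF ln_over_limit]) (use t in simp)
  then show ?thesis
    using eventually_grid_large [OF l c C t0] eventually_second_derivative [OF l c C t0] eventually_ge_at_top [of 1]
  proof eventually_elim
    case (elim n)
    have n: "n > 0" using elim by simp
    define Q where "Q = (\<lambda>(b, k). b * block_period n + k) ` ({..<block_count l n} \<times> {..<block_size n})"
    have Q: "Q \<subseteq> {..<grid_size l n}" "card Q = block_count l n * block_size n"
      unfolding Q_def by (rule block_points)+
    let ?g = "grid (grid_size l n)"
    let ?W = "{\<omega> \<in> space M. \<tau> / real n \<le> min_modulus (\<lambda>j. \<zeta> j \<omega>) n}"
    let ?D = "\<Union>k<grid_size l n. hit (strip (real l) t - B) n (?g k)"
    let ?G = "\<Union>k\<in>{..<grid_size l n} - Q. hit B n (?g k)"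
    have ev: "hit (strip (real l) t - B) n x \<in> events" "hit B n x \<in> events" for x
      by (intro hit_events; measurable)+
    have sub: "missed l c C t n \<subseteq> ((?W \<union> (space M - tame l n)) \<union> ?D) \<union> ?G"
    proof
      fix \<omega> assume w: "\<omega> \<in> missed l c C t n"
      then have ws: "\<omega> \<in> space M" by (simp add: missed_def)
      show "\<omega> \<in> ((?W \<union> (space M - tame l n)) \<union> ?D) \<union> ?G"
      proof (cases "\<omega> \<in> tame l n \<and> min_modulus (\<lambda>j. \<zeta> j \<omega>) n < \<tau> / real n")
        case True
        have S: "cmod (scaled_deriv n 2 (\<lambda>j. \<zeta> j \<omega>) y) \<le> 4 * ln (real n)" for y
          by (rule tame_second_derivative) (use elim l True in auto)
        have Kl: "2 * pi * (real n * deriv_sd n) / real (grid_size l n) \<le> real l"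
          using grid_size_bounds(1) [of n l] elim l by (simp add: field_simps)
        obtain k where k: "k < grid_size l n"
          "(of_nat n * scaled_deriv n 0 (\<lambda>j. \<zeta> j \<omega>) (?g k), scaled_deriv n 1 (\<lambda>j. \<zeta> j \<omega>) (?g k)) \<in> strip (real l) (\<tau> + (real l)\<^sup>2 * (4 * ln (real n)) / real n)"
          using min_modulus_strip [OF n S _ Kl] True elim by blast
        have "strip (real l) (\<tau> + (real l)\<^sup>2 * (4 * ln (real n)) / real n) \<subseteq> strip (real l) t"
          using elim by (intro strip_mono) simp
        then have hD: "\<omega> \<in> hit (strip (real l) t) n (?g k)" using k ws by (auto simp: hit_def)
        have "k \<notin> Q" if hB: "\<omega> \<in> hit B n (?g k)"
        proof
          assume "k \<in> Q"
          then show False using w hB by (auto simp: Q_def missed_def B_def)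
        qed
        then show ?thesis using hD k(1) by (auto simp: hit_def)
      qed (use ws in auto)
    qed
    have pD: "prob ?D \<le> real (grid_size l n) / (real n)\<^sup>2 * measure intensity (strip (real l) t - B)"
    proof -
      have "prob ?D \<le> (\<Sum>k<grid_size l n. prob (hit (strip (real l) t - B) n (?g k)))"
        using ev by (intro finite_measure_subadditive_finite) auto
      also have "\<dots> \<le> (\<Sum>k<grid_size l n. measure intensity (strip (real l) t - B) / (real n)\<^sup>2)"
        using gaussian_measure_rescale_le [OF n _ finD] by (intro sum_mono) (simp add: hit_prob [OF n])
      finally show ?thesis by simp
    qed
    have pG: "prob ?G \<le> (real (grid_size l n) / (real n)\<^sup>2 - real (block_count l n * block_size n) / (real n)\<^sup>2) * measure intensity B"
    proof -
      have "prob ?G \<le> (\<Sum>k\<in>{..<grid_size l n} - Q. prob (hit B n (?g k)))"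
        using ev by (intro finite_measure_subadditive_finite) auto
      also have "\<dots> \<le> (\<Sum>k\<in>{..<grid_size l n} - Q. measure intensity B / (real n)\<^sup>2)"
        using gaussian_measure_rescale_le [OF n _ finB] by (intro sum_mono) (simp add: hit_prob [OF n])
      also have "\<dots> = real (card ({..<grid_size l n} - Q)) * (measure intensity B / (real n)\<^sup>2)" by simp
      also have "real (card ({..<grid_size l n} - Q)) = real (grid_size l n) - real (block_count l n * block_size n)"
      proof -
        have "card Q \<le> grid_size l n" using card_mono [OF _ Q(1)] by simp
        then show ?thesis using Q by (subst card_Diff_subset) (auto intro: finite_subset simp: of_nat_diff simp del: of_nat_mult)
      qed
      finally show ?thesis by (simp add: left_diff_distrib diff_divide_distrib)
    qed
    have W: "?W \<in> events" by (rule min_modulus_events)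
    have "prob (missed l c C t n) \<le> prob (((?W \<union> (space M - tame l n)) \<union> ?D) \<union> ?G)"
      using ev W tame_events by (intro finite_measure_mono sub) auto
    also have "\<dots> \<le> prob ((?W \<union> (space M - tame l n)) \<union> ?D) + prob ?G"
      using ev W tame_events by (intro measure_Un_le) auto
    also have "prob ((?W \<union> (space M - tame l n)) \<union> ?D) \<le> prob (?W \<union> (space M - tame l n)) + prob ?D"
      using ev W tame_events by (intro measure_Un_le) auto
    also have "prob (?W \<union> (space M - tame l n)) \<le> prob ?W + prob (space M - tame l n)"
      using W tame_events by (intro measure_Un_le) auto
    finally show ?case using pD pG by linarith
  qed
qed

end

text \<open>Expresses that the limit inferior of f is at least x. Bounds in this form pass through
  the limits in l, then c and C, then t, while f stays fixed.\<close>

definition asymp_ge :: "(nat \<Rightarrow> real) \<Rightarrow> real \<Rightarrow> bool" where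
  "asymp_ge f x \<longleftrightarrow> (\<forall>\<rho>>0. eventually (\<lambda>n. x - \<rho> \<le> f n) sequentially)"

lemma asymp_geI:
  assumes "eventually (\<lambda>n. g n \<le> f n) sequentially" "g \<longlonglongrightarrow> y" "x \<le> y"
  shows "asymp_ge f x"
  unfolding asymp_ge_def
proof (intro allI impI)
  fix \<rho> :: real assume "\<rho> > 0"
  then have "eventually (\<lambda>n. x - \<rho> < g n) sequentially"
    using assms by (intro order_tendstoD(1) [of _ y]) auto
  with assms(1) show "eventually (\<lambda>n. x - \<rho> \<le> f n) sequentially" by eventually_elim simp
qed

lemma asymp_ge_limit:
  assumes f: "eventually (\<lambda>k. asymp_ge f (g k)) sequentially" and g: "g \<longlonglongrightarrow> x"
  shows "asymp_ge f x"
  unfolding asymp_ge_def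
proof (intro allI impI)
  fix \<rho> :: real assume \<rho>: "\<rho> > 0"
  have "eventually (\<lambda>k. x - \<rho> / 2 < g k) sequentially" using g \<rho> by (intro order_tendstoD(1)) auto
  with f have "eventually (\<lambda>k. asymp_ge f (g k) \<and> x - \<rho> / 2 < g k) sequentially" by (rule eventually_conj)
  then obtain k where k: "asymp_ge f (g k)" "x - \<rho> / 2 < g k" by (auto dest!: eventually_happens)
  have "eventually (\<lambda>n. g k - \<rho> / 2 \<le> f n) sequentially" using k(1) \<rho> by (simp add: asymp_ge_def)
  then show "eventually (\<lambda>n. x - \<rho> \<le> f n) sequentially" by eventually_elim (use k(2) in linarith)
qed

lemma asymp_ge_tendsto:
  assumes "asymp_ge f x" "asymp_ge (\<lambda>n. - f n) (- x)"
  shows "f \<longlonglongrightarrow> x"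
proof (rule LIMSEQ_I)
  fix r :: real assume r: "r > 0"
  have "eventually (\<lambda>n. x - r / 2 \<le> f n) sequentially" "eventually (\<lambda>n. - x - r / 2 \<le> - f n) sequentially"
    using assms r by (simp_all add: asymp_ge_def)
  then have "eventually (\<lambda>n. norm (f n - x) < r) sequentially" by eventually_elim (use r in auto)
  then show "\<exists>n0. \<forall>n\<ge>n0. norm (f n - x) < r" by (simp add: eventually_sequentially)
qed

context gaussian_coefficients
begin

abbreviation "survival \<tau> n \<equiv> prob {\<omega> \<in> space M. \<tau> / real n \<le> min_modulus (\<lambda>j. \<zeta> j \<omega>) n}"

text \<open>The density 2 pi / (sqrt 3 l) of grid points meets the intensity 2 t (l - 2) / pi times
  the slope integral; pi cancels.\<close>

lemma missed_limit:
  assumes l: "l \<ge> 3" and c: "c > 0" and C: "C > 0" and t: "t > 0"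
  shows "(\<lambda>n. prob (missed l c C t n)) \<longlonglongrightarrow> exp (- (4 / sqrt 3 * t * ((real l - 2) / real l) * slope_integral c C))"
proof -
  have "measure intensity (parallelogram 1 (real l - 1) c C t) = 2 * t * (real l - 1 - 1) / pi * slope_integral c C"
    unfolding measure_def using l t slope_integral_nonneg [of c C] by (subst emeasure_parallelogram [OF c _ t]) simp_all
  then have eq: "2 * pi / (sqrt 3 * real l) * measure intensity (parallelogram 1 (real l - 1) c C t) =
     4 / sqrt 3 * t * ((real l - 2) / real l) * slope_integral c C"
    using l by (simp add: field_simps)
  show ?thesis using block_hits_limit [OF l c C t] unfolding eq missed_def .
qed

lemma untame_limit: "(\<lambda>n. prob (space M - tame l n)) \<longlonglongrightarrow> 0"
  using tame_limit [of l 0] by simp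

text \<open>Stated for the negative, so that both bounds are instances of \<open>asymp_ge\<close>.
  The exponent is continuous in each parameter, and no error term has to be balanced.\<close>

lemma survival_upper:
  assumes \<tau>: "\<tau> > 0"
  shows "asymp_ge (\<lambda>n. - survival \<tau> n) (- exp (- (2 * sqrt (pi / 3) * \<tau>)))"
proof -
  have 1: "asymp_ge (\<lambda>n. - survival \<tau> n) (- exp (- (4 / sqrt 3 * t * ((real l - 2) / real l) * slope_integral c C)))"
    if "l \<ge> 3" "c > 0" "C > 0" "0 < t" "t < \<tau>" for l c C t
  proof (rule asymp_geI)
    show "eventually (\<lambda>n. - (prob (missed l c C t n) + prob (space M - tame l n)) \<le> - survival \<tau> n) sequentially"
      using min_modulus_upper [OF that] by eventually_elim simp
    show "(\<lambda>n. - (prob (missed l c C t n) + prob (space M - tame l n))) \<longlonglongrightarrow>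
      - (exp (- (4 / sqrt 3 * t * ((real l - 2) / real l) * slope_integral c C)) + 0)"
      by (intro tendsto_intros missed_limit untame_limit that)
  qed simp
  have lim_l: "(\<lambda>l. (real l - 2) / real l) \<longlonglongrightarrow> 1" by real_asymp
  have 2: "asymp_ge (\<lambda>n. - survival \<tau> n) (- exp (- (4 / sqrt 3 * t * 1 * slope_integral c C)))"
    if "c > 0" "C > 0" "0 < t" "t < \<tau>" for c C t
  proof (rule asymp_ge_limit)
    show "eventually (\<lambda>l. asymp_ge (\<lambda>n. - survival \<tau> n) (- exp (- (4 / sqrt 3 * t * ((real l - 2) / real l) * slope_integral c C)))) sequentially"
      using eventually_ge_at_top [of 3] by eventually_elim (rule 1 [OF _ that])
  qed (intro tendsto_intros lim_l)
  have 3: "asymp_ge (\<lambda>n. - survival \<tau> n) (- exp (- (4 / sqrt 3 * t * 1 * (sqrt pi / 2))))"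
    if "0 < t" "t < \<tau>" for t
  proof (rule asymp_ge_limit)
    show "eventually (\<lambda>i. asymp_ge (\<lambda>n. - survival \<tau> n) (- exp (- (4 / sqrt 3 * t * 1 * slope_integral (1 / real (Suc i)) (real (Suc i)))))) sequentially"
      by (intro always_eventually allI 2 that) auto
  qed (intro tendsto_intros slope_integral_limit)
  have "asymp_ge (\<lambda>n. - survival \<tau> n) (- exp (- (4 / sqrt 3 * \<tau> * 1 * (sqrt pi / 2))))"
  proof (rule asymp_ge_limit)
    show "eventually (\<lambda>k. asymp_ge (\<lambda>n. - survival \<tau> n) (- exp (- (4 / sqrt 3 * (\<tau> * (real (Suc k) / real (Suc (Suc k)))) * 1 * (sqrt pi / 2))))) sequentially"
    proof (intro always_eventually allI 3)
      fix k
      show "0 < \<tau> * (real (Suc k) / real (Suc (Suc k)))" using \<tau> by simp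
      have "\<tau> * (real (Suc k) / real (Suc (Suc k))) < \<tau> * 1" using \<tau> by (intro mult_strict_left_mono) auto
      then show "\<tau> * (real (Suc k) / real (Suc (Suc k))) < \<tau>" by simp
    qed
    have "(\<lambda>k. real (Suc k) / real (Suc (Suc k))) \<longlonglongrightarrow> 1" by real_asymp
    from tendsto_mult_left [OF this, of \<tau>]
    show "(\<lambda>k. - exp (- (4 / sqrt 3 * (\<tau> * (real (Suc k) / real (Suc (Suc k)))) * 1 * (sqrt pi / 2)))) \<longlonglongrightarrow> - exp (- (4 / sqrt 3 * \<tau> * 1 * (sqrt pi / 2)))"
      by (intro tendsto_intros) simp
  qed
  \<comment> \<open>4 / sqrt 3 times E|Z| = sqrt pi / 2 is 2 sqrt (pi / 3).\<close>
  then show ?thesis by (simp add: real_sqrt_divide mult_ac)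
qed

text \<open>The order of limits matters. The cell-end error blows up as c \<rightarrow> 0 but does
  not grow with l, so l \<rightarrow> \<infinity> removes it first; the slope error keeps a bounded
  weight in that limit and vanishes afterwards as c \<rightarrow> 0 and C \<rightarrow>
  \<infinity>.\<close>

lemma survival_lower:
  assumes \<tau>: "\<tau> > 0"
  shows "asymp_ge (survival \<tau>) (exp (- (2 * sqrt (pi / 3) * \<tau>)))"
proof -
  define a where "a l = 2 * pi / (sqrt 3 * real l)" for l :: nat
  define E where "E l c C t = 2 * t * (2 + 2 * (t / c)) / pi * slope_integral c C + (real l + 1) * tail_integral t c C" for l :: nat and c C t
  have 1: "asymp_ge (survival \<tau>) (exp (- (4 / sqrt 3 * t * ((real l - 2) / real l) * slope_integral c C)) - a l * E l c C t)"
    if h: "l \<ge> 3" "c > 0" "C > 0" "\<tau> < t" for l c C t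
  proof (rule asymp_geI [OF min_modulus_lower [OF h(1,2,3) \<tau> h(4)]])
    have t0: "t > 0" using h \<tau> by simp
    let ?B = "parallelogram 1 (real l - 1) c C t"
    have ED: "measure intensity (strip (real l) t - ?B) \<le> E l c C t"
    proof -
      have "0 \<le> E l c C t" unfolding E_def using t0 h slope_integral_nonneg [of c C] tail_integral_nonneg [of t c C] by simp
      moreover have "emeasure intensity (strip (real l) t - ?B) \<le> ennreal (E l c C t)"
        unfolding E_def using emeasure_strip_diff [OF h(2) t0, of l C] h(1) by simp
      ultimately show ?thesis unfolding measure_def by (simp add: enn2real_leI)
    qed
    show "(\<lambda>n. prob (missed l c C t n) - prob (space M - tame l n)
      - real (grid_size l n) / (real n)\<^sup>2 * measure intensity (strip (real l) t - ?B)
      - (real (grid_size l n) / (real n)\<^sup>2 - real (block_count l n * block_size n) / (real n)\<^sup>2) * measure intensity ?B)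
      \<longlonglongrightarrow> exp (- (4 / sqrt 3 * t * ((real l - 2) / real l) * slope_integral c C)) - 0 - a l * measure intensity (strip (real l) t - ?B)
        - (a l - a l) * measure intensity ?B"
      unfolding a_def by (intro tendsto_diff tendsto_mult tendsto_const missed_limit untame_limit grid_size_limit block_points_limit h t0)
    show "exp (- (4 / sqrt 3 * t * ((real l - 2) / real l) * slope_integral c C)) - a l * E l c C t \<le>
      exp (- (4 / sqrt 3 * t * ((real l - 2) / real l) * slope_integral c C)) - 0 - a l * measure intensity (strip (real l) t - ?B)
        - (a l - a l) * measure intensity ?B"
      using mult_left_mono [OF ED, of "a l"] by (simp add: a_def)
  qed
  have lim_l: "(\<lambda>l. (real l - 2) / real l) \<longlonglongrightarrow> 1" by real_asymp
  have a0: "a \<longlonglongrightarrow> 0"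
  proof -
    have "(\<lambda>l. 1 / real l) \<longlonglongrightarrow> 0" by real_asymp
    from tendsto_mult_left [OF this, of "2 * pi / sqrt 3"] show ?thesis by (simp add: a_def [abs_def])
  qed
  have a1: "(\<lambda>l. a l * (real l + 1)) \<longlonglongrightarrow> 2 * pi / sqrt 3"
  proof -
    have "(\<lambda>l. (real l + 1) / real l) \<longlonglongrightarrow> 1" by real_asymp
    from tendsto_mult_left [OF this, of "2 * pi / sqrt 3"] show ?thesis by (simp add: a_def [abs_def])
  qed
  have 2: "asymp_ge (survival \<tau>) (exp (- (4 / sqrt 3 * t * 1 * slope_integral c C)) - (0 * (2 * t * (2 + 2 * (t / c)) / pi * slope_integral c C) + 2 * pi / sqrt 3 * tail_integral t c C))"
    if h: "c > 0" "C > 0" "\<tau> < t" for c C t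
  proof (rule asymp_ge_limit)
    show "eventually (\<lambda>l. asymp_ge (survival \<tau>) (exp (- (4 / sqrt 3 * t * ((real l - 2) / real l) * slope_integral c C))
        - (a l * (2 * t * (2 + 2 * (t / c)) / pi * slope_integral c C) + (a l * (real l + 1)) * tail_integral t c C))) sequentially"
      using eventually_ge_at_top [of 3]
    proof eventually_elim
      case (elim l)
      have "a l * E l c C t = a l * (2 * t * (2 + 2 * (t / c)) / pi * slope_integral c C) + (a l * (real l + 1)) * tail_integral t c C"
      proof -
        have "x * (y + u * v) = x * y + (x * u) * v" for x y u v :: real by (simp add: algebra_simps)
        then show ?thesis unfolding E_def .
      qed
      with 1 [OF elim h] show ?case by (simp only:)
    qed
    show "(\<lambda>l. exp (- (4 / sqrt 3 * t * ((real l - 2) / real l) * slope_integral c C))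
        - (a l * (2 * t * (2 + 2 * (t / c)) / pi * slope_integral c C) + (a l * (real l + 1)) * tail_integral t c C)) \<longlonglongrightarrow>
      exp (- (4 / sqrt 3 * t * 1 * slope_integral c C)) - (0 * (2 * t * (2 + 2 * (t / c)) / pi * slope_integral c C) + 2 * pi / sqrt 3 * tail_integral t c C)"
      by (intro tendsto_diff tendsto_add tendsto_exp tendsto_minus tendsto_mult tendsto_const lim_l a0 a1)
  qed
  have 3: "asymp_ge (survival \<tau>) (exp (- (4 / sqrt 3 * t * 1 * (sqrt pi / 2))) - 2 * pi / sqrt 3 * 0)" if "\<tau> < t" for t
  proof (rule asymp_ge_limit)
    show "eventually (\<lambda>i. asymp_ge (survival \<tau>) (exp (- (4 / sqrt 3 * t * 1 * slope_integral (1 / real (Suc i)) (real (Suc i))))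
       - 2 * pi / sqrt 3 * tail_integral t (1 / real (Suc i)) (real (Suc i)))) sequentially"
    proof (intro always_eventually allI)
      fix i
      show "asymp_ge (survival \<tau>) (exp (- (4 / sqrt 3 * t * 1 * slope_integral (1 / real (Suc i)) (real (Suc i))))
       - 2 * pi / sqrt 3 * tail_integral t (1 / real (Suc i)) (real (Suc i)))"
        using 2 [of "1 / real (Suc i)" "real (Suc i)" t] that by simp
    qed
    show "(\<lambda>i. exp (- (4 / sqrt 3 * t * 1 * slope_integral (1 / real (Suc i)) (real (Suc i))))
       - 2 * pi / sqrt 3 * tail_integral t (1 / real (Suc i)) (real (Suc i))) \<longlonglongrightarrow> exp (- (4 / sqrt 3 * t * 1 * (sqrt pi / 2))) - 2 * pi / sqrt 3 * 0"
      by (intro tendsto_diff tendsto_exp tendsto_minus tendsto_mult tendsto_const slope_integral_limit tail_integral_limit)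
  qed
  have "asymp_ge (survival \<tau>) (exp (- (4 / sqrt 3 * \<tau> * 1 * (sqrt pi / 2))))"
  proof (rule asymp_ge_limit)
    show "eventually (\<lambda>k. asymp_ge (survival \<tau>) (exp (- (4 / sqrt 3 * (\<tau> + 1 / real (Suc k)) * 1 * (sqrt pi / 2))))) sequentially"
    proof (intro always_eventually allI)
      fix k
      show "asymp_ge (survival \<tau>) (exp (- (4 / sqrt 3 * (\<tau> + 1 / real (Suc k)) * 1 * (sqrt pi / 2))))"
        using 3 [of "\<tau> + 1 / real (Suc k)"] by simp
    qed
    have "(\<lambda>k. 1 / real (Suc k)) \<longlonglongrightarrow> 0" by real_asymp
    from tendsto_add [OF tendsto_const [of \<tau>] this]
    show "(\<lambda>k. exp (- (4 / sqrt 3 * (\<tau> + 1 / real (Suc k)) * 1 * (sqrt pi / 2)))) \<longlonglongrightarrow> exp (- (4 / sqrt 3 * \<tau> * 1 * (sqrt pi / 2)))"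
      by (intro tendsto_intros) simp
  qed
  then show ?thesis by (simp add: real_sqrt_divide mult_ac)
qed

end

theorem theorem1:
  fixes M :: "'a measure" and \<zeta> :: "int \<Rightarrow> 'a \<Rightarrow> complex" and \<tau> :: real
  assumes "prob_space M"
    and "prob_space.indep_vars M (\<lambda>_. borel) \<zeta> UNIV"
    and "\<And>j. std_complex_gaussian M (\<zeta> j)"
    and "\<tau> > 0"
  shows "(\<lambda>n. measure M {\<omega> \<in> space M. min_modulus (\<lambda>j. \<zeta> j \<omega>) n \<ge> \<tau> / real n})
           \<longlonglongrightarrow> exp (- (2 * sqrt (pi / 3)) * \<tau>)"
proof -
  interpret gaussian_coefficients M \<zeta>
    by (intro gaussian_coefficients.intro gaussian_coefficients_axioms.intro assms)
  show ?thesis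
    using asymp_ge_tendsto [OF survival_lower [OF assms(4)] survival_upper [OF assms(4)]] by simp
qed

end
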